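(* Let $(M,D,J)$ be a 3-dimensional strictly pseudoconvex tubular CR manifold with defining equation $v=F(y)$ in $\mathbb C^2$ with coordinates $(z=x+\mathrm i y,\ w=u+\mathrm i v)$, where $F$ is a smooth real-valued function of the real variable $y$, and let $\Lambda$ be an arbitrary real constant. Then there exists a 4-dimensional Lorentzian manifold $(\mathscr M=M\times\mathbb R,\,g)$, which is a lift of $M$, such that $g$ is of Petrov type II or D and satisfies the quasi-Einstein equation $$\operatorname{Ric}(g)=\Lambda g+\Phi\lambda^2,$$ where $\Phi$ is some real function on $\mathscr M$ and $\lambda$ is the (pullback to $\mathscr M$ of the) real 1-form on $M$ with kernel $D$ appearing in the lift.
   Context: CR manifolds. A 3-dimensional CR manifold $(M,D,J)$ is a 3-manifold $M$ with a rank 2 distribution $D\subset TM$ and a smooth field of endomorphisms $J\colon D\to D$, $J^2=-\mathrm{Id}$. It is strictly pseudoconvex if $[X,JX]\notin D$ at every point for every local non-vanishing section $X$ of $D$. For such $X$ put $\partial=X-\mathrm iJX$, $\partial_o=\mathrm i[\partial,\bar\partial]$; then $(\partial,\bar\partial,\partial_o)$ is called an adapted frame, and its dual coframe $(\mu,\bar\mu,\lambda)$ (abbreviated $(\mu,\lambda)$) an adapted coframe; $\mu$ is a complex 1-form, $\lambda$ a real 1-form, $\ker\lambda=D$, and $\mu|_D$ is a complex coordinate on $D$. A tubular CR manifold is a real hypersurface $v=F(y)$ in $\mathbb C^2$ with the CR structure $D=TM\cap \mathrm i\,TM$, $J$ = multiplication by $\mathrm i$; strict pseudoconvexity means that $F_{yy}$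 is nowhere zero. Lifts. The symmetric product of 1-forms is $\omega\gamma=\frac12(\omega\otimes\gamma+\gamma\otimes\omega)$. A lift of $(M,D,J)$ is $\mathscr M=M\times\mathbb R$ with a Lorentzian metric of the form $$g=2\mathscr P^2\left(\mu\bar\mu+\lambda\left(dr+\mathscr W\mu+\overline{\mathscr W}\bar\mu+\mathscr H\lambda\right)\right),$$ where $(\mu,\lambda)$ is (the pullback of) an adapted coframe on $M$, $\mathscr P\neq0$, $r$ and $\mathscr H$ are real functions on $\mathscr M$ and $\mathscr W$ is a complex function on $\mathscr M$. The vector field $\partial_r$ is then null and shearfree for $g$. Petrov type. Let $$e_1=\tfrac1{\mathscr P}(\partial-\mathscr W\partial_r),\quad e_2=\overline{e_1},\quad e_3=\tfrac1{\mathscr P}(\partial_o-\mathscr H\partial_r),\quad e_4=\tfrac1{\mathscr P}\partial_r$$ be the frame dual to $\theta^1=\mathscr P\mu$, $\theta^2=\mathscr P\bar\mu$, $\theta^3=\mathscr P\lambda$, $\theta^4=\mathscr P(dr+\mathscr W\mu+\overline{\mathscr W}\bar\mu+\mathscr H\lambda)$, so that $g=2(\theta^1\theta^2+\theta^3\theta^4)$. Here "$g$ is of Petrov type II or D" means that the components of the (complex-linearly extended) Weyl tensor $C$ with respect to this frame satisfy $C_{4141}=C_{4341}=0$ and $C_{4132}\neq0$. *)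

theory Defs
  imports "HOL-Analysis.Analysis"
begin

primrec cdiff_on :: "nat \<Rightarrow> 'a::euclidean_space set \<Rightarrow> ('a \<Rightarrow> 'b::real_normed_vector) \<Rightarrow> bool" where
  "cdiff_on 0 S f \<longleftrightarrow> continuous_on S f"
| "cdiff_on (Suc k) S f \<longleftrightarrow> (\<forall>x\<in>S. f differentiable (at x)) \<and>
     (\<forall>v. cdiff_on k S (\<lambda>x. frechet_derivative f (at x) v))"

text \<open>Only meant for open \<open>S\<close>.\<close>

definition smooth_on :: "'a::euclidean_space set \<Rightarrow> ('a \<Rightarrow> 'b::real_normed_vector) \<Rightarrow> bool" where
  "smooth_on S f \<longleftrightarrow> (\<forall>k. cdiff_on k S f)"

definition partial :: "'n::finite \<Rightarrow> (real^'n \<Rightarrow> 'b::real_normed_vector) \<Rightarrow> real^'n \<Rightarrow> 'b" where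
  "partial i f x = frechet_derivative f (at x) (axis i 1)"

text \<open>(Complex) vector fields and 1-forms on an open subset of \<open>real^'n\<close> are given by their components
  with respect to the coordinate vector fields and coordinate differentials.\<close>

definition lie_bracket ::
  "(real^'n \<Rightarrow> 'a::real_normed_field^'n) \<Rightarrow> (real^'n \<Rightarrow> 'a^'n) \<Rightarrow> real^'n::finite \<Rightarrow> 'a^'n" where
  "lie_bracket X Y x = (\<chi> j. \<Sum>i\<in>UNIV.
     X x $ i * partial i (\<lambda>y. Y y $ j) x - Y x $ i * partial i (\<lambda>y. X y $ j) x)"

definition pairing :: "'a::comm_ring_1^'n \<Rightarrow> 'a^'n::finite \<Rightarrow> 'a" where
  "pairing \<omega> v = (\<Sum>i\<in>UNIV. \<omega> $ i * v $ i)"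

definition cvec :: "real^'n \<Rightarrow> complex^'n::finite" where
  "cvec v = (\<chi> i. complex_of_real (v $ i))"

definition cmat :: "real^'n^'m \<Rightarrow> complex^'n::finite^'m::finite" where
  "cmat A = (\<chi> i j. complex_of_real (A $ i $ j))"

definition conj_vec :: "complex^'n \<Rightarrow> complex^'n::finite" where
  "conj_vec v = (\<chi> i. cnj (v $ i))"

definition symprod :: "'a::field^'n \<Rightarrow> 'a^'n \<Rightarrow> 'a^'n::finite^'n" where
  "symprod \<omega> \<gamma> = (\<chi> i j. (\<omega> $ i * \<gamma> $ j + \<gamma> $ i * \<omega> $ j) / 2)"

definition differential :: "(real^'n \<Rightarrow> real) \<Rightarrow> real^'n::finite \<Rightarrow> real^'n" where
  "differential f x = (\<chi> i. partial i f x)"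

text \<open>A CR structure on an open set \<open>U\<close> of \<open>real^3\<close> is given by the fibres \<open>D p\<close> of the distribution
  and by the endomorphisms \<open>J p\<close> of \<open>D p\<close>; \<open>J p\<close> is irrelevant outside \<open>D p\<close>.\<close>

definition nonvanishing_section ::
  "(real^3 \<Rightarrow> (real^3) set) \<Rightarrow> (real^3) set \<Rightarrow> (real^3 \<Rightarrow> real^3) \<Rightarrow> bool" where
  "nonvanishing_section D V X \<longleftrightarrow> smooth_on V X \<and> (\<forall>p\<in>V. X p \<in> D p \<and> X p \<noteq> 0)"

definition strictly_pseudoconvex ::
  "(real^3) set \<Rightarrow> (real^3 \<Rightarrow> (real^3) set) \<Rightarrow> (real^3 \<Rightarrow> real^3 \<Rightarrow> real^3) \<Rightarrow> bool" where
  "strictly_pseudoconvex U D J \<longleftrightarrow>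
     (\<forall>V X. open V \<and> V \<subseteq> U \<and> nonvanishing_section D V X \<longrightarrow>
        (\<forall>p\<in>V. lie_bracket X (\<lambda>q. J q (X q)) p \<notin> D p))"

definition cr_del :: "(real^3 \<Rightarrow> real^3 \<Rightarrow> real^3) \<Rightarrow> (real^3 \<Rightarrow> real^3) \<Rightarrow> real^3 \<Rightarrow> complex^3" where
  "cr_del J X p = cvec (X p) - \<i> *s cvec (J p (X p))"

definition cr_delbar :: "(real^3 \<Rightarrow> real^3 \<Rightarrow> real^3) \<Rightarrow> (real^3 \<Rightarrow> real^3) \<Rightarrow> real^3 \<Rightarrow> complex^3" where
  "cr_delbar J X p = conj_vec (cr_del J X p)"

definition cr_del_o :: "(real^3 \<Rightarrow> real^3 \<Rightarrow> real^3) \<Rightarrow> (real^3 \<Rightarrow> real^3) \<Rightarrow> real^3 \<Rightarrow> complex^3" where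
  "cr_del_o J X p = \<i> *s lie_bracket (cr_del J X) (cr_delbar J X) p"

definition adapted_coframe ::
  "(real^3) set \<Rightarrow> (real^3 \<Rightarrow> (real^3) set) \<Rightarrow> (real^3 \<Rightarrow> real^3 \<Rightarrow> real^3) \<Rightarrow>
   (real^3 \<Rightarrow> complex^3) \<Rightarrow> (real^3 \<Rightarrow> real^3) \<Rightarrow> bool" where
  "adapted_coframe U D J \<mu> lam \<longleftrightarrow> smooth_on U \<mu> \<and> smooth_on U lam \<and>
     (\<exists>X. nonvanishing_section D U X \<and>
       (\<forall>p\<in>U.
          pairing (\<mu> p) (cr_del J X p) = 1 \<and>
          pairing (\<mu> p) (cr_delbar J X p) = 0 \<and>
          pairing (\<mu> p) (cr_del_o J X p) = 0 \<and>
          pairing (conj_vec (\<mu> p)) (cr_del J X p) = 0 \<and>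
          pairing (conj_vec (\<mu> p)) (cr_delbar J X p) = 1 \<and>
          pairing (conj_vec (\<mu> p)) (cr_del_o J X p) = 0 \<and>
          pairing (cvec (lam p)) (cr_del J X p) = 0 \<and>
          pairing (cvec (lam p)) (cr_delbar J X p) = 0 \<and>
          pairing (cvec (lam p)) (cr_del_o J X p) = 1))"

definition tube_hypersurface :: "real set \<Rightarrow> (real \<Rightarrow> real) \<Rightarrow> (complex \<times> complex) set" where
  "tube_hypersurface I F = {(z, w). Im z \<in> I \<and> Im w = F (Im z)}"

text \<open>The hypersurface is a graph, so \<open>(x, y, u)\<close> are global coordinates on it; its CR structure is
  transported to the coordinate domain along \<open>tube_param F\<close>.\<close>

definition tube_dom :: "real set \<Rightarrow> (real^3) set" where
  "tube_dom I = {q. q $ 2 \<in> I}"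

definition tube_param :: "(real \<Rightarrow> real) \<Rightarrow> real^3 \<Rightarrow> complex \<times> complex" where
  "tube_param F q = (Complex (q $ 1) (q $ 2), Complex (q $ 3) (F (q $ 2)))"

lemma bij_betw_tube_param: "bij_betw (tube_param F) (tube_dom I) (tube_hypersurface I F)"
proof (rule bij_betw_byWitness[where f' = "\<lambda>(z, w). vector [Re z, Im z, Re w]"])
  show "\<forall>q\<in>tube_dom I. (case tube_param F q of (z, w) \<Rightarrow> vector [Re z, Im z, Re w]) = q"
    by (simp add: tube_param_def vec_eq_iff forall_3)
  show "\<forall>p\<in>tube_hypersurface I F. tube_param F (case p of (z, w) \<Rightarrow> vector [Re z, Im z, Re w]) = p"
    by (auto simp: tube_param_def tube_hypersurface_def complex_eq_iff)
  show "tube_param F ` tube_dom I \<subseteq> tube_hypersurface I F"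
    by (auto simp: tube_param_def tube_dom_def tube_hypersurface_def)
  show "(\<lambda>(z, w). vector [Re z, Im z, Re w]) ` tube_hypersurface I F \<subseteq> tube_dom I"
    by (auto simp: tube_dom_def tube_hypersurface_def)
qed

definition mult_i :: "complex \<times> complex \<Rightarrow> complex \<times> complex" where
  "mult_i v = (\<i> * fst v, \<i> * snd v)"

definition tube_push :: "(real \<Rightarrow> real) \<Rightarrow> real^3 \<Rightarrow> real^3 \<Rightarrow> complex \<times> complex" where
  "tube_push F q = frechet_derivative (tube_param F) (at q)"

text \<open>\<open>D = TM \<inter> \<i> TM\<close> and \<open>J\<close> is multiplication by \<open>\<i>\<close>.\<close>

definition tube_D :: "(real \<Rightarrow> real) \<Rightarrow> real^3 \<Rightarrow> (real^3) set" where
  "tube_D F q = {X. tube_push F q X \<in> range (tube_push F q) \<inter> mult_i ` range (tube_push F q)}"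

definition tube_J :: "(real \<Rightarrow> real) \<Rightarrow> real^3 \<Rightarrow> real^3 \<Rightarrow> real^3" where
  "tube_J F q X = (THE Y. tube_push F q Y = mult_i (tube_push F q X))"

definition christoffel :: "(real^'n \<Rightarrow> real^'n^'n) \<Rightarrow> real^'n::finite \<Rightarrow> 'n \<Rightarrow> 'n \<Rightarrow> 'n \<Rightarrow> real" where
  "christoffel g x k i j = (\<Sum>l\<in>UNIV. matrix_inv (g x) $ k $ l *
     (partial i (\<lambda>y. g y $ j $ l) x + partial j (\<lambda>y. g y $ i $ l) x - partial l (\<lambda>y. g y $ i $ j) x)) / 2"

text \<open>\<open>riemann_up g x l k i j\<close> is the \<open>l\<close>-th component of
  \<open>R(\<partial>\<^sub>i,\<partial>\<^sub>j)\<partial>\<^sub>k = \<nabla>\<^sub>i\<nabla>\<^sub>j\<partial>\<^sub>k - \<nabla>\<^sub>j\<nabla>\<^sub>i\<partial>\<^sub>k\<close>. With the Ricci tensor below, round spheres have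
  positive Ricci curvature.\<close>

definition riemann_up ::
  "(real^'n \<Rightarrow> real^'n^'n) \<Rightarrow> real^'n::finite \<Rightarrow> 'n \<Rightarrow> 'n \<Rightarrow> 'n \<Rightarrow> 'n \<Rightarrow> real" where
  "riemann_up g x l k i j =
     partial i (\<lambda>y. christoffel g y l j k) x - partial j (\<lambda>y. christoffel g y l i k) x +
     (\<Sum>m\<in>UNIV. christoffel g x l i m * christoffel g x m j k -
                christoffel g x l j m * christoffel g x m i k)"

definition riemann ::
  "(real^'n \<Rightarrow> real^'n^'n) \<Rightarrow> real^'n::finite \<Rightarrow> 'n \<Rightarrow> 'n \<Rightarrow> 'n \<Rightarrow> 'n \<Rightarrow> real" where
  "riemann g x l k i j = (\<Sum>m\<in>UNIV. g x $ l $ m * riemann_up g x m k i j)"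

definition ricci :: "(real^'n \<Rightarrow> real^'n^'n) \<Rightarrow> real^'n::finite \<Rightarrow> real^'n^'n" where
  "ricci g x = (\<chi> k j. \<Sum>i\<in>UNIV. riemann_up g x i k i j)"

definition scalar_curvature :: "(real^'n \<Rightarrow> real^'n^'n) \<Rightarrow> real^'n::finite \<Rightarrow> real" where
  "scalar_curvature g x = (\<Sum>i\<in>UNIV. \<Sum>j\<in>UNIV. matrix_inv (g x) $ i $ j * ricci g x $ i $ j)"

text \<open>The coefficients \<open>1/2\<close> and \<open>1/6\<close> are \<open>1/(n-2)\<close> and \<open>1/((n-1)(n-2))\<close> for \<open>n = 4\<close>.\<close>

definition weyl :: "(real^4 \<Rightarrow> real^4^4) \<Rightarrow> real^4 \<Rightarrow> 4 \<Rightarrow> 4 \<Rightarrow> 4 \<Rightarrow> 4 \<Rightarrow> real" where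
  "weyl g x l k i j = riemann g x l k i j
     - (g x $ l $ i * ricci g x $ k $ j - g x $ l $ j * ricci g x $ k $ i
        + g x $ k $ j * ricci g x $ l $ i - g x $ k $ i * ricci g x $ l $ j) / 2
     + scalar_curvature g x * (g x $ l $ i * g x $ k $ j - g x $ l $ j * g x $ k $ i) / 6"

text \<open>Component \<open>C(e\<^sub>a,e\<^sub>b,e\<^sub>c,e\<^sub>d)\<close> of the complex-multilinear extension in a complex frame \<open>e\<close>.\<close>

definition weyl_frame ::
  "(real^4 \<Rightarrow> real^4^4) \<Rightarrow> real^4 \<Rightarrow> (4 \<Rightarrow> complex^4) \<Rightarrow> 4 \<Rightarrow> 4 \<Rightarrow> 4 \<Rightarrow> 4 \<Rightarrow> complex" where
  "weyl_frame g x e a b c d = (\<Sum>i\<in>UNIV. \<Sum>j\<in>UNIV. \<Sum>k\<in>UNIV. \<Sum>l\<in>UNIV.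
     complex_of_real (weyl g x i j k l) * e a $ i * e b $ j * e c $ k * e d $ l)"

definition minkowski :: "real^4^4" where
  "minkowski = (\<chi> i j. if i = j then (if i = 4 then -1 else 1) else 0)"

definition lorentzian_metric_on :: "(real^4) set \<Rightarrow> (real^4 \<Rightarrow> real^4^4) \<Rightarrow> bool" where
  "lorentzian_metric_on S g \<longleftrightarrow> smooth_on S g \<and>
     (\<forall>x\<in>S. transpose (g x) = g x \<and>
        (\<exists>B. invertible B \<and> transpose B ** g x ** B = minkowski))"

definition base :: "real^4 \<Rightarrow> real^3" where
  "base x = vector [x $ 1, x $ 2, x $ 3]"

text \<open>\<open>M \<times> \<real>\<close>, with the fourth coordinate as the coordinate of the factor \<open>\<real>\<close>.\<close>

definition total_space :: "(real^3) set \<Rightarrow> (real^4) set" where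
  "total_space U = {x. base x \<in> U}"

definition pullback :: "(real^3 \<Rightarrow> 'a::zero^3) \<Rightarrow> real^4 \<Rightarrow> 'a^4" where
  "pullback \<omega> x = vector [\<omega> (base x) $ 1, \<omega> (base x) $ 2, \<omega> (base x) $ 3, 0]"

text \<open>The form \<open>dr + W \<mu> + cnj W cnj \<mu> + H lam\<close>. Here \<open>r\<close> is a real function on the lift and need not
  be the fourth coordinate itself; non-degeneracy of the metric makes it a coordinate on the fibres.
  This freedom matters: the null geodesic congruence is twisting, so that \<open>Ric(\<partial>\<^sub>r,\<partial>\<^sub>r) = 0\<close> confines
  \<open>r\<close> to a bounded interval on every fibre.\<close>

definition lift_form ::
  "(real^3 \<Rightarrow> complex^3) \<Rightarrow> (real^3 \<Rightarrow> real^3) \<Rightarrow> (real^4 \<Rightarrow> real) \<Rightarrow> (real^4 \<Rightarrow> complex) \<Rightarrow>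
   (real^4 \<Rightarrow> real) \<Rightarrow> real^4 \<Rightarrow> complex^4" where
  "lift_form \<mu> lam r W H x = cvec (differential r x)
     + W x *s pullback \<mu> x + cnj (W x) *s conj_vec (pullback \<mu> x)
     + complex_of_real (H x) *s cvec (pullback lam x)"

definition is_lift ::
  "(real^3) set \<Rightarrow> (real^3 \<Rightarrow> (real^3) set) \<Rightarrow> (real^3 \<Rightarrow> real^3 \<Rightarrow> real^3) \<Rightarrow>
   (real^3 \<Rightarrow> complex^3) \<Rightarrow> (real^3 \<Rightarrow> real^3) \<Rightarrow> (real^4 \<Rightarrow> real) \<Rightarrow> (real^4 \<Rightarrow> real) \<Rightarrow>
   (real^4 \<Rightarrow> complex) \<Rightarrow> (real^4 \<Rightarrow> real) \<Rightarrow> (real^4 \<Rightarrow> real^4^4) \<Rightarrow> bool" where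
  "is_lift U D J \<mu> lam P r W H g \<longleftrightarrow>
     adapted_coframe U D J \<mu> lam \<and>
     smooth_on (total_space U) P \<and> smooth_on (total_space U) r \<and>
     smooth_on (total_space U) W \<and> smooth_on (total_space U) H \<and>
     (\<forall>x\<in>total_space U. P x \<noteq> 0) \<and>
     lorentzian_metric_on (total_space U) g \<and>
     (\<forall>x\<in>total_space U. cmat (g x) = (2 * (P x)\<^sup>2) *\<^sub>R
        (symprod (pullback \<mu> x) (conj_vec (pullback \<mu> x))
         + symprod (cvec (pullback lam x)) (lift_form \<mu> lam r W H x)))"

text \<open>Row \<open>a\<close> consists of the components of \<open>\<theta>\<^sup>a\<close>.\<close>

definition lift_coframe ::
  "(real^3 \<Rightarrow> complex^3) \<Rightarrow> (real^3 \<Rightarrow> real^3) \<Rightarrow> (real^4 \<Rightarrow> real) \<Rightarrow> (real^4 \<Rightarrow> real) \<Rightarrow>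
   (real^4 \<Rightarrow> complex) \<Rightarrow> (real^4 \<Rightarrow> real) \<Rightarrow> real^4 \<Rightarrow> complex^4^4" where
  "lift_coframe \<mu> lam P r W H x = P x *\<^sub>R vector
     [pullback \<mu> x, conj_vec (pullback \<mu> x), cvec (pullback lam x), lift_form \<mu> lam r W H x]"

text \<open>The frame \<open>e\<close> dual to \<open>\<theta>\<close>: \<open>\<theta> ** matrix_inv \<theta> = mat 1\<close> says \<open>\<theta>\<^sup>a(e\<^sub>b) = \<delta>\<^sub>a\<^sub>b\<close>. For a lift,
  invertibility follows from non-degeneracy of the metric.\<close>

definition dual_frame :: "complex^4^4 \<Rightarrow> 4 \<Rightarrow> complex^4" where
  "dual_frame \<theta> b = column b (matrix_inv \<theta>)"

definition petrov_II_or_D :: "(real^4) set \<Rightarrow> (real^4 \<Rightarrow> real^4^4) \<Rightarrow> (real^4 \<Rightarrow> complex^4^4) \<Rightarrow> bool" where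
  "petrov_II_or_D S g \<theta> \<longleftrightarrow> (\<forall>x\<in>S.
     weyl_frame g x (dual_frame (\<theta> x)) 4 1 4 1 = 0 \<and>
     weyl_frame g x (dual_frame (\<theta> x)) 4 3 4 1 = 0 \<and>
     weyl_frame g x (dual_frame (\<theta> x)) 4 1 3 2 \<noteq> 0)"

end

theory Submission
  imports Defs
begin

text \<open>
  In the coordinates \<open>(x, y, u)\<close> the distribution of the tube is the kernel of \<open>\<sigma> = du - F' dx\<close>. On the
  product with a line with coordinate \<open>\<rho>\<close> consider
  \<open>g = q (\<rho>\<^sup>2 + S\<^sup>2) (dx\<^sup>2 + dy\<^sup>2) + 2 \<sigma> (d\<rho> + S' dx + H \<sigma>)\<close>
  with functions \<open>q > 0\<close> and \<open>S\<close> of \<open>y\<close> such that \<open>F'' = 2 q S\<close>; this is a twisting analogue of the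
  Taub-NUT-de Sitter metric, with the NUT radius \<open>S\<close> depending on \<open>y\<close>. Let \<open>K\<close> be the Gauss curvature of
  \<open>q (dx\<^sup>2 + dy\<^sup>2)\<close>. If \<open>S'' = 2 q (M - K S + 4/3 \<Lambda> S\<^sup>3)\<close> for a constant \<open>M\<close> and
  \<open>H = - K/2 + \<Lambda> (\<rho>\<^sup>2 + 5 S\<^sup>2)/6 + M S/(\<rho>\<^sup>2 + S\<^sup>2)\<close>, then \<open>Ric(g) - \<Lambda> g\<close> is a multiple of \<open>\<sigma>\<^sup>2\<close>,
  and \<open>C\<^sub>4\<^sub>1\<^sub>3\<^sub>2 = - \<i> M / (\<rho> + \<i> S)\<^sup>3\<close>, which does not vanish if \<open>M \<noteq> 0\<close>.
  The function \<open>r = 2 arctan (\<rho>/S)\<close> exhibits \<open>g\<close> as a lift.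

  Eliminating \<open>q\<close> and writing \<open>S = \<plusminus>p\<^sup>2\<close> turns the condition on \<open>S\<close> into
  \<open>p'' = 1/4 (log |F''|)'' p + |F''| (N/p\<^sup>3 + \<Lambda>/3 p\<^sup>3)\<close> with \<open>M = \<plusminus>4 N\<close>, and a positive solution on the
  whole interval is needed, for some \<open>N \<noteq> 0\<close> of our choice. If \<open>\<Lambda> \<le> 0\<close>, take \<open>N = 1\<close>: an energy estimate
  shows that solutions of the initial value problem neither explode nor reach \<open>0\<close>. If \<open>\<Lambda> > 0\<close>, generic
  solutions do explode; for \<open>N = -1\<close>, however, constants are barriers for two-point boundary value
  problems, and solutions obey bounds in the interior that do not depend on the boundary values, so
  that a global solution is found by compactness.
\<close>

section \<open>Smooth functions\<close>

text \<open>Zeros of \<open>S\<close> are the obstacle: \<open>F'' = 2 q S\<close> with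
  \<open>q > 0\<close> forbids them, so a solution has to exist on all of \<open>I\<close> without
  leaving the half-line, although nothing is known about \<open>F\<close> near the ends of
  \<open>I\<close>. Hence estimates are made over compact subintervals, and the solutions are glued
  by uniqueness. Putting \<open>q = F''/(2 S)\<close> into the condition on \<open>S\<close> gives
  \<open>2 S'' = (log |F''|)'' S + S'^2/S + M F''/S + 4/3 \<Lambda> F'' S^2\<close>; the square in
  \<open>S = \<plusminus>p^2\<close> is what removes the term \<open>S'^2/S\<close>, and with it
  every first derivative. The constant \<open>M\<close> is at disposal, and its sign selects a
  favourable regime. For \<open>N > 0\<close> and \<open>\<Lambda> \<le> 0\<close> the term
  \<open>N/p^3\<close> repels from \<open>0\<close> and the cubic term does not push outwards, so a
  mechanical energy confines \<open>p\<close>. For \<open>N < 0\<close> and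
  \<open>\<Lambda> > 0\<close> the right-hand side is, over every compact subinterval, negative for
  small \<open>p\<close> and positive for large \<open>p\<close>: the signs that the maximum
  principle asks for.\<close>

lemma has_derivative_frechet: "f differentiable (at x) \<Longrightarrow> (f has_derivative frechet_derivative f (at x)) (at x)"
  by (simp add: frechet_derivative_works)

text \<open>\<open>frechet_derivative\<close> is a choice among the derivatives of a function.
  Functions equal near \<open>x\<close> have the same derivatives, so the choices coincide, even
  where there is no derivative to choose.\<close>

lemma frechet_derivative_cong_on:
  assumes "open S" "x \<in> S" "\<And>y. y \<in> S \<Longrightarrow> f y = g y"
  shows "frechet_derivative f (at x) = frechet_derivative g (at x)"
proof -
  have "(f has_derivative D) (at x) \<longleftrightarrow> (g has_derivative D) (at x)" for D
    using assms has_derivative_transform_within_open[OF _ assms(1,2), of f D UNIV g]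
      has_derivative_transform_within_open[OF _ assms(1,2), of g D UNIV f] by auto
  then show ?thesis by (simp add: frechet_derivative_def)
qed

lemma differentiable_cong_on:
  assumes "open S" "x \<in> S" "\<And>y. y \<in> S \<Longrightarrow> f y = g y" "f differentiable (at x)"
  shows "g differentiable (at x)"
  using assms(4) has_derivative_transform_within_open[OF _ assms(1,2), of f _ UNIV g] assms(3)
  unfolding differentiable_def by blast

lemma cdiff_on_cong:
  assumes "open S" "\<And>x. x \<in> S \<Longrightarrow> f x = g x" "cdiff_on k S f"
  shows "cdiff_on k S g"
  using assms(2,3)
proof (induction k arbitrary: f g)
  case 0
  then show ?case using continuous_on_cong[of S S f g] by simp
next
  case (Suc k)
  show ?case unfolding cdiff_on.simps
  proof (intro conjI ballI allI)
    fix x assume "x \<in> S"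
    then show "g differentiable (at x)"
      using Suc.prems differentiable_cong_on[OF assms(1), of x f g] by auto
  next
    fix v
    show "cdiff_on k S (\<lambda>x. frechet_derivative g (at x) v)"
    proof (rule Suc.IH)
      show "cdiff_on k S (\<lambda>x. frechet_derivative f (at x) v)" using Suc.prems by simp
      show "frechet_derivative f (at x) v = frechet_derivative g (at x) v" if "x \<in> S" for x
        using frechet_derivative_cong_on[OF assms(1) that, of f g] Suc.prems(1) by simp
    qed
  qed
qed

text \<open>\<open>cdiff_on\<close> speaks of the chosen \<open>frechet_derivative\<close>; this
  rule lets the closure proofs supply the derivative as a formula \<open>D\<close>.\<close>

lemma cdiff_on_SucI:
  assumes "open S" "\<And>x. x \<in> S \<Longrightarrow> (f has_derivative D x) (at x)" "\<And>v. cdiff_on k S (\<lambda>x. D x v)"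
  shows "cdiff_on (Suc k) S f"
  unfolding cdiff_on.simps
proof (intro conjI ballI allI)
  show "f differentiable (at x)" if "x \<in> S" for x using assms(2)[OF that] by (auto simp: differentiable_def)
  show "cdiff_on k S (\<lambda>x. frechet_derivative f (at x) v)" for v
    by (rule cdiff_on_cong[OF assms(1) _ assms(3)[of v]]) (use frechet_derivative_at[OF assms(2)] in metis)
qed

lemma cdiff_on_has_derivative:
  "cdiff_on (Suc k) S f \<Longrightarrow> x \<in> S \<Longrightarrow> (f has_derivative frechet_derivative f (at x)) (at x)"
  by (simp add: has_derivative_frechet)

lemma cdiff_on_Suc_deriv: "cdiff_on (Suc k) S f \<Longrightarrow> cdiff_on k S (\<lambda>x. frechet_derivative f (at x) v)"
  by simp

text \<open>In the product and chain rules the derivative contains undifferentiated factors, which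
  the induction must regard as merely \<open>k\<close> times differentiable.\<close>

lemma cdiff_on_SucD: "cdiff_on (Suc k) S f \<Longrightarrow> cdiff_on k S f"
proof (induction k arbitrary: f)
  case 0
  then show ?case
    by (auto intro!: continuous_at_imp_continuous_on differentiable_imp_continuous_within)
next
  case (Suc k)
  then show ?case using cdiff_on.simps(2) by metis
qed

lemma cdiff_on_const [simp]: "cdiff_on k S (\<lambda>x. c)"
  by (induction k arbitrary: c) (auto simp: frechet_derivative_const)

lemma cdiff_on_bounded_linear_comp:
  assumes "open S" "bounded_linear L"
  shows "cdiff_on k S f \<Longrightarrow> cdiff_on k S (\<lambda>x. L (f x))"
proof (induction k arbitrary: f)
  case 0
  then show ?case using bounded_linear.continuous_on[OF assms(2)] by simp
next
  case (Suc k)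
  show ?case
  proof (rule cdiff_on_SucI[OF assms(1)])
    show "((\<lambda>x. L (f x)) has_derivative (\<lambda>v. L (frechet_derivative f (at x) v))) (at x)" if "x \<in> S" for x
      by (rule bounded_linear.has_derivative[OF assms(2) cdiff_on_has_derivative[OF Suc.prems that]])
    show "cdiff_on k S (\<lambda>x. L (frechet_derivative f (at x) v))" for v
      by (rule Suc.IH[OF cdiff_on_Suc_deriv[OF Suc.prems]])
  qed
qed

lemma cdiff_on_add:
  assumes "open S"
  shows "cdiff_on k S f \<Longrightarrow> cdiff_on k S g \<Longrightarrow> cdiff_on k S (\<lambda>x. f x + g x)"
proof (induction k arbitrary: f g)
  case 0
  then show ?case by (auto intro: continuous_on_add)
next
  case (Suc k)
  show ?case
  proof (rule cdiff_on_SucI[OF assms(1)])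
    show "((\<lambda>x. f x + g x) has_derivative (\<lambda>v. frechet_derivative f (at x) v + frechet_derivative g (at x) v)) (at x)" if "x \<in> S" for x
      by (rule has_derivative_add[OF cdiff_on_has_derivative[OF Suc.prems(1) that] cdiff_on_has_derivative[OF Suc.prems(2) that]])
    show "cdiff_on k S (\<lambda>x. frechet_derivative f (at x) v + frechet_derivative g (at x) v)" for v
      by (rule Suc.IH[OF cdiff_on_Suc_deriv[OF Suc.prems(1)] cdiff_on_Suc_deriv[OF Suc.prems(2)]])
  qed
qed

lemma cdiff_on_bilinear:
  assumes "open S" "bounded_bilinear bil"
  shows "cdiff_on k S f \<Longrightarrow> cdiff_on k S g \<Longrightarrow> cdiff_on k S (\<lambda>x. bil (f x) (g x))"
proof (induction k arbitrary: f g)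
  case 0
  then show ?case using bounded_bilinear.continuous_on[OF assms(2)] by auto
next
  case (Suc k)
  show ?case
  proof (rule cdiff_on_SucI[OF assms(1)])
    show "((\<lambda>x. bil (f x) (g x)) has_derivative
        (\<lambda>v. bil (f x) (frechet_derivative g (at x) v) + bil (frechet_derivative f (at x) v) (g x))) (at x)" if "x \<in> S" for x
      by (rule bounded_bilinear.FDERIV[OF assms(2) cdiff_on_has_derivative[OF Suc.prems(1) that] cdiff_on_has_derivative[OF Suc.prems(2) that]])
    show "cdiff_on k S (\<lambda>x. bil (f x) (frechet_derivative g (at x) v) + bil (frechet_derivative f (at x) v) (g x))" for v
      by (rule cdiff_on_add[OF assms(1) Suc.IH[OF cdiff_on_SucD[OF Suc.prems(1)] cdiff_on_Suc_deriv[OF Suc.prems(2)]]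
            Suc.IH[OF cdiff_on_Suc_deriv[OF Suc.prems(1)] cdiff_on_SucD[OF Suc.prems(2)]]])
  qed
qed

lemma cdiff_on_of_field_derivative:
  fixes h :: "real \<Rightarrow> real"
  assumes "open T" "\<And>y. y \<in> T \<Longrightarrow> (h has_real_derivative h' y) (at y)" "cdiff_on k T h'"
  shows "cdiff_on (Suc k) T h"
proof (rule cdiff_on_SucI[OF assms(1)])
  show "(h has_derivative (\<lambda>v. h' y * v)) (at y)" if "y \<in> T" for y
    using assms(2)[OF that] by (simp add: has_field_derivative_def)
  show "cdiff_on k T (\<lambda>x. h' x * v)" for v
    by (intro cdiff_on_bilinear[OF assms(1) bounded_bilinear_mult] assms(3) cdiff_on_const)
qed

lemma cdiff_on_compose_real:
  fixes h :: "real \<Rightarrow> real"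
  assumes "open S" "open T"
  shows "cdiff_on k T h \<Longrightarrow> cdiff_on k S \<phi> \<Longrightarrow> \<phi> ` S \<subseteq> T \<Longrightarrow> cdiff_on k S (\<lambda>x. h (\<phi> x))"
proof (induction k arbitrary: h)
  case 0
  then show ?case by (auto intro: continuous_on_compose2)
next
  case (Suc k)
  show ?case
  proof (rule cdiff_on_SucI[OF assms(1)])
    show "((\<lambda>x. h (\<phi> x)) has_derivative (\<lambda>v. frechet_derivative \<phi> (at x) v * frechet_derivative h (at (\<phi> x)) 1)) (at x)" if x: "x \<in> S" for x
    proof -
      have hd: "(h has_derivative frechet_derivative h (at (\<phi> x))) (at (\<phi> x))"
        by (rule cdiff_on_has_derivative[OF Suc.prems(1)]) (use Suc.prems x in auto)
      \<comment> \<open>A linear map of the line is multiplication by its value at \<open>1\<close>,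
        so the derivative of the composition becomes a product of functions covered by the
        induction.\<close>
      have "frechet_derivative h (at (\<phi> x)) s = s * frechet_derivative h (at (\<phi> x)) 1" for s
        using linear_scale[OF has_derivative_linear[OF hd], of s 1] by simp
      with has_derivative_compose[OF cdiff_on_has_derivative[OF Suc.prems(2) x] hd]
      show ?thesis by (metis (no_types, lifting) ext)
    qed
    show "cdiff_on k S (\<lambda>x. frechet_derivative \<phi> (at x) v * frechet_derivative h (at (\<phi> x)) 1)" for v
      by (intro cdiff_on_bilinear[OF assms(1) bounded_bilinear_mult] cdiff_on_Suc_deriv[OF Suc.prems(2)]
          Suc.IH[OF cdiff_on_Suc_deriv[OF Suc.prems(1)] cdiff_on_SucD[OF Suc.prems(2)] Suc.prems(3)])
  qed
qed

lemma smooth_on_const [simp]: "smooth_on S (\<lambda>x. c)"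
  by (simp add: smooth_on_def)

lemma smooth_on_cong: "open S \<Longrightarrow> smooth_on S f \<Longrightarrow> (\<And>x. x \<in> S \<Longrightarrow> f x = g x) \<Longrightarrow> smooth_on S g"
  unfolding smooth_on_def using cdiff_on_cong by blast

lemma smooth_on_linear_comp: "open S \<Longrightarrow> bounded_linear L \<Longrightarrow> smooth_on S f \<Longrightarrow> smooth_on S (\<lambda>x. L (f x))"
  by (simp add: smooth_on_def cdiff_on_bounded_linear_comp)

lemma smooth_on_id: assumes "open S" shows "smooth_on S (\<lambda>x. x)"
  unfolding smooth_on_def
proof
  fix k show "cdiff_on k S (\<lambda>x. x)"
    by (cases k) (auto simp: continuous_on_id intro!: cdiff_on_SucI[OF assms, where D = "\<lambda>x v. v"] derivative_intros)
qed

lemma smooth_on_add: "open S \<Longrightarrow> smooth_on S f \<Longrightarrow> smooth_on S g \<Longrightarrow> smooth_on S (\<lambda>x. f x + g x)"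
  by (simp add: smooth_on_def cdiff_on_add)

lemma smooth_on_mult:
  fixes f g :: "'a::euclidean_space \<Rightarrow> 'b::real_normed_algebra"
  shows "open S \<Longrightarrow> smooth_on S f \<Longrightarrow> smooth_on S g \<Longrightarrow> smooth_on S (\<lambda>x. f x * g x)"
  by (simp add: smooth_on_def cdiff_on_bilinear[OF _ bounded_bilinear_mult])

lemma smooth_on_minus: "open S \<Longrightarrow> smooth_on S f \<Longrightarrow> smooth_on S (\<lambda>x. - f x)"
  using smooth_on_linear_comp[OF _ bounded_linear_minus[OF bounded_linear_ident]] by blast

lemma smooth_on_diff: "open S \<Longrightarrow> smooth_on S f \<Longrightarrow> smooth_on S g \<Longrightarrow> smooth_on S (\<lambda>x. f x - g x)"
  using smooth_on_add[OF _ _ smooth_on_minus, of S f g] by simp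

lemma smooth_on_power:
  fixes f :: "'a::euclidean_space \<Rightarrow> real"
  shows "open S \<Longrightarrow> smooth_on S f \<Longrightarrow> smooth_on S (\<lambda>x. f x ^ n)"
  by (induction n) (auto intro: smooth_on_mult)

lemma smooth_on_compose_real:
  fixes h :: "real \<Rightarrow> real"
  shows "open S \<Longrightarrow> open T \<Longrightarrow> smooth_on T h \<Longrightarrow> smooth_on S \<phi> \<Longrightarrow> \<phi> ` S \<subseteq> T \<Longrightarrow> smooth_on S (\<lambda>x. h (\<phi> x))"
  unfolding smooth_on_def using cdiff_on_compose_real by blast

lemma smooth_on_nth: "open S \<Longrightarrow> smooth_on S (\<lambda>x::real^'n. x $ i)"
  using smooth_on_linear_comp[OF _ bounded_linear_vec_nth smooth_on_id] by blast

lemma smooth_on_partial: "smooth_on S f \<Longrightarrow> smooth_on S (partial i f)"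
  unfolding smooth_on_def partial_def[abs_def] using cdiff_on_Suc_deriv by blast

text \<open>The derivative is again a polynomial in \<open>inverse\<close>, so order
  \<open>k\<close> for the function yields order \<open>k + 1\<close>. The same bootstrap handles
  \<open>sqrt\<close>, whose derivative is half the \<open>inverse\<close> of
  \<open>sqrt\<close>.\<close>

lemma smooth_on_inverse_real: "smooth_on (- {0::real}) (inverse :: real \<Rightarrow> real)"
  unfolding smooth_on_def
proof
  fix k show "cdiff_on k (- {0::real}) (inverse :: real \<Rightarrow> real)"
  proof (induction k)
    case (Suc k)
    have o: "open (- {0::real})" by (simp add: open_Compl)
    show ?case
    proof (rule cdiff_on_of_field_derivative[OF o, where h' = "\<lambda>y. (-1) * (inverse y * inverse y)"])
      show "(inverse has_real_derivative (-1) * (inverse y * inverse y)) (at y)" if "y \<in> - {0}" for y :: real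
        using that by (auto intro!: derivative_eq_intros simp: field_simps)
      show "cdiff_on k (- {0::real}) (\<lambda>y. (-1) * (inverse y * inverse y))"
        by (intro cdiff_on_bilinear[OF o bounded_bilinear_mult] Suc.IH cdiff_on_const)
    qed
  qed (auto intro!: continuous_intros)
qed

lemma smooth_on_inverse:
  fixes f :: "'a::euclidean_space \<Rightarrow> real"
  assumes "open S" "smooth_on S f" "\<And>x. x \<in> S \<Longrightarrow> f x \<noteq> 0"
  shows "smooth_on S (\<lambda>x. inverse (f x))"
proof -
  have "open (- {0::real})" by (simp add: open_Compl)
  moreover have "f ` S \<subseteq> - {0}" using assms(3) by auto
  ultimately show ?thesis by (rule smooth_on_compose_real[OF assms(1) _ smooth_on_inverse_real assms(2)])
qed

lemma smooth_on_divide: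
  fixes f g :: "'a::euclidean_space \<Rightarrow> real"
  assumes "open S" "smooth_on S f" "smooth_on S g" "\<And>x. x \<in> S \<Longrightarrow> g x \<noteq> 0"
  shows "smooth_on S (\<lambda>x. f x / g x)"
  unfolding divide_inverse using assms by (intro smooth_on_mult smooth_on_inverse)

lemma smooth_on_sqrt_real: "smooth_on {0<..} sqrt"
  unfolding smooth_on_def
proof
  have o: "open {0::real<..}" by auto
  fix k show "cdiff_on k {0<..} sqrt"
  proof (induction k)
    case (Suc k)
    have inv: "cdiff_on k (- {0::real}) (inverse :: real \<Rightarrow> real)" using smooth_on_inverse_real by (simp add: smooth_on_def)
    show ?case
    proof (rule cdiff_on_of_field_derivative[OF o, where h' = "\<lambda>y. inverse (sqrt y) * (1 / 2)"])
      show "(sqrt has_real_derivative inverse (sqrt y) * (1 / 2)) (at y)" if "y \<in> {0<..}" for y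
        using DERIV_real_sqrt[of y] that by simp
      show "cdiff_on k {0<..} (\<lambda>y. inverse (sqrt y) * (1 / 2))"
        by (intro cdiff_on_bilinear[OF o bounded_bilinear_mult] cdiff_on_const
            cdiff_on_compose_real[OF o _ inv Suc.IH]) auto
    qed
  qed (auto intro!: continuous_intros)
qed

lemma smooth_on_sqrt:
  fixes f :: "'a::euclidean_space \<Rightarrow> real"
  assumes "open S" "smooth_on S f" "\<And>x. x \<in> S \<Longrightarrow> f x > 0"
  shows "smooth_on S (\<lambda>x. sqrt (f x))"
  using smooth_on_compose_real[OF assms(1) _ smooth_on_sqrt_real assms(2)] assms(3) by auto

lemma smooth_on_of_field_derivative:
  fixes h :: "real \<Rightarrow> real"
  assumes "open T" "\<And>y. y \<in> T \<Longrightarrow> (h has_real_derivative h' y) (at y)" "smooth_on T h'"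
  shows "smooth_on T h"
  unfolding smooth_on_def
proof
  fix k
  have "cdiff_on (Suc k) T h"
    by (rule cdiff_on_of_field_derivative[OF assms(1,2)]) (use assms(3) in \<open>auto simp: smooth_on_def\<close>)
  then show "cdiff_on k T h" by (rule cdiff_on_SucD)
qed

lemma smooth_on_arctan:
  fixes f :: "'a::euclidean_space \<Rightarrow> real"
  assumes "open S" "smooth_on S f"
  shows "smooth_on S (\<lambda>x. arctan (f x))"
proof -
  have "smooth_on UNIV (\<lambda>y::real. inverse (1 + y ^ 2))"
    by (intro smooth_on_inverse smooth_on_add smooth_on_power smooth_on_id smooth_on_const) (auto simp: add_nonneg_eq_0_iff)
  then have "smooth_on UNIV arctan"
    by (rule smooth_on_of_field_derivative[rotated 2]) (auto intro: DERIV_arctan)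
  then show ?thesis using smooth_on_compose_real[OF assms(1) open_UNIV _ assms(2)] by auto
qed

lemma bounded_linear_axis: "bounded_linear (axis i :: 'b::real_normed_vector \<Rightarrow> 'b^'n)"
proof (rule bounded_linear_intro[where K = 1])
  show "norm (axis i x :: 'b^'n) \<le> norm x * 1" for x :: 'b
  proof -
    have "norm (axis i x :: 'b^'n) \<le> (\<Sum>j\<in>UNIV. norm ((axis i x :: 'b^'n) $ j))"
      unfolding norm_vec_def by (rule L2_set_le_sum) simp
    also have "\<dots> = (\<Sum>j\<in>UNIV. if j = i then norm x else 0)"
      by (rule sum.cong) (auto simp: axis_def)
    finally show ?thesis by simp
  qed
qed (auto simp: axis_def vec_eq_iff)

lemma smooth_on_sum:
  assumes "open S"
  shows "finite A \<Longrightarrow> (\<And>i. i \<in> A \<Longrightarrow> smooth_on S (f i)) \<Longrightarrow> smooth_on S (\<lambda>x. \<Sum>i\<in>A. f i x)"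
  by (induction A rule: finite_induct) (auto intro: smooth_on_add[OF assms])

lemma smooth_on_vecI:
  fixes f :: "'a::euclidean_space \<Rightarrow> 'b::real_normed_vector^'n"
  assumes "open S" "\<And>i. smooth_on S (\<lambda>x. f x $ i)"
  shows "smooth_on S f"
proof -
  have "f = (\<lambda>x. \<Sum>i\<in>UNIV. axis i (f x $ i))"
    by (auto simp: fun_eq_iff vec_eq_iff axis_def)
  moreover have "smooth_on S (\<lambda>x. \<Sum>i\<in>UNIV. axis i (f x $ i))"
    by (intro smooth_on_sum[OF assms(1)] smooth_on_linear_comp[OF assms(1) bounded_linear_axis] assms(2)) auto
  ultimately show ?thesis by simp
qed

lemma smooth_on_of_real:
  "open S \<Longrightarrow> smooth_on S f \<Longrightarrow> smooth_on S (\<lambda>x. complex_of_real (f x))"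
  using smooth_on_linear_comp[OF _ bounded_linear_of_real] by blast

lemma smooth_on_has_real_derivative:
  fixes h :: "real \<Rightarrow> real"
  assumes "smooth_on T h" "y \<in> T"
  shows "(h has_real_derivative frechet_derivative h (at y) 1) (at y)"
proof -
  have "cdiff_on (Suc 0) T h" using assms(1) by (simp only: smooth_on_def)
  from cdiff_on_has_derivative[OF this assms(2)]
  have D: "(h has_derivative frechet_derivative h (at y)) (at y)" .
  then have "frechet_derivative h (at y) s = frechet_derivative h (at y) 1 * s" for s
    using linear_scale[OF has_derivative_linear[OF D], of s 1] by simp
  with D show ?thesis unfolding has_field_derivative_def by (metis (no_types, lifting) ext)
qed

lemma smooth_on_frechet: "smooth_on S f \<Longrightarrow> smooth_on S (\<lambda>x. frechet_derivative f (at x) v)"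
  unfolding smooth_on_def using cdiff_on_Suc_deriv by blast

lemma smooth_on_continuous: "smooth_on S f \<Longrightarrow> continuous_on S f"
  unfolding smooth_on_def using cdiff_on.simps(1) by blast

section \<open>Partial derivatives and curvature of the metric\<close>

lemma vector_4 [simp]:
  "(vector [a, b, c, d] :: 'a::zero^4) $ 1 = a"
  "(vector [a, b, c, d] :: 'a::zero^4) $ 2 = b"
  "(vector [a, b, c, d] :: 'a::zero^4) $ 3 = c"
  "(vector [a, b, c, d] :: 'a::zero^4) $ 4 = d"
  unfolding vector_def by simp_all

lemma partial_eqI:
  assumes "(\<phi> has_derivative D) (at x)" shows "partial i \<phi> x = D (axis i 1)"
  using assms by (simp add: partial_def frechet_derivative_at[symmetric])

lemma partial_const [simp]: "partial i (\<lambda>x. c) x = 0"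
  by (rule partial_eqI[THEN trans]) (auto intro!: derivative_eq_intros)

lemma partial_add:
  fixes \<phi> \<psi> :: "real^'n::finite \<Rightarrow> real"
  assumes "\<phi> differentiable (at x)" "\<psi> differentiable (at x)"
  shows "partial i (\<lambda>x. \<phi> x + \<psi> x) x = partial i \<phi> x + partial i \<psi> x"
  using has_derivative_add[OF assms[THEN has_derivative_frechet]]
  by (subst partial_eqI) (auto simp: partial_def)

lemma partial_diff:
  fixes \<phi> \<psi> :: "real^'n::finite \<Rightarrow> real"
  assumes "\<phi> differentiable (at x)" "\<psi> differentiable (at x)"
  shows "partial i (\<lambda>x. \<phi> x - \<psi> x) x = partial i \<phi> x - partial i \<psi> x"
  using has_derivative_diff[OF assms[THEN has_derivative_frechet]]
  by (subst partial_eqI) (auto simp: partial_def)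

lemma partial_minus:
  fixes \<phi> :: "real^'n::finite \<Rightarrow> real"
  assumes "\<phi> differentiable (at x)"
  shows "partial i (\<lambda>x. - \<phi> x) x = - partial i \<phi> x"
  using has_derivative_minus[OF assms[THEN has_derivative_frechet]]
  by (subst partial_eqI) (auto simp: partial_def)

lemma partial_mult:
  fixes \<phi> \<psi> :: "real^'n::finite \<Rightarrow> real"
  assumes "\<phi> differentiable (at x)" "\<psi> differentiable (at x)"
  shows "partial i (\<lambda>x. \<phi> x * \<psi> x) x = \<phi> x * partial i \<psi> x + partial i \<phi> x * \<psi> x"
  using has_derivative_mult[OF assms[THEN has_derivative_frechet]]
  by (subst partial_eqI) (auto simp: partial_def)

lemma partial_power:
  fixes \<phi> :: "real^'n::finite \<Rightarrow> real"
  assumes "\<phi> differentiable (at x)"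
  shows "partial i (\<lambda>x. \<phi> x ^ n) x = of_nat n * \<phi> x ^ (n - 1) * partial i \<phi> x"
  using has_derivative_power[OF assms[THEN has_derivative_frechet], of n]
  by (subst partial_eqI) (auto simp: partial_def mult_ac)

lemma partial_divide_const:
  fixes \<phi> :: "real^'n::finite \<Rightarrow> real"
  assumes "\<phi> differentiable (at x)"
  shows "partial i (\<lambda>x. \<phi> x / c) x = partial i \<phi> x / c"
  using has_derivative_mult_right[OF assms[THEN has_derivative_frechet], of "inverse c"]
  by (subst partial_eqI) (auto simp: partial_def field_simps)

lemma partial_nth: "partial i (\<lambda>x::real^'n::finite. x $ j) x = (if j = i then 1 else 0)"
  by (subst partial_eqI[where D = "\<lambda>v. v $ j"])
     (auto simp: axis_def intro!: bounded_linear_imp_has_derivative bounded_linear_vec_nth)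

lemma differentiable_nth: "(\<lambda>x::real^'n::finite. x $ j) differentiable (at x)"
  by (intro bounded_linear_imp_differentiable bounded_linear_vec_nth)

lemma partial_of_nth:
  fixes h :: "real \<Rightarrow> real"
  assumes "(h has_real_derivative h') (at (x $ j))"
  shows "partial i (\<lambda>x::real^'n::finite. h (x $ j)) x = (if j = i then h' else 0)"
    and "(\<lambda>x::real^'n::finite. h (x $ j)) differentiable (at x)"
proof -
  have "((\<lambda>x::real^'n. x $ j) has_derivative (\<lambda>v. v $ j)) (at x)"
    by (auto intro!: bounded_linear_imp_has_derivative bounded_linear_vec_nth)
  from has_derivative_compose[OF this, of h "\<lambda>v. v * h'"] assms
  have D: "((\<lambda>x::real^'n::finite. h (x $ j)) has_derivative (\<lambda>v. v $ j * h')) (at x)"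
    by (simp add: has_field_derivative_def mult.commute[of _ h'])
  show "partial i (\<lambda>x::real^'n::finite. h (x $ j)) x = (if j = i then h' else 0)"
    by (subst partial_eqI[OF D]) (auto simp: axis_def)
  show "(\<lambda>x::real^'n::finite. h (x $ j)) differentiable (at x)"
    using D by (auto simp: differentiable_def)
qed

lemma partial_cong_on:
  assumes "open X" "x \<in> X" "\<And>y. y \<in> X \<Longrightarrow> \<phi> y = \<psi> y"
  shows "partial i \<phi> x = partial i \<psi> x"
  using frechet_derivative_cong_on[OF assms] by (simp add: partial_def)

lemmas partial_rules =
  partial_add partial_diff partial_minus partial_mult partial_power partial_divide_const

text \<open>Given differentiability, the partial derivatives determine the total one. The
  coefficient functions on the four-dimensional space depend on \<open>y\<close> and
  \<open>rho\<close> only, the second and fourth coordinates.\<close>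

lemma has_derivative_partials:
  fixes \<phi> :: "real^4 \<Rightarrow> real"
  assumes "\<phi> differentiable (at x)" "partial 1 \<phi> x = 0" "partial 3 \<phi> x = 0"
    "partial 2 \<phi> x = b" "partial 4 \<phi> x = c"
  shows "(\<phi> has_derivative (\<lambda>v. b * v $ 2 + c * v $ 4)) (at x)"
proof -
  note D = has_derivative_frechet[OF assms(1)]
  have "frechet_derivative \<phi> (at x) v = b * v $ 2 + c * v $ 4" for v
  proof -
    have "v = (\<Sum>i\<in>UNIV. v $ i *\<^sub>R axis i 1)"
      by (subst basis_expansion[symmetric]) (simp add: scalar_mult_eq_scaleR)
    then have "frechet_derivative \<phi> (at x) v = (\<Sum>i\<in>UNIV. v $ i * partial i \<phi> x)"
      using linear_sum[OF has_derivative_linear[OF D], of "\<lambda>i. v $ i *\<^sub>R axis i 1" UNIV] linear_scale[OF has_derivative_linear[OF D]]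
      by (simp add: partial_def)
    then show ?thesis by (simp add: sum_4 assms)
  qed
  then have "frechet_derivative \<phi> (at x) = (\<lambda>v. b * v $ 2 + c * v $ 4)" by (rule ext)
  with D show ?thesis by simp
qed

section \<open>Inverse metric, connection and curvature\<close>

lemma matrix_inv_eqI:
  fixes A B :: "'a::field^'n::finite^'n"
  assumes "A ** B = mat 1" shows "matrix_inv A = B"
proof -
  have "B ** A = mat 1" using assms matrix_left_right_inverse by blast
  then have "invertible A" using assms by (auto simp: invertible_def)
  then have "matrix_inv A ** A = mat 1" using someI_ex[of "\<lambda>A'. A ** A' = mat 1 \<and> A' ** A = mat 1"]
    by (auto simp: invertible_def matrix_inv_def)
  then have "matrix_inv A ** (A ** B) = B" by (simp add: matrix_mul_assoc)
  then show ?thesis by (simp add: assms)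
qed

text \<open>\<open>w\<close> occurs in the formula for \<open>H\<close> in
  \<open>quasi_einstein\<close> as well as in the Christoffel symbols of \<open>tube_metric\<close>;
  this common base allows the former locale to be an instance of the latter.\<close>

locale tube_base =
  fixes I :: "real set" and q S V :: "real \<Rightarrow> real"
  assumes I: "open I"
    and q_pos: "\<And>y. y \<in> I \<Longrightarrow> q y > 0" and S_nz: "\<And>y. y \<in> I \<Longrightarrow> S y \<noteq> 0"
    and dS: "\<And>y. y \<in> I \<Longrightarrow> (S has_real_derivative q y * V y) (at y)"
begin

definition w :: "real^4 \<Rightarrow> real" where "w x = inverse ((x$4)^2 + (S (x$2))^2)"

lemma w_mult_radius: "x $ 2 \<in> I \<Longrightarrow> w x * ((x$4)^2 + (S (x$2))^2) = 1"
  unfolding w_def by (rule left_inverse) (metis S_nz sum_power2_eq_zero_iff)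

lemma has_derivative_w:
  assumes "x $ 2 \<in> I"
  shows "(w has_derivative (\<lambda>v. - (2 * S (x$2) * q (x$2) * V (x$2) * (w x)^2) * v $ 2 - 2 * x$4 * (w x)^2 * v $ 4)) (at x)"
proof -
  have nz: "(x$4)^2 + (S (x$2))^2 \<noteq> 0" using w_mult_radius[OF assms] by auto
  have S: "((\<lambda>x. S (x $ 2)) has_derivative (\<lambda>v. v $ 2 * (q (x$2) * V (x$2)))) (at x)"
    using has_derivative_compose[OF bounded_linear_imp_has_derivative[OF bounded_linear_vec_nth[of 2]], of S "\<lambda>v. v * (q (x$2) * V (x$2))" x UNIV] dS[OF assms]
    by (simp add: has_field_derivative_def mult.commute[of _ "q (x$2) * V (x$2)"])
  have r: "((\<lambda>x::real^4. x $ 4) has_derivative (\<lambda>v. v $ 4)) (at x)"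
    by (auto intro!: bounded_linear_imp_has_derivative bounded_linear_vec_nth)
  show ?thesis unfolding w_def
    by (rule derivative_eq_intros r S nz refl)+
       (auto simp: fun_eq_iff w_def algebra_simps power2_eq_square)
qed

end

text \<open>Derivatives with respect to \<open>y\<close> are divided by \<open>q\<close> throughout (\<open>a = q'/q\<close>, \<open>V = S'/q\<close>, \<open>T = S''/q\<close>,
  \<open>T1 = T'/q\<close>, \<open>f = F'\<close>, and \<open>Hs\<close>, \<open>Hr\<close> are the \<open>y\<close>-derivative of \<open>H\<close> over \<open>q\<close> and its \<open>\<rho>\<close>-derivative): the
  connection and the curvature are then polynomials in these functions and \<open>w = 1/(\<rho>\<^sup>2 + S\<^sup>2)\<close>, and all
  identities hold modulo the single relation \<open>w (\<rho>\<^sup>2 + S\<^sup>2) = 1\<close>.\<close>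

locale tube_metric = tube_base I q S V
  for I :: "real set" and q a S V T T1 K f :: "real \<Rightarrow> real"
    and H Hs Hr Hsy Hsr Hrr :: "real^4 \<Rightarrow> real" +
  assumes dq: "\<And>y. y \<in> I \<Longrightarrow> (q has_real_derivative q y * a y) (at y)"
    and da: "\<And>y. y \<in> I \<Longrightarrow> (a has_real_derivative - (2 * q y * K y)) (at y)"
    and dV: "\<And>y. y \<in> I \<Longrightarrow> (V has_real_derivative T y - a y * V y) (at y)"
    and dT: "\<And>y. y \<in> I \<Longrightarrow> (T has_real_derivative q y * T1 y) (at y)"
    and df: "\<And>y. y \<in> I \<Longrightarrow> (f has_real_derivative 2 * q y * S y) (at y)"
    and dH: "\<And>x. x $ 2 \<in> I \<Longrightarrow> (H has_derivative (\<lambda>v. q (x$2) * Hs x * v $ 2 + Hr x * v $ 4)) (at x)"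
    and dHs: "\<And>x. x $ 2 \<in> I \<Longrightarrow> (Hs has_derivative (\<lambda>v. Hsy x * v $ 2 + Hsr x * v $ 4)) (at x)"
    and dHr: "\<And>x. x $ 2 \<in> I \<Longrightarrow> (Hr has_derivative (\<lambda>v. q (x$2) * Hsr x * v $ 2 + Hrr x * v $ 4)) (at x)"
begin

lemma differentiable_coefficients:
  assumes "x $ 2 \<in> I"
  shows "(\<lambda>x. q (x $ 2)) differentiable (at x)" "(\<lambda>x. a (x $ 2)) differentiable (at x)"
    "(\<lambda>x. S (x $ 2)) differentiable (at x)" "(\<lambda>x. V (x $ 2)) differentiable (at x)"
    "(\<lambda>x. T (x $ 2)) differentiable (at x)" "(\<lambda>x. f (x $ 2)) differentiable (at x)"
    "H differentiable (at x)" "Hs differentiable (at x)" "Hr differentiable (at x)"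
    "w differentiable (at x)"
    "(\<lambda>x::real^4. x $ 4) differentiable (at x)"
  using partial_of_nth(2)[OF dq[OF assms]] partial_of_nth(2)[OF da[OF assms]]
    partial_of_nth(2)[OF dS[OF assms]] partial_of_nth(2)[OF dV[OF assms]]
    partial_of_nth(2)[OF dT[OF assms]] partial_of_nth(2)[OF df[OF assms]]
    dH[OF assms] dHs[OF assms] dHr[OF assms] has_derivative_w[OF assms] differentiable_nth
  by (auto simp: differentiable_def)

lemma partial_coefficients:
  assumes "x $ 2 \<in> I"
  shows "partial i (\<lambda>x. q (x $ 2)) x = (if 2 = i then q (x$2) * a (x$2) else 0)"
    "partial i (\<lambda>x. a (x $ 2)) x = (if 2 = i then - (2 * q (x$2) * K (x$2)) else 0)"
    "partial i (\<lambda>x. S (x $ 2)) x = (if 2 = i then q (x$2) * V (x$2) else 0)"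
    "partial i (\<lambda>x. V (x $ 2)) x = (if 2 = i then T (x$2) - a (x$2) * V (x$2) else 0)"
    "partial i (\<lambda>x. T (x $ 2)) x = (if 2 = i then q (x$2) * T1 (x$2) else 0)"
    "partial i (\<lambda>x. f (x $ 2)) x = (if 2 = i then 2 * q (x$2) * S (x$2) else 0)"
    "partial i H x = (if 2 = i then q (x$2) * Hs x else if 4 = i then Hr x else 0)"
    "partial i Hs x = (if 2 = i then Hsy x else if 4 = i then Hsr x else 0)"
    "partial i Hr x = (if 2 = i then q (x$2) * Hsr x else if 4 = i then Hrr x else 0)"
    "partial i w x = (if 2 = i then - (2 * S (x$2) * q (x$2) * V (x$2) * (w x)^2) else if 4 = i then - (2 * x$4 * (w x)^2) else 0)"
    "partial i (\<lambda>x::real^4. x $ 4) x = (if 4 = i then 1 else 0)"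
  by (simp_all add: partial_of_nth(1)[OF dq[OF assms]] partial_of_nth(1)[OF da[OF assms]]
    partial_of_nth(1)[OF dS[OF assms]] partial_of_nth(1)[OF dV[OF assms]]
    partial_of_nth(1)[OF dT[OF assms]] partial_of_nth(1)[OF df[OF assms]]
    partial_eqI[OF dH[OF assms]] partial_eqI[OF dHs[OF assms]] partial_eqI[OF dHr[OF assms]]
    partial_eqI[OF has_derivative_w[OF assms]] partial_nth axis_def)

text \<open>The components of the metric of the overview in the coordinates
  \<open>(x, y, u, rho)\<close>, with \<open>F' = f\<close> and \<open>S' = q V\<close>.\<close>

definition g :: "real^4 \<Rightarrow> real^4^4" where
  "g x = vector [
     vector [2 * H x * (f (x$2))^2 + (S (x$2))^2 * q (x$2) - 2 * V (x$2) * f (x$2) * q (x$2) + q (x$2) * x$4^2, 0, - 2 * H x * f (x$2) + V (x$2) * q (x$2), - f (x$2)],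
     vector [0, (S (x$2))^2 * q (x$2) + q (x$2) * x$4^2, 0, 0],
     vector [- 2 * H x * f (x$2) + V (x$2) * q (x$2), 0, 2 * H x, 1],
     vector [- f (x$2), 0, 1, 0]]"

definition ginv :: "real^4 \<Rightarrow> real^4^4" where
  "ginv x = vector [
     vector [w x / q (x$2), 0, f (x$2) * w x / q (x$2), - V (x$2) * w x],
     vector [0, w x / q (x$2), 0, 0],
     vector [f (x$2) * w x / q (x$2), 0, (f (x$2))^2 * w x / q (x$2), 1 - f (x$2) * V (x$2) * w x],
     vector [- V (x$2) * w x, 0, 1 - f (x$2) * V (x$2) * w x, (V (x$2))^2 * q (x$2) * w x - 2 * H x]]"

text \<open>The first index is the upper one. Tabulating the symbols as polynomials in functions
  with known partial derivatives makes the second differentiation, for the curvature, as mechanical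
  as the first.\<close>

definition christoffel_table :: "real^4 \<Rightarrow> real^4^4^4" where
  "christoffel_table x = (let y = x $ 2 in vector [
   vector [
     vector [Hr x * V y * (f y)^2 * w x + V y * q y * x$4 * w x, 2 * H x * S y * f y * w x - T y * f y * w x / 2 + a y / 2, - Hr x * V y * f y * w x, x$4 * w x],
     vector [2 * H x * S y * f y * w x - T y * f y * w x / 2 + a y / 2, V y * q y * x$4 * w x, - 2 * H x * S y * w x + T y * w x / 2, - S y * w x],
     vector [- Hr x * V y * f y * w x, - 2 * H x * S y * w x + T y * w x / 2, Hr x * V y * w x, 0],
     vector [x$4 * w x, - S y * w x, 0, 0]],
   vector [
     vector [- 4 * H x * S y * f y * w x - Hs x * (f y)^2 * w x + S y * V y * q y * w x + T y * f y * w x - a y / 2, 0, 2 * H x * S y * w x + Hs x * f y * w x - T y * w x / 2, S y * w x],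
     vector [0, S y * V y * q y * w x + a y / 2, 0, x$4 * w x],
     vector [2 * H x * S y * w x + Hs x * f y * w x - T y * w x / 2, 0, - Hs x * w x, 0],
     vector [S y * w x, x$4 * w x, 0, 0]],
   vector [
     vector [Hr x * V y * (f y)^3 * w x - Hr x * (f y)^2 + V y * f y * q y * x$4 * w x - q y * x$4, 2 * H x * S y * (f y)^2 * w x - S y * q y - T y * (f y)^2 * w x / 2 + a y * f y / 2, - Hr x * V y * (f y)^2 * w x + Hr x * f y, f y * x$4 * w x],
     vector [2 * H x * S y * (f y)^2 * w x - S y * q y - T y * (f y)^2 * w x / 2 + a y * f y / 2, V y * f y * q y * x$4 * w x - q y * x$4, - 2 * H x * S y * f y * w x + T y * f y * w x / 2, - S y * f y * w x],
     vector [- Hr x * V y * (f y)^2 * w x + Hr x * f y, - 2 * H x * S y * f y * w x + T y * f y * w x / 2, Hr x * V y * f y * w x - Hr x, 0],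
     vector [f y * x$4 * w x, - S y * f y * w x, 0, 0]],
   vector [
     vector [2 * H x * Hr x * (f y)^2 + 2 * H x * q y * x$4 - Hr x * (V y)^2 * (f y)^2 * q y * w x - (V y)^2 * (q y)^2 * x$4 * w x, - 2 * H x * S y * V y * f y * q y * w x - Hs x * f y * q y + T y * V y * f y * q y * w x / 2 + T y * q y / 2 - V y * a y * q y / 2, - 2 * H x * Hr x * f y + Hr x * (V y)^2 * f y * q y * w x, - Hr x * f y - V y * q y * x$4 * w x],
     vector [- 2 * H x * S y * V y * f y * q y * w x - Hs x * f y * q y + T y * V y * f y * q y * w x / 2 + T y * q y / 2 - V y * a y * q y / 2, 2 * H x * q y * x$4 - (V y)^2 * (q y)^2 * x$4 * w x, 2 * H x * S y * V y * q y * w x + Hs x * q y - T y * V y * q y * w x / 2, S y * V y * q y * w x],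
     vector [- 2 * H x * Hr x * f y + Hr x * (V y)^2 * f y * q y * w x, 2 * H x * S y * V y * q y * w x + Hs x * q y - T y * V y * q y * w x / 2, 2 * H x * Hr x - Hr x * (V y)^2 * q y * w x, Hr x],
     vector [- Hr x * f y - V y * q y * x$4 * w x, S y * V y * q y * w x, Hr x, 0]]])"

lemmas christoffel_table_eq = christoffel_table_def[unfolded Let_def]

lemma ginv: "x $ 2 \<in> I \<Longrightarrow> matrix_inv (g x) = ginv x"
  apply (rule matrix_inv_eqI)
  using w_mult_radius[of x] q_pos[of "x$2"]
  apply (simp add: vec_eq_iff forall_4 matrix_matrix_mult_def sum_4 g_def ginv_def mat_def)
  apply (simp add: field_simps)
  apply (intro conjI; (algebra | simp add: power2_eq_square))
  done

lemma christoffel_eq: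
  assumes x: "x $ 2 \<in> I"
  shows "christoffel g x l i j = christoffel_table x $ l $ i $ j"
proof -
  note [simp] = partial_rules partial_coefficients[OF x] differentiable_coefficients[OF x]
  have "\<forall>l i j. christoffel g x l i j = christoffel_table x $ l $ i $ j"
    unfolding forall_4 christoffel_def ginv[OF x] sum_4
    apply (simp add: g_def christoffel_table_eq ginv_def)
    using w_mult_radius[OF x] q_pos[OF x]
    apply (simp add: field_simps)
    apply (intro conjI; (algebra | simp add: power2_eq_square power3_eq_cube power4_eq_xxxx))
    done
  then show ?thesis by blast
qed

lemma open_tube: "open {x::real^4. x $ 2 \<in> I}"
  using open_vimage[OF I, of "\<lambda>x::real^4. x $ 2"]
  by (simp add: vimage_def continuous_intros)

text \<open>The table is known to be correct only over the tube; since the tube is open, this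
  suffices for the partial derivatives as well.\<close>

lemma riemann_up_eq:
  assumes x: "x $ 2 \<in> I"
  shows "riemann_up g x l k i j =
     partial i (\<lambda>y. christoffel_table y $ l $ j $ k) x - partial j (\<lambda>y. christoffel_table y $ l $ i $ k) x +
     (\<Sum>m\<in>UNIV. christoffel_table x $ l $ i $ m * christoffel_table x $ m $ j $ k -
                christoffel_table x $ l $ j $ m * christoffel_table x $ m $ i $ k)"
  unfolding riemann_up_def christoffel_eq[OF x]
  by (intro arg_cong2[of _ _ _ _ "(+)"] arg_cong2[of _ _ _ _ "(-)"] partial_cong_on[OF open_tube]) (auto simp: x christoffel_eq)

definition ricci_table :: "real^4 \<Rightarrow> real^4^4" where
  "ricci_table x = (let y = x $ 2 in vector [
     vector [4 * H x * Hr x * (f y)^2 * (x$4) * w x + 2 * H x * Hrr x * (f y)^2 - 4 * H x * S y * T y * (f y)^2 * (w x)^2 - 4 * H x * (S y)^2 * q y * w x - 4 * H x * V y * f y * q y * w x + 2 * H x * q y + 8 * (H x)^2 * (S y)^2 * (f y)^2 * (w x)^2 - 4 * Hr x * V y * f y * q y * (x$4) * w x + 2 * Hr x * q y * (x$4) - Hrr x * (V y)^2 * (f y)^2 * q y * w x - 4 * Hs x * S y * f y * q y * w x - Hs x * a y * (f y)^2 * w x - Hsy x * (f y)^2 * w x + K y * q y + S y * T y * q y * w x + (T y)^2 * (f y)^2 * (w x)^2 / 2 + T1 y * f y * q y * w x, 4 * H x * S y * V y * f y * q y * (x$4) * (w x)^2 - 2 * Hr x * S y * V y * f y * q y * w x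 - Hsr x * f y * q y - T y * V y * f y * q y * (x$4) * (w x)^2, - 4 * H x * Hr x * f y * (x$4) * w x - 2 * H x * Hrr x * f y + 4 * H x * S y * T y * f y * (w x)^2 + 2 * H x * V y * q y * w x - 8 * (H x)^2 * (S y)^2 * f y * (w x)^2 + 2 * Hr x * V y * q y * (x$4) * w x + Hrr x * (V y)^2 * f y * q y * w x + 2 * Hs x * S y * q y * w x + Hs x * a y * f y * w x + Hsy x * f y * w x - (T y)^2 * f y * (w x)^2 / 2 - T1 y * q y * w x / 2, - 4 * H x * (S y)^2 * f y * (w x)^2 - 2 * Hr x * f y * (x$4) * w x - Hrr x * f y + S y * T y * f y * (w x)^2],
     vector [4 * H x * S y * V y * f y * q y * (x$4) * (w x)^2 - 2 * Hr x * S y * V y * f y * q y * w x - Hsr x * f y * q y - T y * V y * f y * q y * (x$4) * (w x)^2, - 4 * H x * (S y)^2 * q y * w x + 2 * H x * q y + 2 * Hr x * q y * (x$4) + K y * q y + S y * T y * q y * w x, - 4 * H x * S y * V y * q y * (x$4) * (w x)^2 + 2 * Hr x * S y * V y * q y * w x + Hsr x * q y + T y * V y * q y * (x$4) * (w x)^2, 0],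
     vector [- 4 * H x * Hr x * f y * (x$4) * w x - 2 * H x * Hrr x * f y + 4 * H x * S y * T y * f y * (w x)^2 + 2 * H x * V y * q y * w x - 8 * (H x)^2 * (S y)^2 * f y * (w x)^2 + 2 * Hr x * V y * q y * (x$4) * w x + Hrr x * (V y)^2 * f y * q y * w x + 2 * Hs x * S y * q y * w x + Hs x * a y * f y * w x + Hsy x * f y * w x - (T y)^2 * f y * (w x)^2 / 2 - T1 y * q y * w x / 2, - 4 * H x * S y * V y * q y * (x$4) * (w x)^2 + 2 * Hr x * S y * V y * q y * w x + Hsr x * q y + T y * V y * q y * (x$4) * (w x)^2, 4 * H x * Hr x * (x$4) * w x + 2 * H x * Hrr x - 4 * H x * S y * T y * (w x)^2 + 8 * (H x)^2 * (S y)^2 * (w x)^2 - Hrr x * (V y)^2 * q y * w x - Hs x * a y * w x - Hsy x * w x + (T y)^2 * (w x)^2 / 2, 4 * H x * (S y)^2 * (w x)^2 + 2 * Hr x * (x$4) * w x + Hrr x - S y * T y * (w x)^2],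
     vector [- 4 * H x * (S y)^2 * f y * (w x)^2 - 2 * Hr x * f y * (x$4) * w x - Hrr x * f y + S y * T y * f y * (w x)^2, 0, 4 * H x * (S y)^2 * (w x)^2 + 2 * Hr x * (x$4) * w x + Hrr x - S y * T y * (w x)^2, 0]])"

lemmas ricci_table_eq = ricci_table_def[unfolded Let_def]

lemma ricci_g:
  assumes x: "x $ 2 \<in> I"
  shows "ricci g x $ k $ j = ricci_table x $ k $ j"
proof -
  note [simp] = partial_rules partial_coefficients[OF x] differentiable_coefficients[OF x]
  have "\<forall>k j. ricci g x $ k $ j = ricci_table x $ k $ j"
    using w_mult_radius[OF x] q_pos[OF x]
    unfolding ricci_def sum_4 riemann_up_eq[OF x] vec_lambda_beta forall_4
    apply (simp add: christoffel_table_eq ricci_table_eq)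
    apply (simp add: field_simps)
    apply (intro conjI; (algebra | simp add: power2_eq_square power3_eq_cube power4_eq_xxxx))
    done
  then show ?thesis by blast
qed

text \<open>In the frame of the lift, \<open>e_4\<close> is a multiple of the \<open>rho\<close>
  direction and \<open>e_3\<close> a combination of the \<open>u\<close> and \<open>rho\<close>
  directions. The three Weyl components in question therefore involve only first index
  \<open>4\<close> and third index \<open>3\<close> or \<open>4\<close>.\<close>

definition riemann_43_table :: "real^4 \<Rightarrow> real^4^4" where
  "riemann_43_table x = (let y = x $ 2 in vector [
     vector [2 * H x * (S y)^2 * q y * w x - Hr x * V y * f y * q y * (x$4) * w x + Hr x * q y * (x$4) + Hs x * S y * f y * q y * w x - S y * T y * q y * w x / 2, 2 * H x * S y * q y * (x$4) * w x + Hr x * S y * V y * f y * q y * w x - Hr x * S y * q y + Hs x * f y * q y * (x$4) * w x - Hsr x * f y * q y - T y * q y * (x$4) * w x / 2, 0, - Hrr x * f y],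
     vector [- 2 * H x * S y * q y * (x$4) * w x + Hr x * S y * q y + T y * q y * (x$4) * w x / 2, 2 * H x * (S y)^2 * q y * w x + Hr x * q y * (x$4) - S y * T y * q y * w x / 2, 0, 0],
     vector [Hr x * V y * q y * (x$4) * w x - Hs x * S y * q y * w x, - Hr x * S y * V y * q y * w x - Hs x * q y * (x$4) * w x + Hsr x * q y, 0, Hrr x],
     vector [0, 0, 0, 0]])"

lemmas riemann_43_table_eq = riemann_43_table_def[unfolded Let_def]

lemma riemann_44:
  assumes x: "x $ 2 \<in> I"
  shows "riemann g x 4 k 4 j = - Hrr x * (vector [- f (x$2), 0, 1, 0] :: real^4) $ k * (vector [- f (x$2), 0, 1, 0] :: real^4) $ j"
proof -
  note [simp] = partial_rules partial_coefficients[OF x] differentiable_coefficients[OF x]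
  have "\<forall>k j. riemann g x 4 k 4 j = - Hrr x * (vector [- f (x$2), 0, 1, 0] :: real^4) $ k * (vector [- f (x$2), 0, 1, 0] :: real^4) $ j"
    using w_mult_radius[OF x]
    unfolding riemann_def sum_4 riemann_up_eq[OF x] forall_4
    apply (simp add: christoffel_table_eq g_def)
    apply (simp add: field_simps)
    apply (intro conjI; (algebra | simp add: power2_eq_square power3_eq_cube power4_eq_xxxx))
    done
  then show ?thesis by blast
qed

lemma riemann_43:
  assumes x: "x $ 2 \<in> I"
  shows "riemann g x 4 k 3 j = riemann_43_table x $ k $ j"
proof -
  note [simp] = partial_rules partial_coefficients[OF x] differentiable_coefficients[OF x]
  have "\<forall>k j. riemann g x 4 k 3 j = riemann_43_table x $ k $ j"
    using w_mult_radius[OF x]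
    unfolding riemann_def sum_4 riemann_up_eq[OF x] forall_4
    apply (simp add: christoffel_table_eq g_def riemann_43_table_eq)
    apply (simp add: field_simps)
    apply (intro conjI; (algebra | simp add: power2_eq_square power3_eq_cube power4_eq_xxxx))
    done
  then show ?thesis by blast
qed

end

section \<open>The quasi-Einstein condition\<close>

text \<open>\<open>L\<close> and \<open>L1\<close> are the first and second derivatives of
  \<open>K\<close>, each differentiation being followed by division by \<open>q\<close>:
  \<open>H\<close> contains \<open>K\<close>, and the curvature contains two derivatives of
  \<open>H\<close>. The condition on \<open>V\<close> is the overview's equation for
  \<open>S''\<close>.\<close>

locale quasi_einstein = tube_base I q S V
  for I :: "real set" and q a S V K L L1 f :: "real \<Rightarrow> real" and M \<Lambda> :: real +
  assumes dq: "\<And>y. y \<in> I \<Longrightarrow> (q has_real_derivative q y * a y) (at y)"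
    and da: "\<And>y. y \<in> I \<Longrightarrow> (a has_real_derivative - (2 * q y * K y)) (at y)"
    and dV: "\<And>y. y \<in> I \<Longrightarrow> (V has_real_derivative 2 * (M - K y * S y + 4 * \<Lambda> * (S y)^3 / 3) - a y * V y) (at y)"
    and dK: "\<And>y. y \<in> I \<Longrightarrow> (K has_real_derivative q y * L y) (at y)"
    and dL: "\<And>y. y \<in> I \<Longrightarrow> (L has_real_derivative q y * L1 y) (at y)"
    and df: "\<And>y. y \<in> I \<Longrightarrow> (f has_real_derivative 2 * q y * S y) (at y)"
begin

definition T where "T y = 2 * (M - K y * S y + 4 * \<Lambda> * (S y)^3 / 3)"
definition T1 where "T1 y = - 2 * K y * V y - 2 * L y * S y + 8 * \<Lambda> * (S y)^2 * V y"
text \<open>For \<open>T\<close> as above, the (2,2) component of \<open>Ric = \<Lambda> g\<close>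
  is, after division by \<open>q\<close>, a linear first-order equation for \<open>H\<close> in the
  variable \<open>rho\<close>. Its solutions differ by multiples of
  \<open>rho/(rho^2 + S^2)\<close>; the one even in \<open>rho\<close> is taken.\<close>

definition H :: "real^4 \<Rightarrow> real" where
  "H x = - K (x$2) / 2 + \<Lambda> * ((x$4)^2 + 5 * (S (x$2))^2) / 6 + M * S (x$2) * w x"
definition Hs :: "real^4 \<Rightarrow> real" where
  "Hs x = - L (x$2) / 2 + 5 * \<Lambda> * S (x$2) * V (x$2) / 3 - 2 * M * (S (x$2))^2 * V (x$2) * (w x)^2 + M * V (x$2) * w x"
definition Hr :: "real^4 \<Rightarrow> real" where
  "Hr x = \<Lambda> * (x$4) / 3 - 2 * M * S (x$2) * (x$4) * (w x)^2"
text \<open>This derivative stays abstract: it enters the Ricci tensor only through a multiple of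
  \<sigma>^2, whose coefficient is free.\<close>

definition Hsy :: "real^4 \<Rightarrow> real" where
  "Hsy x = partial 2 Hs x"
definition Hsr :: "real^4 \<Rightarrow> real" where
  "Hsr x = 8 * M * (S (x$2))^2 * V (x$2) * (x$4) * (w x)^3 - 2 * M * V (x$2) * (x$4) * (w x)^2"
definition Hrr :: "real^4 \<Rightarrow> real" where
  "Hrr x = \<Lambda> / 3 + 8 * M * S (x$2) * (x$4)^2 * (w x)^3 - 2 * M * S (x$2) * (w x)^2"

lemma differentiable_basic:
  assumes "x $ 2 \<in> I"
  shows "(\<lambda>x. q (x $ 2)) differentiable (at x)" "(\<lambda>x. K (x $ 2)) differentiable (at x)"
    "(\<lambda>x. L (x $ 2)) differentiable (at x)"
    "(\<lambda>x. S (x $ 2)) differentiable (at x)" "(\<lambda>x. V (x $ 2)) differentiable (at x)"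
    "w differentiable (at x)" "(\<lambda>x::real^4. x $ 4) differentiable (at x)"
  using partial_of_nth(2)[OF dq[OF assms]] partial_of_nth(2)[OF dK[OF assms]]
    partial_of_nth(2)[OF dL[OF assms]]
    partial_of_nth(2)[OF dS[OF assms]] partial_of_nth(2)[OF dV[OF assms]] has_derivative_w[OF assms] differentiable_nth
  by (auto simp: differentiable_def)

lemma partial_basic:
  assumes "x $ 2 \<in> I"
  shows "partial i (\<lambda>x. q (x $ 2)) x = (if 2 = i then q (x$2) * a (x$2) else 0)"
    "partial i (\<lambda>x. K (x $ 2)) x = (if 2 = i then q (x$2) * L (x$2) else 0)"
    "partial i (\<lambda>x. L (x $ 2)) x = (if 2 = i then q (x$2) * L1 (x$2) else 0)"
    "partial i (\<lambda>x. S (x $ 2)) x = (if 2 = i then q (x$2) * V (x$2) else 0)"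
    "partial i (\<lambda>x. V (x $ 2)) x = (if 2 = i then 2 * (M - K (x$2) * S (x$2) + 4 * \<Lambda> * (S (x$2))^3 / 3) - a (x$2) * V (x$2) else 0)"
    "partial i w x = (if 2 = i then - (2 * S (x$2) * q (x$2) * V (x$2) * (w x)^2) else if 4 = i then - (2 * x$4 * (w x)^2) else 0)"
    "partial i (\<lambda>x::real^4. x $ 4) x = (if 4 = i then 1 else 0)"
  by (simp_all add: partial_of_nth(1)[OF dq[OF assms]] partial_of_nth(1)[OF dK[OF assms]]
    partial_of_nth(1)[OF dL[OF assms]]
    partial_of_nth(1)[OF dS[OF assms]] partial_of_nth(1)[OF dV[OF assms]]
    partial_eqI[OF has_derivative_w[OF assms]] partial_nth axis_def)

lemma differentiable_H: assumes x: "x $ 2 \<in> I" shows "H differentiable (at x)" "Hs differentiable (at x)" "Hr differentiable (at x)"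
  unfolding H_def Hs_def Hr_def divide_inverse
  by (intro derivative_intros differentiable_basic[OF x] | simp add: differentiable_basic[OF x])+

sublocale tube_metric I q a S V T T1 K f H Hs Hr Hsy Hsr Hrr
proof (unfold_locales, goal_cases)
  case (4 y)
  then show ?case by (auto intro!: derivative_eq_intros dK dS simp: T_def[abs_def] T1_def algebra_simps power2_eq_square power3_eq_cube)
next
  case (6 x)
  note [simp] = partial_rules partial_basic[OF 6] differentiable_basic[OF 6]
  show ?case using w_mult_radius[OF 6]
    by (intro has_derivative_partials differentiable_H 6) (simp_all add: H_def[abs_def] Hs_def Hr_def, simp_all add: field_simps power2_eq_square)
next
  case (7 x)
  note [simp] = partial_rules partial_basic[OF 7] differentiable_basic[OF 7]
  show ?case
    by (intro has_derivative_partials differentiable_H 7) (simp_all add: Hsy_def, simp_all add: Hs_def[abs_def] Hsr_def, simp_all add: eval_nat_numeral field_simps)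
next
  case (8 x)
  note [simp] = partial_rules partial_basic[OF 8] differentiable_basic[OF 8]
  show ?case
    by (intro has_derivative_partials differentiable_H 8) (simp_all add: Hsr_def Hrr_def Hr_def[abs_def], simp_all add: eval_nat_numeral field_simps)
qed (use dq da dV df in \<open>auto simp: T_def\<close>)

lemma ricci_34: assumes x: "x $ 2 \<in> I" shows "ricci g x $ 3 $ 4 = \<Lambda>"
    using w_mult_radius[OF x] unfolding ricci_g[OF x] by (simp add: ricci_table_eq T_def H_def Hs_def Hr_def Hrr_def Hsr_def T1_def field_simps, algebra)
text \<open>These are the components of \<open>Ric = \<Lambda> g + \<Phi> \<sigma>\<^sup>2\<close> that determine all others, since the remaining
  components are linear combinations of them with coefficients built from \<open>f\<close>.\<close>

lemma ricci_frame:
  assumes x: "x $ 2 \<in> I"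
  shows "ricci g x $ 3 $ 4 = \<Lambda>" and "ricci g x $ 2 $ 2 = \<Lambda> * (q (x$2) * ((x$4)^2 + (S (x$2))^2))"
    "ricci g x $ 2 $ 3 = 0"
    "ricci g x $ 1 $ 3 = \<Lambda> * V (x$2) * q (x$2) - f (x$2) * ricci g x $ 3 $ 3"
proof -

  note defs = T_def H_def Hs_def Hr_def Hrr_def Hsr_def T1_def
  show "ricci g x $ 3 $ 4 = \<Lambda>"
    using w_mult_radius[OF x] unfolding ricci_g[OF x] by (simp add: ricci_table_eq defs field_simps, algebra)
  show "ricci g x $ 2 $ 2 = \<Lambda> * (q (x$2) * ((x$4)^2 + (S (x$2))^2))"
    using w_mult_radius[OF x] unfolding ricci_g[OF x] by (simp add: ricci_table_eq defs field_simps, algebra)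
  show "ricci g x $ 2 $ 3 = 0"
    using w_mult_radius[OF x] unfolding ricci_g[OF x] by (simp add: ricci_table_eq defs field_simps, algebra)
  \<comment> \<open>\<open>?e\<close> is what \<open>Ric_13 + f Ric_33 - q V Ric_34\<close> becomes
    after division by \<open>q\<close>; in this combination the second \<open>y\<close>-derivative
    of \<open>H\<close> cancels.\<close>
  have "- 4 * H x * (S (x$2))^2 * V (x$2) * w x ^ 2 + 2 * H x * V (x$2) * w x - Hrr x * V (x$2) + 2 * Hs x * S (x$2) * w x
    + S (x$2) * T (x$2) * V (x$2) * (w x)^2 - T1 (x$2) * w x / 2 = 0" (is "?e = 0")
    using w_mult_radius[OF x] by (simp add: defs field_simps, algebra)
  then have "q (x$2) * ?e = 0" by simp
  then show "ricci g x $ 1 $ 3 = \<Lambda> * V (x$2) * q (x$2) - f (x$2) * ricci g x $ 3 $ 3"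
    using w_mult_radius[OF x] ricci_34[OF x] unfolding ricci_g[OF x]
    by (simp add: ricci_table_eq field_simps, algebra)
qed

text \<open>Since \<open>g_33 = 2 H\<close> and \<sigma> has third component \<open>1\<close>, the
  (3,3) component of \<open>Ric - \<Lambda> g\<close> is the coefficient of \<sigma>^2.\<close>

definition null_term where "null_term x = ricci g x $ 3 $ 3 - 2 * \<Lambda> * H x"

lemma ricci_eq:
  assumes x: "x $ 2 \<in> I"
  shows "ricci g x $ i $ j = \<Lambda> * g x $ i $ j + null_term x * (vector [- f (x$2), 0, 1, 0] :: real^4) $ i * (vector [- f (x$2), 0, 1, 0] :: real^4) $ j"
proof -
  have r33: "ricci g x $ 3 $ 3 = ricci_table x $ 3 $ 3" by (rule ricci_g[OF x])
  have "\<forall>i j. ricci g x $ i $ j = \<Lambda> * g x $ i $ j + null_term x * (vector [- f (x$2), 0, 1, 0] :: real^4) $ i * (vector [- f (x$2), 0, 1, 0] :: real^4) $ j"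
    using ricci_frame[OF x] w_mult_radius[OF x]
    unfolding null_term_def ricci_g[OF x] forall_4
    apply (simp add: g_def)
    apply (simp add: ricci_table_eq)
    apply (intro conjI; simp add: field_simps; algebra)
    done
  then show ?thesis by blast
qed

end

section \<open>Tubular CR structures\<close>

lemma tube_push_eq:
  assumes "(F has_real_derivative F') (at (p $ 2))"
  shows "tube_push F p = (\<lambda>X. (Complex (X $ 1) (X $ 2), Complex (X $ 3) (F' * X $ 2)))"
proof -
  have eq: "tube_param F = (\<lambda>q. (of_real (q $ 1) + \<i> * of_real (q $ 2), of_real (q $ 3) + \<i> * of_real (F (q $ 2))))"
    by (auto simp: tube_param_def fun_eq_iff complex_eq_iff)
  have nth: "((\<lambda>q::real^3. q $ i) has_derivative (\<lambda>X. X $ i)) (at p)" for i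
    by (intro bounded_linear_imp_has_derivative bounded_linear_vec_nth)
  have F: "((\<lambda>q::real^3. F (q $ 2)) has_derivative (\<lambda>X. F' * X $ 2)) (at p)"
    using has_derivative_compose[OF nth[of 2], of F "(*) F'"] assms by (simp add: has_field_derivative_def)
  have "(tube_param F has_derivative (\<lambda>X. (of_real (X $ 1) + \<i> * of_real (X $ 2), of_real (X $ 3) + \<i> * of_real (F' * X $ 2)))) (at p)"
    unfolding eq by (intro has_derivative_Pair has_derivative_add has_derivative_mult_right has_derivative_of_real nth F)
  then have "tube_push F p = (\<lambda>X. (of_real (X $ 1) + \<i> * of_real (X $ 2), of_real (X $ 3) + \<i> * of_real (F' * X $ 2)))"
    unfolding tube_push_def by (rule frechet_derivative_at[symmetric])
  then show ?thesis by (simp add: fun_eq_iff complex_eq_iff)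
qed

lemma tube_D_iff:
  assumes "(F has_real_derivative F') (at (p $ 2))"
  shows "X \<in> tube_D F p \<longleftrightarrow> X $ 3 = F' * X $ 1"
proof
  assume "X \<in> tube_D F p"
  then obtain Y where "tube_push F p X = mult_i (tube_push F p Y)" by (auto simp: tube_D_def)
  then show "X $ 3 = F' * X $ 1"
    unfolding tube_push_eq[OF assms] by (auto simp: mult_i_def complex_eq_iff)
next
  assume "X $ 3 = F' * X $ 1"
  \<comment> \<open>The vector used here is \<open>- J X\<close>, whose image is the image of
    \<open>X\<close> divided by the imaginary unit.\<close>
  then have "tube_push F p X = mult_i (tube_push F p (vector [X $ 2, - X $ 1, F' * X $ 2]))"
    unfolding tube_push_eq[OF assms] by (simp add: mult_i_def complex_eq_iff)
  then show "X \<in> tube_D F p" by (auto simp: tube_D_def)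
qed

lemma tube_J_eq:
  assumes "(F has_real_derivative F') (at (p $ 2))" and "X $ 3 = F' * X $ 1"
  shows "tube_J F p X = vector [- X $ 2, X $ 1, - F' * X $ 2]"
  unfolding tube_J_def tube_push_eq[OF assms(1)]
  by (rule the_equality) (use assms(2) in \<open>auto simp: mult_i_def complex_eq_iff vec_eq_iff forall_3\<close>)

lemma open_tube_dom: "open I \<Longrightarrow> open (tube_dom I)"
  using open_vimage[of I "\<lambda>x::real^3. x $ 2"] by (simp add: tube_dom_def vimage_def continuous_intros)

lemma total_space_tube_dom: "total_space (tube_dom I) = {x. x $ 2 \<in> I}"
  by (simp add: total_space_def tube_dom_def base_def)

lemma smooth_on_nth_tube:
  fixes h :: "real \<Rightarrow> real"
  assumes "open I" "smooth_on I h"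
  shows "smooth_on {x::real^'n. x $ j \<in> I} (\<lambda>x. h (x $ j))"
proof -
  have "open {x::real^'n. x $ j \<in> I}"
    using open_vimage[of I "\<lambda>x::real^'n. x $ j"] assms(1) by (simp add: vimage_def continuous_intros)
  then show ?thesis by (intro smooth_on_compose_real[OF _ assms] smooth_on_nth) auto
qed

text \<open>The global vector field \<open>X = \<partial>_x + F' \<partial>_u\<close>, chosen
  because \<open>J X\<close> is simply \<open>\<partial>_y\<close>, so that
  \<open>[X, J X] = - F'' \<partial>_u\<close>.\<close>

definition tube_section :: "(real \<Rightarrow> real) \<Rightarrow> real^3 \<Rightarrow> real^3" where
  "tube_section f p = vector [1, 0, f (p $ 2)]"

lemma tube_section:
  assumes "open I" "smooth_on I f" "\<And>y. y \<in> I \<Longrightarrow> (F has_real_derivative f y) (at y)"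
  shows "nonvanishing_section (tube_D F) (tube_dom I) (tube_section f)"
    "p \<in> tube_dom I \<Longrightarrow> tube_J F p (tube_section f p) = vector [0, 1, 0]"
proof -
  note o = open_tube_dom[OF assms(1)]
  have "smooth_on (tube_dom I) (\<lambda>p. f (p $ 2))" using smooth_on_nth_tube[OF assms(1,2)] by (simp add: tube_dom_def)
  then have "\<forall>i. smooth_on (tube_dom I) (\<lambda>p. tube_section f p $ i)"
    by (simp add: forall_3 tube_section_def)
  then have "smooth_on (tube_dom I) (tube_section f)" by (intro smooth_on_vecI o) auto
  moreover have "tube_section f p \<in> tube_D F p" if "p \<in> tube_dom I" for p
    using tube_D_iff[OF assms(3)] that by (simp add: tube_dom_def tube_section_def)
  moreover have "tube_section f p \<noteq> 0" for p by (simp add: vec_eq_iff forall_3 tube_section_def)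
  ultimately show "nonvanishing_section (tube_D F) (tube_dom I) (tube_section f)"
    by (simp add: nonvanishing_section_def)
  show "tube_J F p (tube_section f p) = vector [0, 1, 0]" if "p \<in> tube_dom I"
    using that by (subst tube_J_eq[OF assms(3)]) (auto simp: tube_dom_def tube_section_def)
qed

text \<open>The definition is tested on \<open>tube_section f\<close> alone: a zero of
  \<open>F''\<close> would make the bracket of this section with its \<open>J\<close>-image vanish
  at that point, and \<open>0\<close> lies in the distribution.\<close>

lemma strictly_pseudoconvex_tube_imp:
  assumes I: "open I" and f: "smooth_on I f" and dF: "\<And>y. y \<in> I \<Longrightarrow> (F has_real_derivative f y) (at y)"
    and spc: "strictly_pseudoconvex (tube_dom I) (tube_D F) (tube_J F)"
    and y: "y \<in> I" and G: "(f has_real_derivative G) (at y)"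
  shows "G \<noteq> 0"
proof
  assume "G = 0"
  define p where "p = (vector [0, y, 0] :: real^3)"
  have p: "p \<in> tube_dom I" "p $ 2 = y" using y by (auto simp: p_def tube_dom_def)
  note o = open_tube_dom[OF I]
  have "lie_bracket (tube_section f) (\<lambda>q. tube_J F q (tube_section f q)) p \<notin> tube_D F p"
    using spc o tube_section(1)[OF I f dF] p unfolding strictly_pseudoconvex_def by blast
  moreover have "lie_bracket (tube_section f) (\<lambda>q. tube_J F q (tube_section f q)) p = 0"
  proof -
    have 1: "partial i (\<lambda>q. tube_J F q (tube_section f q) $ j) p = 0" for i j
    proof -
      have "partial i (\<lambda>q. tube_J F q (tube_section f q) $ j) p = partial i (\<lambda>q. (vector [0, 1, 0] :: real^3) $ j) p"
        by (rule partial_cong_on[OF o p(1)]) (simp add: tube_section(2)[OF I f dF])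
      then show ?thesis by simp
    qed
    have "partial i (\<lambda>q::real^3. f (q $ 2)) p = 0" for i
      using partial_of_nth(1)[of f G p 2 i] G p \<open>G = 0\<close> by simp
    then have 2: "partial i (\<lambda>q. tube_section f q $ j) p = 0" for i j
      using exhaust_3[of j] by (auto simp: tube_section_def)
    show ?thesis by (simp add: lie_bracket_def 1 2 vec_eq_iff)
  qed
  ultimately show False using tube_D_iff[OF dF[OF y[folded p(2)]], of 0] by simp
qed

section \<open>The lift\<close>

lemma scaleR_symprod_cvec:
  "c *\<^sub>R symprod (cvec (k *\<^sub>R s)) (cvec (l *\<^sub>R t)) = cmat (\<chi> i j. (c * (k * l)) / 2 * (s $ i * t $ j + t $ i * s $ j))"
  by (simp add: vec_eq_iff symprod_def cvec_def cmat_def complex_eq_iff field_simps)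

locale tube_lift = quasi_einstein I q a S V K L L1 f M \<Lambda>
  for I :: "real set" and q a S V K L L1 f :: "real \<Rightarrow> real" and M \<Lambda> :: real +
  fixes F :: "real \<Rightarrow> real"
  assumes dF: "\<And>y. y \<in> I \<Longrightarrow> (F has_real_derivative f y) (at y)"
    and smooth: "smooth_on I q" "smooth_on I a" "smooth_on I S" "smooth_on I V" "smooth_on I K" "smooth_on I L" "smooth_on I L1" "smooth_on I f"
    and M_nz: "M \<noteq> 0"
begin

definition G where "G y = 2 * q y * S y"
text \<open>\<open>\<mu>\<close> is \<open>dz/2\<close> and \<open>lam\<close> is
  \<open>(du - F' dx)/(2 F'')\<close>: the section gives
  \<open>\<partial> = \<partial>_x - i \<partial>_y + F' \<partial>_u\<close> and
  \<open>\<partial>_o = 2 F'' \<partial>_u\<close>, and the factors normalise the pairings to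
  \<open>1\<close>.\<close>

definition \<mu> :: "real^3 \<Rightarrow> complex^3" where "\<mu> p = vector [1/2, \<i>/2, 0]"
definition lam :: "real^3 \<Rightarrow> real^3" where
  "lam p = vector [- f (p$2) / G (p$2), 0, 1 / G (p$2)] /\<^sub>R 2"
text \<open>As \<open>\<mu>\<close> times its conjugate is \<open>(dx^2 + dy^2)/4\<close>, the
  conformal factor must satisfy \<open>P^2/2 = q (rho^2 + S^2)\<close>.\<close>

definition P :: "real^4 \<Rightarrow> real" where "P x = sqrt (2 * q (x$2) * ((x$4)^2 + (S (x$2))^2))"
text \<open>Comparing the terms with \<sigma> and the differential of \<open>rho\<close> in the two
  forms of the metric requires the \<open>rho\<close>-derivative of \<open>r\<close> to be
  \<open>2 G/P^2 = 2 S w\<close>; the arctangent is an antiderivative.\<close>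

definition r :: "real^4 \<Rightarrow> real" where "r x = 2 * arctan (x$4 / S (x$2))"
text \<open>Writing \<open>W = a + i b\<close>, the form \<open>W \<mu>\<close> plus its conjugate
  is \<open>a dx - b dy\<close>. The imaginary part removes the \<open>dy\<close> component of
  \<open>dr\<close>, and the real part supplies \<open>S' dx\<close> up to the common factor
  \<open>2 S w\<close>; \<open>Hl\<close> carries the same factor.\<close>

definition Wl :: "real^4 \<Rightarrow> complex" where
  "Wl x = of_real (2 * q (x$2) * V (x$2) * w x) * Complex (S (x$2)) (- x$4)"
definition Hl :: "real^4 \<Rightarrow> real" where "Hl x = 8 * q (x$2) * (S (x$2))^2 * w x * H x"

lemma G_nz: "y \<in> I \<Longrightarrow> G y \<noteq> 0"
  using q_pos[of y] S_nz[of y] by (simp add: G_def)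

lemma smooth_tube:
  "smooth_on {x::real^'n. x $ j \<in> I} (\<lambda>x. q (x $ j))" "smooth_on {x::real^'n. x $ j \<in> I} (\<lambda>x. a (x $ j))"
  "smooth_on {x::real^'n. x $ j \<in> I} (\<lambda>x. S (x $ j))" "smooth_on {x::real^'n. x $ j \<in> I} (\<lambda>x. V (x $ j))"
  "smooth_on {x::real^'n. x $ j \<in> I} (\<lambda>x. K (x $ j))" "smooth_on {x::real^'n. x $ j \<in> I} (\<lambda>x. L (x $ j))"
  "smooth_on {x::real^'n. x $ j \<in> I} (\<lambda>x. L1 (x $ j))" "smooth_on {x::real^'n. x $ j \<in> I} (\<lambda>x. f (x $ j))"
  by (intro smooth_on_nth_tube I smooth)+

lemma smooth_G: "smooth_on {x::real^'n. x $ j \<in> I} (\<lambda>x. G (x $ j))"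
proof -
  have "open {x::real^'n. x $ j \<in> I}"
    using open_vimage[of I "\<lambda>x::real^'n. x $ j"] I by (simp add: vimage_def continuous_intros)
  then show ?thesis unfolding G_def by (intro smooth_on_mult smooth_on_const smooth_tube)
qed

lemma deriv_f: "y \<in> I \<Longrightarrow> (f has_real_derivative G y) (at y)"
  unfolding G_def by (rule df)

lemma cr_del_section:
  assumes "p \<in> tube_dom I"
  shows "cr_del (tube_J F) (tube_section f) p = vector [1, - \<i>, of_real (f (p $ 2))]"
    "cr_delbar (tube_J F) (tube_section f) p = vector [1, \<i>, of_real (f (p $ 2))]"
  using tube_section(2)[OF I smooth(8) dF assms]
  by (simp_all add: cr_del_def cr_delbar_def conj_vec_def cvec_def vec_eq_iff forall_3 tube_section_def)

lemma partial_of_real: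
  assumes "\<phi> differentiable (at x)"
  shows "partial i (\<lambda>x. complex_of_real (\<phi> x)) x = of_real (partial i \<phi> x)"
  unfolding partial_def
  using frechet_derivative_at[OF has_derivative_of_real[OF has_derivative_frechet[OF assms]], symmetric] by (rule fun_cong)

lemma cr_del_o_section:
  assumes p: "p \<in> tube_dom I"
  shows "cr_del_o (tube_J F) (tube_section f) p = vector [0, 0, of_real (2 * G (p $ 2))]"
proof -
  note o = open_tube_dom[OF I]
  have pI: "p $ 2 \<in> I" using p by (simp add: tube_dom_def)
  have pf: "partial i (\<lambda>p::real^3. complex_of_real (f (p $ 2))) p = (if i = 2 then of_real (G (p $ 2)) else 0)" for i
    using partial_of_nth(1)[OF deriv_f[OF pI], of i] partial_of_nth(2)[OF deriv_f[OF pI]] partial_of_real[of "\<lambda>p::real^3. f (p $ 2)" p i] by auto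
  have 1: "partial i (\<lambda>p. cr_del (tube_J F) (tube_section f) p $ j) p = (if i = 2 \<and> j = 3 then of_real (G (p $ 2)) else 0)" for i j
    using partial_cong_on[OF o p, of "\<lambda>p. cr_del (tube_J F) (tube_section f) p $ j" "\<lambda>p. (vector [1, - \<i>, of_real (f (p $ 2))] :: complex^3) $ j" i]
      cr_del_section(1) pf exhaust_3[of j] by auto
  have 2: "partial i (\<lambda>p. cr_delbar (tube_J F) (tube_section f) p $ j) p = (if i = 2 \<and> j = 3 then of_real (G (p $ 2)) else 0)" for i j
    using partial_cong_on[OF o p, of "\<lambda>p. cr_delbar (tube_J F) (tube_section f) p $ j" "\<lambda>p. (vector [1, \<i>, of_real (f (p $ 2))] :: complex^3) $ j" i]
      cr_del_section(2) pf exhaust_3[of j] by auto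
  show ?thesis unfolding cr_del_o_def lie_bracket_def 1 2 cr_del_section[OF p]
    by (simp add: sum_3 vec_eq_iff forall_3 complex_eq_iff)
qed

lemma adapted_coframe_lift: "adapted_coframe (tube_dom I) (tube_D F) (tube_J F) \<mu> lam"
  unfolding adapted_coframe_def
proof (intro conjI exI[of _ "tube_section f"] ballI)
  note o = open_tube_dom[OF I]
  show "smooth_on (tube_dom I) \<mu>" unfolding \<mu>_def by simp
  have "\<forall>i. smooth_on (tube_dom I) (\<lambda>p. lam p $ i)"
    using o G_nz smooth_tube(8)[where ?'n = 3 and j = 2] smooth_G[where ?'n = 3 and j = 2]
    unfolding forall_3 lam_def tube_dom_def
    by (auto intro!: smooth_on_mult smooth_on_divide smooth_on_minus smooth_on_const)
  then show "smooth_on (tube_dom I) lam" by (intro smooth_on_vecI o) auto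
  show "nonvanishing_section (tube_D F) (tube_dom I) (tube_section f)"
    by (rule tube_section(1)[OF I smooth(8) dF])
  fix p assume p: "p \<in> tube_dom I"
  then have G: "G (p $ 2) \<noteq> 0" using G_nz by (simp add: tube_dom_def)
  note s = pairing_def sum_3 \<mu>_def lam_def conj_vec_def cvec_def cr_del_section[OF p] cr_del_o_section[OF p]
  show "pairing (\<mu> p) (cr_del (tube_J F) (tube_section f) p) = 1"
    "pairing (\<mu> p) (cr_delbar (tube_J F) (tube_section f) p) = 0"
    "pairing (\<mu> p) (cr_del_o (tube_J F) (tube_section f) p) = 0"
    "pairing (conj_vec (\<mu> p)) (cr_del (tube_J F) (tube_section f) p) = 0"
    "pairing (conj_vec (\<mu> p)) (cr_delbar (tube_J F) (tube_section f) p) = 1"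
    "pairing (conj_vec (\<mu> p)) (cr_del_o (tube_J F) (tube_section f) p) = 0"
    "pairing (cvec (lam p)) (cr_del (tube_J F) (tube_section f) p) = 0"
    "pairing (cvec (lam p)) (cr_delbar (tube_J F) (tube_section f) p) = 0"
    "pairing (cvec (lam p)) (cr_del_o (tube_J F) (tube_section f) p) = 1"
    using G by (simp_all add: s complex_eq_iff)
qed

lemma radius_pos: "x $ 2 \<in> I \<Longrightarrow> (x$4)^2 + (S (x$2))^2 > 0"
  using S_nz[of "x$2"] by (simp add: sum_power2_gt_zero_iff)

lemma w_pos: "x $ 2 \<in> I \<Longrightarrow> w x > 0"
  unfolding w_def using radius_pos[of x] by simp

lemma P_squared: "x $ 2 \<in> I \<Longrightarrow> (P x)^2 = 2 * q (x$2) * ((x$4)^2 + (S (x$2))^2)" "x $ 2 \<in> I \<Longrightarrow> P x > 0"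
  using radius_pos[of x] q_pos[of "x$2"] by (simp_all add: P_def)

definition sig :: "real^4 \<Rightarrow> real^4" where "sig x = vector [- f (x$2), 0, 1, 0]"
definition th :: "real^4 \<Rightarrow> real^4" where "th x = vector [q (x$2) * V (x$2) - H x * f (x$2), 0, H x, 1]"

lemma pullback_coframe:
  assumes x: "x $ 2 \<in> I"
  shows "pullback \<mu> x = vector [1/2, \<i>/2, 0, 0]"
    "pullback lam x = (1 / (2 * G (x$2))) *\<^sub>R sig x"
  by (simp_all add: pullback_def base_def \<mu>_def lam_def vec_eq_iff forall_4 sig_def)

lemma differential_r:
  assumes x: "x $ 2 \<in> I"
  shows "differential r x = vector [0, - 2 * x$4 * q (x$2) * V (x$2) * w x, 0, 2 * S (x$2) * w x]"
proof -
  have nz: "S (x$2) \<noteq> 0" using S_nz x by simp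
  have S: "((\<lambda>x. S (x $ 2)) has_derivative (\<lambda>v. v $ 2 * (q (x$2) * V (x$2)))) (at x)"
    using has_derivative_compose[OF bounded_linear_imp_has_derivative[OF bounded_linear_vec_nth[of 2]], of S "\<lambda>v. v * (q (x$2) * V (x$2))" x UNIV] dS[OF x]
    by (simp add: has_field_derivative_def mult.commute[of _ "q (x$2) * V (x$2)"])
  have r4: "((\<lambda>x::real^4. x $ 4) has_derivative (\<lambda>v. v $ 4)) (at x)"
    by (intro bounded_linear_imp_has_derivative bounded_linear_vec_nth)
  have "((\<lambda>x. x $ 4 / S (x $ 2)) has_derivative (\<lambda>v. (v $ 4 * S (x$2) - x $ 4 * (v $ 2 * (q (x$2) * V (x$2)))) / (S (x$2) * S (x$2)))) (at x)"
    by (rule has_derivative_divide'[OF r4 S nz])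
  moreover have "(arctan has_derivative (\<lambda>v. v * inverse (1 + (x $ 4 / S (x $ 2))^2))) (at (x $ 4 / S (x $ 2)))"
    using DERIV_arctan[of "x $ 4 / S (x $ 2)"] by (simp add: has_field_derivative_def mult_commute_abs)
  ultimately have "((\<lambda>x. arctan (x $ 4 / S (x $ 2))) has_derivative (\<lambda>v. (v $ 4 * S (x$2) - x $ 4 * (v $ 2 * (q (x$2) * V (x$2)))) / (S (x$2) * S (x$2)) * inverse (1 + (x $ 4 / S (x $ 2))^2))) (at x)"
    by (rule has_derivative_compose)
  then have D: "(r has_derivative (\<lambda>v. 2 * ((v $ 4 * S (x$2) - x $ 4 * (v $ 2 * (q (x$2) * V (x$2)))) / (S (x$2) * S (x$2)) * inverse (1 + (x $ 4 / S (x $ 2))^2)))) (at x)"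
    unfolding r_def[abs_def] by (rule has_derivative_mult_right)
  have "1 / (S (x$2) * S (x$2)) * inverse (1 + (x $ 4 / S (x $ 2))^2) = w x"
    using nz radius_pos[OF x] by (simp add: w_def field_simps power2_eq_square)
  moreover have "2 * (z / (S (x$2) * S (x$2)) * inverse (1 + (x $ 4 / S (x $ 2))^2)) =
      2 * z * (1 / (S (x$2) * S (x$2)) * inverse (1 + (x $ 4 / S (x $ 2))^2))" for z
    by simp
  ultimately have "2 * (z / (S (x$2) * S (x$2)) * inverse (1 + (x $ 4 / S (x $ 2))^2)) = 2 * z * w x" for z
    by simp
  note D' = D[unfolded this]
  show ?thesis
    unfolding differential_def partial_eqI[OF D']
    by (simp add: vec_eq_iff forall_4 axis_def)
qed

lemma lift_form_eq:
  assumes x: "x $ 2 \<in> I"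
  shows "lift_form \<mu> lam r Wl Hl x = cvec ((2 * S (x$2) * w x) *\<^sub>R th x)"
proof -
  have "G (x$2) \<noteq> 0" "q (x$2) > 0" "S (x$2) \<noteq> 0" using G_nz x q_pos S_nz by auto
  then show ?thesis
    unfolding lift_form_def differential_r[OF x] pullback_coframe[OF x]
    by (simp add: vec_eq_iff forall_4 cvec_def conj_vec_def sig_def th_def complex_eq_iff Wl_def Hl_def G_def field_simps power2_eq_square)
qed

lemma metric_eq:
  assumes x: "x $ 2 \<in> I"
  shows "cmat (g x) = (2 * (P x)\<^sup>2) *\<^sub>R (symprod (pullback \<mu> x) (conj_vec (pullback \<mu> x))
         + symprod (cvec (pullback lam x)) (lift_form \<mu> lam r Wl Hl x))"
proof -
  have nz: "G (x$2) \<noteq> 0" "q (x$2) > 0" "S (x$2) \<noteq> 0" "w x > 0" using G_nz x q_pos S_nz w_pos by auto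
  have P2w: "(P x)^2 * w x = 2 * q (x$2)" using w_mult_radius[OF x] unfolding P_squared(1)[OF x] by algebra
  have e: "2 * (P x)^2 * (1 / (2 * G (x$2)) * (2 * S (x$2) * w x)) = 2"
  proof -
    have "2 * (P x)^2 * (1 / (2 * G (x$2)) * (2 * S (x$2) * w x)) = 2 * S (x$2) * ((P x)^2 * w x) / G (x$2)"
      by (simp add: field_simps)
    also have "\<dots> = 2" unfolding P2w using nz by (simp add: G_def)
    finally show ?thesis .
  qed
  have sp: "(2 * (P x)\<^sup>2) *\<^sub>R symprod (cvec (pullback lam x)) (lift_form \<mu> lam r Wl Hl x) =
     cmat (\<chi> i j. sig x $ i * th x $ j + th x $ i * sig x $ j)"
  proof -
    show ?thesis unfolding lift_form_eq[OF x] pullback_coframe(2)[OF x] scaleR_symprod_cvec e by simp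
  qed
  show ?thesis
    unfolding scaleR_add_right sp
    unfolding pullback_coframe(1)[OF x] P_squared(1)[OF x]
    by (simp add: vec_eq_iff forall_4 cmat_def symprod_def conj_vec_def g_def sig_def th_def complex_eq_iff algebra_simps power2_eq_square)
qed

section \<open>Smoothness and Lorentzian signature of the lift\<close>

lemma smooth_x4: "smooth_on {x::real^4. x $ 2 \<in> I} (\<lambda>x. x $ 4)"
  by (rule smooth_on_nth[OF open_tube])

lemma smooth_w: "smooth_on {x::real^4. x $ 2 \<in> I} w"
  unfolding w_def[abs_def]
  by (intro smooth_on_inverse[OF open_tube] smooth_on_add[OF open_tube] smooth_on_power[OF open_tube] smooth_x4 smooth_tube)
     (use radius_pos in force)

lemmas smooth_basic = smooth_on_add[OF open_tube] smooth_on_diff[OF open_tube] smooth_on_minus[OF open_tube] smooth_on_mult[OF open_tube] smooth_on_power[OF open_tube]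
  smooth_on_const smooth_x4 smooth_w smooth_tube[where ?'n = 4 and j = 2] smooth_G[where ?'n = 4 and j = 2]

lemma smooth_H: "smooth_on {x::real^4. x $ 2 \<in> I} H" "smooth_on {x::real^4. x $ 2 \<in> I} Hs"
  "smooth_on {x::real^4. x $ 2 \<in> I} Hr" "smooth_on {x::real^4. x $ 2 \<in> I} Hrr"
  unfolding H_def[abs_def] Hs_def[abs_def] Hr_def[abs_def] Hrr_def[abs_def] divide_inverse
  by (intro smooth_basic)+

lemma smooth_Hsy: "smooth_on {x::real^4. x $ 2 \<in> I} Hsy"
  unfolding Hsy_def[abs_def] using smooth_on_partial[OF smooth_H(2), of 2] by simp

lemma smooth_T: "smooth_on {x::real^4. x $ 2 \<in> I} (\<lambda>x. T (x $ 2))"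
  unfolding T_def divide_inverse by (intro smooth_basic)

lemma smooth_P: "smooth_on {x::real^4. x $ 2 \<in> I} P"
  unfolding P_def[abs_def]
  by (rule smooth_on_sqrt[OF open_tube]) (intro smooth_basic, use P_squared in \<open>auto simp: P_def real_sqrt_gt_0_iff\<close>)

lemma smooth_r: "smooth_on {x::real^4. x $ 2 \<in> I} r"
  unfolding r_def[abs_def]
  by (intro smooth_basic smooth_on_arctan[OF open_tube] smooth_on_divide[OF open_tube]) (use S_nz in auto)

lemma smooth_Wl: "smooth_on {x::real^4. x $ 2 \<in> I} Wl"
proof -
  have "Wl = (\<lambda>x. of_real (2 * q (x$2) * V (x$2) * w x) * (of_real (S (x$2)) + (- \<i>) * of_real (x$4)))"
    by (auto simp: Wl_def fun_eq_iff complex_eq_iff)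
  moreover have "smooth_on {x::real^4. x $ 2 \<in> I} (\<lambda>x. complex_of_real (2 * q (x$2) * V (x$2) * w x) * (of_real (S (x$2)) + (- \<i>) * of_real (x$4)))"
    by (intro smooth_on_add[OF open_tube] smooth_on_mult[OF open_tube] smooth_on_const smooth_on_of_real[OF open_tube] smooth_basic)
  ultimately show ?thesis by simp
qed

lemma smooth_Hl: "smooth_on {x::real^4. x $ 2 \<in> I} Hl"
  unfolding Hl_def[abs_def] by (intro smooth_basic smooth_H)

lemma smooth_g: "smooth_on {x::real^4. x $ 2 \<in> I} g"
proof -
  have "\<forall>i j. smooth_on {x::real^4. x $ 2 \<in> I} (\<lambda>x. g x $ i $ j)"
    unfolding forall_4 g_def by (simp, intro conjI smooth_basic smooth_H)
  then show ?thesis by (intro smooth_on_vecI[OF open_tube]) auto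
qed

lemma lorentzian_g: "lorentzian_metric_on {x. x $ 2 \<in> I} g"
  unfolding lorentzian_metric_on_def
proof (intro conjI ballI smooth_g)
  fix x :: "real^4" assume "x \<in> {x. x $ 2 \<in> I}"
  then have x: "x $ 2 \<in> I" by simp
  show "transpose (g x) = g x"
    by (simp add: transpose_def vec_eq_iff forall_4 g_def)
  define Z where "Z = q (x$2) * ((x$4)^2 + (S (x$2))^2)"
  define k where "k = 1 / sqrt Z"
  have "Z > 0" using q_pos[OF x] radius_pos[OF x] unfolding Z_def by (rule mult_pos_pos)
  then have "k * k * Z = 1" unfolding k_def using real_sqrt_mult_self[of Z] by (simp add: field_simps)
  then have k: "k * k * (q (x$2) * ((x$4)^2 + (S (x$2))^2)) = 1" unfolding Z_def .
  \<comment> \<open>The columns of \<open>B\<close> are orthonormal. The null vectors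
    \<open>\<partial>_rho\<close> and \<open>\<partial>_u - H \<partial>_rho\<close> have product
    \<open>1\<close>; adding half the former to the latter gives square \<open>1\<close>,
    subtracting it gives \<open>-1\<close>.\<close>
  define B :: "real^4^4" where "B = vector [vector [k, 0, 0, 0], vector [0, k, 0, 0],
    vector [k * f (x$2), 0, 1, 1], vector [- k * V (x$2) * q (x$2), 0, 1/2 - H x, - 1/2 - H x]]"
  have BgB: "transpose B ** g x ** B = minkowski"
    using k
    apply (simp add: vec_eq_iff forall_4 matrix_matrix_mult_def sum_4 B_def transpose_def g_def minkowski_def)
    apply (simp add: field_simps)
    apply algebra
    done
  \<comment> \<open>\<open>minkowski\<close> is its own inverse, which turns the congruence just
    proved into a left inverse of \<open>B\<close>.\<close>
  have "minkowski ** minkowski = mat 1"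
    by (simp add: vec_eq_iff forall_4 matrix_matrix_mult_def sum_4 minkowski_def mat_def)
  then have "(minkowski ** (transpose B ** g x)) ** B = mat 1"
    unfolding matrix_mul_assoc[symmetric] BgB[unfolded matrix_mul_assoc[symmetric]] .
  then have "invertible B" using invertible_left_inverse by blast
  then show "\<exists>B. invertible B \<and> transpose B ** g x ** B = minkowski" using BgB by blast
qed

lemma is_lift_g: "is_lift (tube_dom I) (tube_D F) (tube_J F) \<mu> lam P r Wl Hl g"
proof -
  have "P x \<noteq> 0" if "x $ 2 \<in> I" for x using P_squared(2)[OF that] by simp
  then show ?thesis unfolding is_lift_def total_space_tube_dom
    using adapted_coframe_lift smooth_P smooth_r smooth_Wl smooth_Hl lorentzian_g metric_eq by simp
qed

text \<open>The factor is \<open>(2 G)^2\<close> because \<sigma> is \<open>2 G\<close> times the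
  pulled back \<open>lam\<close>.\<close>

definition Phi where "Phi x = 4 * (G (x$2))^2 * null_term x"

lemma ricci_lift:
  assumes x: "x $ 2 \<in> I"
  shows "ricci g x = \<Lambda> *\<^sub>R g x + Phi x *\<^sub>R symprod (pullback lam x) (pullback lam x)"
  using G_nz[OF x] unfolding pullback_coframe[OF x]
  by (simp add: vec_eq_iff ricci_eq[OF x] symprod_def sig_def[symmetric] Phi_def field_simps power2_eq_square)

text \<open>\<open>Phi\<close> is defined through \<open>ricci\<close>; its smoothness is read off
  from the table, a polynomial in smooth functions that agrees with \<open>ricci\<close> over the
  open tube.\<close>

lemma smooth_Phi: "smooth_on {x::real^4. x $ 2 \<in> I} Phi"
proof -
  have "smooth_on {x::real^4. x $ 2 \<in> I} (\<lambda>x. ricci_table x $ 3 $ 3)"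
    unfolding ricci_table_eq vector_4 divide_inverse by (intro smooth_basic smooth_H smooth_Hsy smooth_T)
  then have "smooth_on {x::real^4. x $ 2 \<in> I} (\<lambda>x. 4 * (G (x$2))^2 * (ricci_table x $ 3 $ 3 - 2 * \<Lambda> * H x))"
    by (intro smooth_basic smooth_H)
  then show ?thesis
    by (rule smooth_on_cong[OF open_tube]) (simp add: Phi_def null_term_def ricci_g)
qed

section \<open>The Weyl tensor and the Petrov type\<close>

lemma g_4: "g x $ 4 $ j = sig x $ j" "g x $ j $ 4 = sig x $ j"
  using exhaust_4[of j] by (auto simp: g_def sig_def)

lemma sig_4: "sig x $ 4 = 0" "sig x $ 3 = 1"
  by (simp_all add: sig_def)

text \<open>The form \<sigma> is null, so the \<sigma>^2 term of the Ricci tensor is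
  trace-free.\<close>

lemma scalar_curvature_eq:
  assumes x: "x $ 2 \<in> I"
  shows "scalar_curvature g x = 4 * \<Lambda>"
  using w_mult_radius[OF x] q_pos[OF x]
  unfolding scalar_curvature_def ricci_eq[OF x] ginv[OF x] sum_4
  unfolding g_def ginv_def vector_4
  by (simp add: field_simps, algebra)

text \<open>Lowering the index of \<open>\<partial>_rho\<close> gives \<sigma>, and every term
  becomes a multiple of the tensor square of \<sigma>. As \<sigma> annihilates \<open>e_1\<close>
  and \<open>e_2\<close>, this is what makes two of the Weyl components vanish.\<close>

lemma weyl_44:
  assumes x: "x $ 2 \<in> I"
  shows "weyl g x 4 k 4 j = (\<Lambda> / 3 - Hrr x) * sig x $ k * sig x $ j"
  unfolding weyl_def riemann_44[OF x] scalar_curvature_eq[OF x] ricci_eq[OF x] g_4 sig_def[symmetric] sig_4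
  by (simp add: field_simps)

lemma weyl_43:
  assumes x: "x $ 2 \<in> I"
  shows "weyl g x 4 k 3 j = riemann_43_table x $ k $ j - \<Lambda> / 3 * (g x $ k $ j - sig x $ j * g x $ k $ 3)
     - null_term x / 2 * (sig x $ k * sig x $ j - sig x $ j * sig x $ k)"
  unfolding weyl_def riemann_43[OF x] scalar_curvature_eq[OF x] ricci_eq[OF x] g_4 sig_def[symmetric] sig_4
  by (simp add: field_simps)

text \<open>The columns are the dual frame scaled by \<open>P\<close>, which keeps the square root
  out of the entries.\<close>

definition frame :: "real^4 \<Rightarrow> complex^4^4" where
  "frame x = vector [
     vector [1, 1, 0, 0],
     vector [- \<i>, \<i>, 0, 0],
     vector [of_real (f (x$2)), of_real (f (x$2)), of_real (2 * G (x$2)), 0],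
     vector [- of_real (q (x$2) * V (x$2)), - of_real (q (x$2) * V (x$2)), - of_real (2 * G (x$2) * H x), of_real (1 / (2 * S (x$2) * w x))]]"

lemma frame_dual:
  assumes x: "x $ 2 \<in> I"
  shows "dual_frame (lift_coframe \<mu> lam P r Wl Hl x) b $ i = frame x $ i $ b / complex_of_real (P x)"
proof -
  have nz: "G (x$2) \<noteq> 0" "q (x$2) \<noteq> 0" "S (x$2) \<noteq> 0" "w x \<noteq> 0" "P x \<noteq> 0"
    using G_nz[OF x] q_pos[OF x] S_nz[OF x] w_pos[OF x] P_squared(2)[OF x] by auto
  have 1: "(vector [pullback \<mu> x, conj_vec (pullback \<mu> x), cvec (pullback lam x), lift_form \<mu> lam r Wl Hl x] :: complex^4^4) ** frame x = mat 1"
    unfolding lift_form_eq[OF x] pullback_coframe[OF x] using nz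
    by (simp add: vec_eq_iff forall_4 matrix_matrix_mult_def sum_4 frame_def mat_def conj_vec_def cvec_def sig_def th_def complex_eq_iff field_simps)
  have "lift_coframe \<mu> lam P r Wl Hl x ** (inverse (P x) *\<^sub>R frame x) = mat 1"
    unfolding lift_coframe_def using 1 nz(5)
    by (simp add: vec_eq_iff matrix_matrix_mult_def)
  then have "matrix_inv (lift_coframe \<mu> lam P r Wl Hl x) = inverse (P x) *\<^sub>R frame x" by (rule matrix_inv_eqI)
  then show ?thesis using nz(5) by (simp add: dual_frame_def column_def scaleR_conv_of_real[where 'a = complex] divide_inverse mult.commute)
qed

lemma weyl_frame_4:
  assumes x: "x $ 2 \<in> I"
  shows "weyl_frame g x (dual_frame (lift_coframe \<mu> lam P r Wl Hl x)) 4 b c d =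
    of_real (1 / (2 * S (x$2) * w x)) / complex_of_real (P x) ^ 4 *
    (\<Sum>j\<in>UNIV. \<Sum>k\<in>UNIV. \<Sum>l\<in>UNIV. complex_of_real (weyl g x 4 j k l) * frame x $ j $ b * frame x $ k $ c * frame x $ l $ d)"
proof -
  have f4: "frame x $ 1 $ 4 = 0" "frame x $ 2 $ 4 = 0" "frame x $ 3 $ 4 = 0" "frame x $ 4 $ 4 = of_real (1 / (2 * S (x$2) * w x))"
    by (simp_all add: frame_def)
  have "weyl_frame g x (dual_frame (lift_coframe \<mu> lam P r Wl Hl x)) 4 b c d =
    (\<Sum>j\<in>UNIV. \<Sum>k\<in>UNIV. \<Sum>l\<in>UNIV. complex_of_real (weyl g x 4 j k l) * (frame x $ 4 $ 4 / complex_of_real (P x)) *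
      (frame x $ j $ b / complex_of_real (P x)) * (frame x $ k $ c / complex_of_real (P x)) * (frame x $ l $ d / complex_of_real (P x)))"
    unfolding weyl_frame_def frame_dual[OF x] by (subst sum_4) (simp add: f4(1-3))
  also have "\<dots> = (\<Sum>j\<in>UNIV. \<Sum>k\<in>UNIV. \<Sum>l\<in>UNIV. frame x $ 4 $ 4 / complex_of_real (P x) ^ 4 *
      (complex_of_real (weyl g x 4 j k l) * frame x $ j $ b * frame x $ k $ c * frame x $ l $ d))"
    by (simp add: eval_nat_numeral mult_ac)
  finally show ?thesis unfolding f4(4) sum_distrib_left .
qed

lemma sig_frame: "(\<Sum>j\<in>UNIV. complex_of_real (sig x $ j) * frame x $ j $ 1) = 0" "(\<Sum>j\<in>UNIV. complex_of_real (sig x $ j) * frame x $ j $ 2) = 0"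
  by (simp_all add: sum_4 sig_def frame_def)

lemma weyl_4c4:
  assumes x: "x $ 2 \<in> I"
  shows "(\<Sum>j\<in>UNIV. \<Sum>l\<in>UNIV. complex_of_real (weyl g x 4 j 4 l) * frame x $ j $ b * frame x $ l $ d) =
    of_real (\<Lambda> / 3 - Hrr x) * (\<Sum>j\<in>UNIV. complex_of_real (sig x $ j) * frame x $ j $ b) * (\<Sum>j\<in>UNIV. complex_of_real (sig x $ j) * frame x $ j $ d)"
  unfolding weyl_44[OF x] sum_4 by (simp add: algebra_simps)

lemma weyl_4b4d:
  assumes x: "x $ 2 \<in> I" and d: "d = 1 \<or> d = 2"
  shows "weyl_frame g x (dual_frame (lift_coframe \<mu> lam P r Wl Hl x)) 4 b 4 d = 0"
proof -
  have f4: "frame x $ 1 $ 4 = 0" "frame x $ 2 $ 4 = 0" "frame x $ 3 $ 4 = 0" by (simp_all add: frame_def)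
  have "(\<Sum>j\<in>UNIV. \<Sum>k\<in>UNIV. \<Sum>l\<in>UNIV. complex_of_real (weyl g x 4 j k l) * frame x $ j $ b * frame x $ k $ 4 * frame x $ l $ d)
     = frame x $ 4 $ 4 * (\<Sum>j\<in>UNIV. \<Sum>l\<in>UNIV. complex_of_real (weyl g x 4 j 4 l) * frame x $ j $ b * frame x $ l $ d)"
    unfolding sum_distrib_left by (rule sum.cong[OF refl], subst sum_4) (simp add: f4 mult_ac)
  also have "\<dots> = 0" unfolding weyl_4c4[OF x] using d sig_frame[of x] by auto
  finally show ?thesis unfolding weyl_frame_4[OF x] by simp
qed

text \<open>The complex factor on the right is \<open>i (rho - i S)^3\<close> in real and imaginary
  parts. The contributions of \<open>\<Lambda>\<close> cancel between curvature and metric, and only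
  \<open>M\<close> remains.\<close>

lemma weyl_4132_sum:
  assumes x: "x $ 2 \<in> I"
  shows "(\<Sum>j\<in>UNIV. \<Sum>k\<in>UNIV. \<Sum>l\<in>UNIV. complex_of_real (weyl g x 4 j k l) * frame x $ j $ 1 * frame x $ k $ 3 * frame x $ l $ 2)
    = of_real (- 4 * G (x$2) * q (x$2) * M * (w x)^2) * Complex (S (x$2) * (3 * (x$4)^2 - (S (x$2))^2)) ((x$4) * ((x$4)^2 - 3 * (S (x$2))^2))"
proof -
  have f3: "frame x $ 1 $ 3 = 0" "frame x $ 2 $ 3 = 0" "frame x $ 3 $ 3 = of_real (2 * G (x$2))" by (simp_all add: frame_def)
  have "(\<Sum>j\<in>UNIV. \<Sum>k\<in>UNIV. \<Sum>l\<in>UNIV. complex_of_real (weyl g x 4 j k l) * frame x $ j $ 1 * frame x $ k $ 3 * frame x $ l $ 2)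
    = of_real (2 * G (x$2)) * (\<Sum>j\<in>UNIV. \<Sum>l\<in>UNIV. complex_of_real (weyl g x 4 j 3 l) * frame x $ j $ 1 * frame x $ l $ 2)
      + frame x $ 4 $ 3 * (\<Sum>j\<in>UNIV. \<Sum>l\<in>UNIV. complex_of_real (weyl g x 4 j 4 l) * frame x $ j $ 1 * frame x $ l $ 2)"
    unfolding sum_distrib_left sum.distrib[symmetric] by (rule sum.cong[OF refl], subst sum_4) (simp add: f3 sum.distrib sum_distrib_left mult_ac)
  \<comment> \<open>The \<open>rho\<close> component of \<open>e_3\<close> contributes nothing: the
    sum with two indices \<open>4\<close> is a multiple of
    \<open>\<sigma>(e_1) \<sigma>(e_2)\<close>.\<close>
  also have "\<dots> = of_real (2 * G (x$2)) * (\<Sum>j\<in>UNIV. \<Sum>l\<in>UNIV. complex_of_real (weyl g x 4 j 3 l) * frame x $ j $ 1 * frame x $ l $ 2)"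
    unfolding weyl_4c4[OF x] sig_frame by simp
  also have "(\<Sum>j\<in>UNIV. \<Sum>l\<in>UNIV. complex_of_real (weyl g x 4 j 3 l) * frame x $ j $ 1 * frame x $ l $ 2)
     = of_real (- 2 * q (x$2) * M * (w x)^2) * Complex (S (x$2) * (3 * (x$4)^2 - (S (x$2))^2)) ((x$4) * ((x$4)^2 - 3 * (S (x$2))^2))"
  proof -
    have "(\<Sum>j\<in>UNIV. \<Sum>l\<in>UNIV. complex_of_real (weyl g x 4 j 3 l) * frame x $ j $ 1 * frame x $ l $ 2)
      = (\<Sum>j\<in>UNIV. \<Sum>l\<in>UNIV. complex_of_real (riemann_43_table x $ j $ l) * frame x $ j $ 1 * frame x $ l $ 2)
        - of_real (\<Lambda> / 3) * (\<Sum>j\<in>UNIV. \<Sum>l\<in>UNIV. complex_of_real (g x $ j $ l) * frame x $ j $ 1 * frame x $ l $ 2)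
        + of_real (\<Lambda> / 3) * (\<Sum>j\<in>UNIV. complex_of_real (g x $ j $ 3) * frame x $ j $ 1) * (\<Sum>j\<in>UNIV. complex_of_real (sig x $ j) * frame x $ j $ 2)"
      unfolding weyl_43[OF x] sum_4 by (simp add: algebra_simps)
    also have "\<dots> = (\<Sum>j\<in>UNIV. \<Sum>l\<in>UNIV. complex_of_real (riemann_43_table x $ j $ l) * frame x $ j $ 1 * frame x $ l $ 2)
        - of_real (\<Lambda> / 3) * (\<Sum>j\<in>UNIV. \<Sum>l\<in>UNIV. complex_of_real (g x $ j $ l) * frame x $ j $ 1 * frame x $ l $ 2)"
      unfolding sig_frame by simp
    also have "(\<Sum>j\<in>UNIV. \<Sum>l\<in>UNIV. complex_of_real (g x $ j $ l) * frame x $ j $ 1 * frame x $ l $ 2) = of_real (2 * q (x$2) * ((x$4)^2 + (S (x$2))^2))"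
      by (simp add: sum_4 g_def frame_def complex_eq_iff algebra_simps power2_eq_square)
    also have "(\<Sum>j\<in>UNIV. \<Sum>l\<in>UNIV. complex_of_real (riemann_43_table x $ j $ l) * frame x $ j $ 1 * frame x $ l $ 2) =
       of_real (q (x$2)) * Complex (4 * H x * (S (x$2))^2 * w x + 2 * Hr x * (x$4) - S (x$2) * T (x$2) * w x)
         (4 * H x * S (x$2) * (x$4) * w x - 2 * Hr x * S (x$2) - T (x$2) * (x$4) * w x)"
      by (simp add: sum_4 riemann_43_table_eq frame_def complex_eq_iff algebra_simps power2_eq_square)
    finally have eq: "(\<Sum>j\<in>UNIV. \<Sum>l\<in>UNIV. complex_of_real (weyl g x 4 j 3 l) * frame x $ j $ 1 * frame x $ l $ 2) =
      of_real (q (x$2)) * Complex (4 * H x * (S (x$2))^2 * w x + 2 * Hr x * (x$4) - S (x$2) * T (x$2) * w x)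
         (4 * H x * S (x$2) * (x$4) * w x - 2 * Hr x * S (x$2) - T (x$2) * (x$4) * w x)
       - of_real (\<Lambda> / 3) * of_real (2 * q (x$2) * ((x$4)^2 + (S (x$2))^2))" .
    have 1: "4 * H x * (S (x$2))^2 * w x + 2 * Hr x * (x$4) - S (x$2) * T (x$2) * w x - 2 * \<Lambda> / 3 * ((x$4)^2 + (S (x$2))^2)
      = - 2 * M * (w x)^2 * (S (x$2) * (3 * (x$4)^2 - (S (x$2))^2))"
      using w_mult_radius[OF x] by (simp add: H_def Hr_def T_def field_simps, algebra)
    have 2: "4 * H x * S (x$2) * (x$4) * w x - 2 * Hr x * S (x$2) - T (x$2) * (x$4) * w x
      = - 2 * M * (w x)^2 * ((x$4) * ((x$4)^2 - 3 * (S (x$2))^2))"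
      using w_mult_radius[OF x] by (simp add: H_def Hr_def T_def field_simps, algebra)
    have "Complex (4 * H x * (S (x$2))^2 * w x + 2 * Hr x * (x$4) - S (x$2) * T (x$2) * w x)
         (4 * H x * S (x$2) * (x$4) * w x - 2 * Hr x * S (x$2) - T (x$2) * (x$4) * w x)
      = of_real (- 2 * M * (w x)^2) * Complex (S (x$2) * (3 * (x$4)^2 - (S (x$2))^2)) ((x$4) * ((x$4)^2 - 3 * (S (x$2))^2))
        + of_real (2 * \<Lambda> / 3 * ((x$4)^2 + (S (x$2))^2))"
      unfolding complex_eq_iff using 1 2 by (simp add: algebra_simps)
    from eq[unfolded this] show ?thesis by (simp add: algebra_simps)
  qed
  finally show ?thesis by (simp add: mult_ac)
qed

lemma weyl_4132_nz:
  assumes x: "x $ 2 \<in> I"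
  shows "weyl_frame g x (dual_frame (lift_coframe \<mu> lam P r Wl Hl x)) 4 1 3 2 \<noteq> 0"
proof -
  have nz: "G (x$2) \<noteq> 0" "q (x$2) \<noteq> 0" "S (x$2) \<noteq> 0" "w x \<noteq> 0" "P x \<noteq> 0"
    using G_nz[OF x] q_pos[OF x] S_nz[OF x] w_pos[OF x] P_squared(2)[OF x] by auto
  have "Complex (S (x$2) * (3 * (x$4)^2 - (S (x$2))^2)) ((x$4) * ((x$4)^2 - 3 * (S (x$2))^2)) \<noteq> 0"
  proof
    assume "Complex (S (x$2) * (3 * (x$4)^2 - (S (x$2))^2)) ((x$4) * ((x$4)^2 - 3 * (S (x$2))^2)) = 0"
    then have e: "3 * (x$4)^2 = (S (x$2))^2" "x$4 = 0 \<or> (x$4)^2 = 3 * (S (x$2))^2" using nz(3) by (auto simp: complex_eq_iff)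
    have "(S (x$2))^2 > 0" using nz(3) by simp
    then show False using e by auto
  qed
  then show ?thesis unfolding weyl_frame_4[OF x] weyl_4132_sum[OF x] using nz M_nz by simp
qed

lemma petrov_g: "petrov_II_or_D (total_space (tube_dom I)) g (lift_coframe \<mu> lam P r Wl Hl)"
  unfolding petrov_II_or_D_def total_space_tube_dom using weyl_4b4d weyl_4132_nz by simp

end

section \<open>Positive solutions of the ordinary differential equation\<close>

lemma antiderivative_UNIV:
  fixes F :: "real \<Rightarrow> 'a::banach"
  assumes "continuous_on UNIV F"
  shows "\<exists>G. G 0 = 0 \<and> (\<forall>t. (G has_vector_derivative F t) (at t))"
\<comment> \<open>For either sign of \<open>t\<close> one of the two integrals is over an interval
  with at most one point and vanishes; the difference is the oriented integral.\<close>
proof (intro exI[of _ "\<lambda>t. integral {0..t} F - integral {t..0} F"] conjI allI)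
  fix t :: real
  define n where "n = \<bar>t\<bar> + 1"
  have int: "F integrable_on {a..b}" for a b
    by (rule integrable_continuous_real[OF continuous_on_subset[OF assms]]) auto
  have eq: "integral {-n..u} F - integral {-n..0} F = integral {0..u} F - integral {u..0} F"
    if "u \<in> {-n<..<n}" for u
  proof (cases "u \<ge> 0")
    case True
    have "integral {-n..0} F + integral {0..u} F = integral {-n..u} F"
      by (rule Henstock_Kurzweil_Integration.integral_combine[OF _ _ int]) (use True that n_def in auto)
    moreover have "integral {u..0} F = 0" using True by (cases "u = 0") auto
    ultimately show ?thesis by (simp add: algebra_simps)
  next
    case False
    have "integral {-n..u} F + integral {u..0} F = integral {-n..0} F"
      by (rule Henstock_Kurzweil_Integration.integral_combine[OF _ _ int]) (use False that in auto)
    then show ?thesis using False by (simp add: algebra_simps)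
  qed
  have t: "t \<in> {-n<..<n}" by (auto simp: n_def)
  have "((\<lambda>u. integral {-n..u} F) has_vector_derivative F t) (at t within {-n..n})"
    by (rule integral_has_vector_derivative[OF continuous_on_subset[OF assms]]) (use t in auto)
  then have "((\<lambda>u. integral {-n..u} F) has_vector_derivative F t) (at t)"
    using t at_within_Icc_at[of "-n" t n] by simp
  then have "((\<lambda>u. integral {-n..u} F - integral {-n..0} F) has_vector_derivative F t - 0) (at t)"
    by (intro derivative_intros)
  from has_vector_derivative_transform_within_open[OF this open_greaterThanLessThan t eq]
  show "((\<lambda>t. integral {0..t} F - integral {t..0} F) has_vector_derivative F t) (at t)" by simp
qed simp

lemma exp_weighted_bound_right:
  fixes G :: "real \<Rightarrow> 'a::real_normed_vector"
  assumes "\<And>s. (G has_vector_derivative F s) (at s)" "\<And>s. norm (F s) \<le> C * exp (k * \<bar>s\<bar>)"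
    and "G 0 = 0" "k > 0" "t \<ge> 0"
  shows "norm (G t) \<le> C / k * exp (k * \<bar>t\<bar>)"
proof -
  have C: "C \<ge> 0" using order_trans[OF norm_ge_zero assms(2)[of 0]] by simp
  have "norm (G t - G 0) \<le> C / k * exp (k * t) - C / k * exp (k * 0)"
  proof (cases "t = 0")
    case False
    then have "0 < t" using assms by simp
    show ?thesis
    proof (rule differentiable_bound_general[OF \<open>0 < t\<close>, where f' = F and \<phi>' = "\<lambda>s. C * exp (k * s)"])
      show "continuous_on {0..t} G"
        by (meson assms(1) continuous_at_imp_continuous_on has_vector_derivative_continuous)
      show "continuous_on {0..t} (\<lambda>t. C / k * exp (k * t))" by (intro continuous_intros)
      show "norm (F s) \<le> C * exp (k * s)" if "0 < s" for s using assms(2)[of s] that by simp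
      show "((\<lambda>t. C / k * exp (k * t)) has_vector_derivative C * exp (k * s)) (at s)" for s
        unfolding has_real_derivative_iff_has_vector_derivative[symmetric]
        using \<open>k > 0\<close> by (auto intro!: derivative_eq_intros)
    qed (use assms in auto)
  qed simp
  also have "\<dots> \<le> C / k * exp (k * t)" using C \<open>k > 0\<close> by simp
  finally show ?thesis using assms by simp
qed

text \<open>In the norm weighted by \<open>exp (k |t|)\<close>, integration from \<open>0\<close>
  gains a factor \<open>1/k\<close>; a large \<open>k\<close> thus makes the Picard operator a
  contraction on the whole line at once.\<close>

lemma exp_weighted_bound:
  fixes G :: "real \<Rightarrow> 'a::real_normed_vector"
  assumes "\<And>s. (G has_vector_derivative F s) (at s)" "\<And>s. norm (F s) \<le> C * exp (k * \<bar>s\<bar>)"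
    and "G 0 = 0" "k > 0"
  shows "norm (G t) \<le> C / k * exp (k * \<bar>t\<bar>)"
proof (cases "t \<ge> 0")
  case True
  then show ?thesis using exp_weighted_bound_right[OF assms] by blast
next
  case False
  have "((\<lambda>s. G (- s)) has_vector_derivative - F (- s)) (at s)" for s
  proof -
    have "((\<lambda>s. - s) has_vector_derivative - 1) (at s)" by (auto intro!: derivative_eq_intros)
    from vector_diff_chain_at[OF this assms(1)] show ?thesis by (simp add: o_def)
  qed
  moreover have "norm (- F (- s)) \<le> C * exp (k * \<bar>s\<bar>)" for s
    using assms(2)[of "- s"] by simp
  ultimately show ?thesis
    using exp_weighted_bound_right[of "\<lambda>s. G (- s)" "\<lambda>s. - F (- s)" C k "- t"] assms False by simp
qed

text \<open>Banach's fixed point theorem in an exponentially weighted supremum norm (Bielecki's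
  device). The elements \<open>w\<close> of \<open>bcontfun\<close> stand for the quotients
  \<open>z/E\<close>, which stay bounded even if \<open>z\<close> grows exponentially.\<close>

lemma picard_global:
  fixes f :: "real \<Rightarrow> 'a::banach \<Rightarrow> 'a"
  assumes cont: "continuous_on UNIV (\<lambda>(t, z). f t z)"
    and lip: "\<And>t u v. norm (f t u - f t v) \<le> L * norm (u - v)"
    and bnd: "\<And>t. norm (f t 0) \<le> B"
    and L: "L \<ge> 0"
  shows "\<exists>z. z 0 = z0 \<and> (\<forall>t. (z has_vector_derivative f t (z t)) (at t))"
proof -
  have B: "B \<ge> 0" using bnd[of 0] norm_ge_zero order_trans by blast
  \<comment> \<open>With this weight \<open>L/k\<close> is at most \<open>1/2\<close>, the
    contraction constant.\<close>
  define k where "k = 2 * L + 1"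
  have k: "k > 0" "L / k \<le> 1/2" "k \<ge> 1" using L by (auto simp: k_def field_simps)
  define E where "E t = exp (k * \<bar>t\<bar>)" for t :: real
  have E: "E t > 0" "E t \<ge> 1" for t using k by (auto simp: E_def)
  have contE: "continuous_on UNIV E" unfolding E_def by (intro continuous_intros)
  define F where "F w s = f s (E s *\<^sub>R apply_bcontfun w s)" for w s
  have contF: "continuous_on UNIV (F w)" for w
  proof -
    have "continuous_on UNIV (\<lambda>s. (\<lambda>(t, z). f t z) (s, E s *\<^sub>R apply_bcontfun w s))"
      by (intro continuous_on_compose2[OF cont] continuous_intros contE) auto
    then show ?thesis by (simp add: F_def[abs_def])
  qed
  define P where "P w = (SOME G. G 0 = 0 \<and> (\<forall>t. (G has_vector_derivative F w t) (at t)))" for w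
  have P: "P w 0 = 0" "(P w has_vector_derivative F w t) (at t)" for w t
    using someI_ex[OF antiderivative_UNIV[OF contF[of w]]] unfolding P_def by auto
  have Fb: "norm (F w s) \<le> (B + L * norm w) * exp (k * \<bar>s\<bar>)" for w s
  proof -
    have "norm (F w s) \<le> norm (f s 0) + norm (F w s - f s 0)" by norm
    also have "\<dots> \<le> B + L * norm (E s *\<^sub>R apply_bcontfun w s)"
      unfolding F_def using bnd lip[of s "E s *\<^sub>R apply_bcontfun w s" 0] by (intro add_mono) auto
    also have "\<dots> \<le> B * E s + L * (E s * norm w)"
      using E[of s] L B norm_bounded[of w s] by (intro add_mono mult_left_mono) (auto simp: mult_le_cancel_left1)
    finally show ?thesis by (simp add: E_def algebra_simps)
  qed
  have Fd: "norm (F w s - F v s) \<le> (L * dist w v) * exp (k * \<bar>s\<bar>)" for w v s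
  proof -
    have "norm (F w s - F v s) \<le> L * norm (E s *\<^sub>R apply_bcontfun w s - E s *\<^sub>R apply_bcontfun v s)"
      unfolding F_def by (rule lip)
    also have "\<dots> = L * (E s * dist (apply_bcontfun w s) (apply_bcontfun v s))"
      using E[of s] by (simp add: dist_norm scaleR_right_diff_distrib[symmetric])
    also have "\<dots> \<le> L * (E s * dist w v)"
      using E[of s] L dist_bounded[of w s v] by (intro mult_left_mono) auto
    finally show ?thesis by (simp add: E_def algebra_simps)
  qed
  define T where "T w = Bcontfun (\<lambda>t. inverse (E t) *\<^sub>R (z0 + P w t))" for w
  have contP: "continuous_on UNIV (P w)" for w
    by (meson P(2) continuous_at_imp_continuous_on has_vector_derivative_continuous)
  have T: "apply_bcontfun (T w) t = inverse (E t) *\<^sub>R (z0 + P w t)" for w t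
  proof -
    have "(\<lambda>t. inverse (E t) *\<^sub>R (z0 + P w t)) \<in> bcontfun"
    proof (rule bcontfun_normI)
      show "continuous_on UNIV (\<lambda>t. inverse (E t) *\<^sub>R (z0 + P w t))"
        using E by (intro continuous_intros contE contP) (metis less_irrefl)
      fix t
      have "norm (P w t) \<le> (B + L * norm w) / k * E t"
        unfolding E_def by (rule exp_weighted_bound[OF P(2) Fb P(1) k(1)])
      then have "norm (z0 + P w t) \<le> norm z0 * E t + (B + L * norm w) / k * E t"
        using E[of t] by (intro norm_triangle_le add_mono) (auto simp: mult_le_cancel_left1)
      then have "inverse (E t) * norm (z0 + P w t) \<le> norm z0 + (B + L * norm w) / k"
        using E[of t] by (simp add: field_simps)
      then show "norm (inverse (E t) *\<^sub>R (z0 + P w t)) \<le> norm z0 + (B + L * norm w) / k"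
        using E[of t] by simp
    qed
    then show ?thesis by (simp add: T_def Bcontfun_inverse)
  qed
  have "dist (T w) (T v) \<le> 1/2 * dist w v" for w v
  proof (rule dist_bound)
    fix t
    have "norm (P w t - P v t) \<le> (L * dist w v) / k * exp (k * \<bar>t\<bar>)"
      by (rule exp_weighted_bound[where F = "\<lambda>t. F w t - F v t"])
         (auto intro!: derivative_intros P Fd k simp: P(1))
    then have "norm (P w t - P v t) \<le> (L / k * dist w v) * E t" by (simp add: E_def)
    also have "\<dots> \<le> (1/2 * dist w v) * E t"
      using k E[of t] by (intro mult_right_mono) auto
    finally have "norm (P w t - P v t) \<le> (1/2 * dist w v) * E t" .
    moreover have "dist (T w t) (T v t) = inverse (E t) * norm (P w t - P v t)"
      unfolding T dist_norm using E[of t] by (simp add: scaleR_right_diff_distrib[symmetric])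
    moreover have "inverse (E t) * ((1/2 * dist w v) * E t) = 1/2 * dist w v"
      using E(1)[of t] by simp
    ultimately show "dist (T w t) (T v t) \<le> 1/2 * dist w v"
      using E(1)[of t] by (metis inverse_nonnegative_iff_nonnegative less_imp_le mult_left_mono)
  qed
  then obtain w where w: "T w = w"
    using banach_fix_type[of "1/2" T] by auto
  define z where "z t = z0 + P w t" for t
  have "E t *\<^sub>R apply_bcontfun w t = z t" for t
    using T[of w t] E[of t] unfolding w z_def by simp
  then have "F w t = f t (z t)" for t by (simp add: F_def)
  then have "(z has_vector_derivative f t (z t)) (at t)" for t
    using P(2)[of w t] unfolding z_def by (auto intro!: derivative_eq_intros)
  moreover have "z 0 = z0" by (simp add: z_def P)
  ultimately show ?thesis by blast
qed

text \<open>A first-order system for \<open>u\<close> and \<open>u' = v\<close>. End points carry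
  continuity only, so that one-sided derivatives never occur and restriction to subintervals is
  immediate.\<close>

definition solves2 :: "(real \<Rightarrow> real \<Rightarrow> real) \<Rightarrow> real \<Rightarrow> real \<Rightarrow> (real \<Rightarrow> real) \<Rightarrow> (real \<Rightarrow> real) \<Rightarrow> bool" where
  "solves2 h c d u v \<longleftrightarrow> continuous_on {c..d} u \<and> continuous_on {c..d} v \<and>
     (\<forall>t\<in>{c<..<d}. (u has_real_derivative v t) (at t) \<and> (v has_real_derivative h t (u t)) (at t))"

lemma solves2_subset: "solves2 h c d u v \<Longrightarrow> c \<le> c' \<Longrightarrow> d' \<le> d \<Longrightarrow> solves2 h c' d' u v"
  unfolding solves2_def by (auto elim: continuous_on_subset)

lemma solves2_exists:
  fixes h :: "real \<Rightarrow> real \<Rightarrow> real"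
  assumes cd: "c \<le> d" and cont: "continuous_on ({c..d} \<times> UNIV) (\<lambda>(t, u). h t u)"
    and lip: "\<And>t u v. t \<in> {c..d} \<Longrightarrow> \<bar>h t u - h t v\<bar> \<le> L * \<bar>u - v\<bar>" and L: "L \<ge> 0"
  shows "\<exists>u v. solves2 h c d u v \<and> u t0 = u0 \<and> v t0 = v0"
proof -
  \<comment> \<open>Freezing time outside \<open>{c..d}\<close> extends the field to all times, as
    the existence result on the whole line requires; \<open>f\<close> below also shifts the initial
    time to \<open>0\<close>.\<close>
  define cl where "cl t = max c (min d t)" for t
  have cl: "cl t \<in> {c..d}" "t \<in> {c..d} \<Longrightarrow> cl t = t" for t using cd by (auto simp: cl_def)
  then have cl': "c \<le> cl t" "cl t \<le> d" for t by (auto simp only: atLeastAtMost_iff)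
  have contcl: "continuous_on A cl" for A unfolding cl_def by (intro continuous_intros)
  have conth0: "continuous_on UNIV (\<lambda>t. h (cl t) 0)"
  proof -
    have "continuous_on UNIV (\<lambda>t. (\<lambda>(t, u). h t u) (cl t, 0))"
      by (rule continuous_on_compose2[OF cont]) (auto intro!: continuous_intros contcl simp: cl')
    then show ?thesis by simp
  qed
  have "compact ((\<lambda>t. h t 0) ` {c..d})"
  proof (rule compact_continuous_image)
    have "continuous_on {c..d} (\<lambda>t. (\<lambda>(t, u). h t u) (t, 0))"
      by (rule continuous_on_compose2[OF cont]) (auto intro!: continuous_intros)
    then show "continuous_on {c..d} (\<lambda>t. h t 0)" by simp
  qed simp
  then obtain B where B: "\<And>t. t \<in> {c..d} \<Longrightarrow> \<bar>h t 0\<bar> \<le> B"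
    by (metis compact_imp_bounded bounded_iff image_eqI real_norm_def)
  define f :: "real \<Rightarrow> real \<times> real \<Rightarrow> real \<times> real" where "f t z = (snd z, h (cl (t + t0)) (fst z))" for t z
  have "\<exists>z. z 0 = (u0, v0) \<and> (\<forall>t. (z has_vector_derivative f t (z t)) (at t))"
  proof (rule picard_global)
    have "continuous_on UNIV (\<lambda>p::real \<times> real \<times> real. (\<lambda>(t, u). h t u) (cl (fst p + t0), fst (snd p)))"
      by (rule continuous_on_compose2[OF cont])
         (auto intro!: continuous_intros continuous_on_compose2[OF contcl[of UNIV]] simp: cl')
    then show "continuous_on UNIV (\<lambda>(t, z). f t z)"
      unfolding f_def case_prod_unfold by (intro continuous_intros) simp_all
    show "norm (f t p - f t r) \<le> (1 + L) * norm (p - r)" for t p r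
    proof -
      have "norm (f t p - f t r) \<le> \<bar>snd p - snd r\<bar> + \<bar>h (cl (t + t0)) (fst p) - h (cl (t + t0)) (fst r)\<bar>"
        unfolding f_def norm_prod_def by (simp add: sqrt_sum_squares_le_sum_abs)
      also have "\<dots> \<le> norm (p - r) + L * norm (p - r)"
        using norm_snd_le[of "snd p - snd r" "fst p - fst r"] norm_fst_le[of "fst p - fst r" "snd p - snd r"] minus_prod_def[of p r] L
        by (intro add_mono order_trans[OF lip[OF cl(1)]] mult_left_mono) auto
      finally show ?thesis by (simp add: algebra_simps)
    qed
    show "norm (f t 0) \<le> B" for t
      using B[OF cl(1)] by (simp add: f_def norm_prod_def)
    show "0 \<le> 1 + L" using L by simp
  qed
  then obtain z where z: "z 0 = (u0, v0)" "\<And>t. (z has_vector_derivative f t (z t)) (at t)" by blast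
  define u where "u t = fst (z (t - t0))" for t
  define v where "v t = snd (z (t - t0))" for t
  have zd: "((\<lambda>t. z (t - t0)) has_vector_derivative f (t - t0) (z (t - t0))) (at t)" for t
  proof -
    have "((\<lambda>t. t - t0) has_vector_derivative 1) (at t)" by (auto intro!: derivative_eq_intros)
    from vector_diff_chain_at[OF this z(2)] show ?thesis by (simp add: o_def)
  qed
  have u: "(u has_real_derivative v t) (at t)" for t
    using bounded_linear.has_vector_derivative[OF bounded_linear_fst zd[of t]]
    by (simp add: has_real_derivative_iff_has_vector_derivative u_def[abs_def] v_def f_def)
  have v: "(v has_real_derivative h (cl t) (u t)) (at t)" for t
    using bounded_linear.has_vector_derivative[OF bounded_linear_snd zd[of t]]
    by (simp add: has_real_derivative_iff_has_vector_derivative u_def v_def[abs_def] f_def)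
  have "solves2 h c d u v"
    unfolding solves2_def
  proof (intro conjI ballI)
    show "continuous_on {c..d} u" "continuous_on {c..d} v"
      by (meson u v DERIV_isCont continuous_at_imp_continuous_on)+
    fix t assume "t \<in> {c<..<d}"
    then show "(u has_real_derivative v t) (at t)" "(v has_real_derivative h t (u t)) (at t)"
      using u[of t] v[of t] cl(2)[of t] by auto
  qed
  moreover have "u t0 = u0" "v t0 = v0" by (simp_all add: u_def v_def z)
  ultimately show ?thesis by blast
qed

section \<open>Gronwall estimates and the maximum principle\<close>

lemma exp_bound_of_deriv_bound:
  fixes E E' :: "real \<Rightarrow> real"
  assumes cont: "continuous_on {c..d} E"
    and der: "\<And>t. t \<in> {c<..<d} \<Longrightarrow> (E has_real_derivative E' t) (at t)"
    and bnd: "\<And>t. t \<in> {c<..<d} \<Longrightarrow> \<bar>E' t\<bar> \<le> k * E t"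
    and "t0 \<in> {c..d}" "t \<in> {c..d}"
  shows "E t \<le> E t0 * exp (k * \<bar>t - t0\<bar>)"
proof (cases "t0 \<le> t")
  case True
  \<comment> \<open>Forward in time the product with the decaying exponential decreases; backward in
    time, the mirrored product below increases. The two-sided bound on \<open>E'\<close> serves
    both.\<close>
  have "(\<lambda>s. E s * exp (- k * (s - t0))) t \<le> (\<lambda>s. E s * exp (- k * (s - t0))) t0"
  proof (rule DERIV_nonpos_imp_decreasing_open[OF True, where f = "\<lambda>s. E s * exp (- k * (s - t0))"])
    show "continuous_on {t0..t} (\<lambda>s. E s * exp (- k * (s - t0)))"
      by (intro continuous_intros continuous_on_subset[OF cont]) (use assms in auto)
    fix s assume s: "t0 < s" "s < t"
    then have s': "s \<in> {c<..<d}" using assms by auto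
    have "((\<lambda>s. E s * exp (- k * (s - t0))) has_real_derivative (E' s - k * E s) * exp (- k * (s - t0))) (at s)"
      by (auto intro!: derivative_eq_intros der[OF s'] simp: algebra_simps)
    moreover have "(E' s - k * E s) * exp (- k * (s - t0)) \<le> 0"
      using bnd[OF s'] by (intro mult_nonpos_nonneg) auto
    ultimately show "\<exists>y. ((\<lambda>s. E s * exp (- k * (s - t0))) has_real_derivative y) (at s) \<and> y \<le> 0" by blast
  qed
  then have "E t * exp (- (k * (t - t0))) * exp (k * (t - t0)) \<le> E t0 * exp (k * (t - t0))"
    by (intro mult_right_mono) auto
  then show ?thesis using True by (simp add: mult.assoc exp_add[symmetric])
next
  case False
  have "(\<lambda>s. E s * exp (k * (s - t0))) t \<le> (\<lambda>s. E s * exp (k * (s - t0))) t0"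
  proof (rule DERIV_nonneg_imp_increasing_open[where f = "\<lambda>s. E s * exp (k * (s - t0))"])
    show "t \<le> t0" using False by simp
    show "continuous_on {t..t0} (\<lambda>s. E s * exp (k * (s - t0)))"
      by (intro continuous_intros continuous_on_subset[OF cont]) (use assms in auto)
    fix s assume s: "t < s" "s < t0"
    then have s': "s \<in> {c<..<d}" using assms by auto
    have "((\<lambda>s. E s * exp (k * (s - t0))) has_real_derivative (E' s + k * E s) * exp (k * (s - t0))) (at s)"
      by (auto intro!: derivative_eq_intros der[OF s'] simp: algebra_simps)
    moreover have "(E' s + k * E s) * exp (k * (s - t0)) \<ge> 0"
      using bnd[OF s'] by (intro mult_nonneg_nonneg) auto
    ultimately show "\<exists>y. ((\<lambda>s. E s * exp (k * (s - t0))) has_real_derivative y) (at s) \<and> y \<ge> 0" by blast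
  qed
  then have "E t * exp (k * (t - t0)) * exp (k * (t0 - t)) \<le> E t0 * exp (k * (t0 - t))"
    by (intro mult_right_mono) auto
  then show ?thesis using False by (simp add: mult.assoc exp_add[symmetric] algebra_simps)
qed

text \<open>Two different fields are allowed, with the Lipschitz estimate required only along the
  two solutions: a solution of the singular equation can then be compared with one of its
  truncation.\<close>

lemma gronwall2:
  fixes h1 h2 :: "real \<Rightarrow> real \<Rightarrow> real"
  assumes s: "solves2 h1 c d u1 v1" "solves2 h2 c d u2 v2"
    and lip: "\<And>t. t \<in> {c<..<d} \<Longrightarrow> \<bar>h1 t (u1 t) - h2 t (u2 t)\<bar> \<le> L * \<bar>u1 t - u2 t\<bar>"
    and t: "t0 \<in> {c..d}" "t \<in> {c..d}" and L: "L \<ge> 0"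
  shows "(u1 t - u2 t)^2 + (v1 t - v2 t)^2 \<le> ((u1 t0 - u2 t0)^2 + (v1 t0 - v2 t0)^2) * exp ((1 + L) * \<bar>t - t0\<bar>)"
proof (rule exp_bound_of_deriv_bound[OF _ _ _ t, where E = "\<lambda>t. (u1 t - u2 t)^2 + (v1 t - v2 t)^2"])
  show "continuous_on {c..d} (\<lambda>t. (u1 t - u2 t)\<^sup>2 + (v1 t - v2 t)\<^sup>2)"
    using s unfolding solves2_def by (intro continuous_intros) auto
  fix t assume t: "t \<in> {c<..<d}"
  show "((\<lambda>t. (u1 t - u2 t)\<^sup>2 + (v1 t - v2 t)\<^sup>2) has_real_derivative
     2 * ((u1 t - u2 t) * (v1 t - v2 t)) + 2 * ((v1 t - v2 t) * (h1 t (u1 t) - h2 t (u2 t)))) (at t)"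
    using s t unfolding solves2_def by (auto intro!: derivative_eq_intros simp: algebra_simps)
  let ?x = "\<bar>u1 t - u2 t\<bar>" and ?y = "\<bar>v1 t - v2 t\<bar>"
  have xy: "2 * (?x * ?y) \<le> ?x^2 + ?y^2" using sum_squares_bound[of ?x ?y] by (simp add: mult_ac)
  have "\<bar>2 * ((u1 t - u2 t) * (v1 t - v2 t)) + 2 * ((v1 t - v2 t) * (h1 t (u1 t) - h2 t (u2 t)))\<bar>
     \<le> 2 * (?x * ?y) + 2 * (?y * \<bar>h1 t (u1 t) - h2 t (u2 t)\<bar>)"
    by (rule order_trans[OF abs_triangle_ineq]) (simp only: abs_mult abs_numeral order_refl)
  also have "\<dots> \<le> 2 * (?x * ?y) + 2 * (?y * (L * ?x))"
    using lip[OF t] by (intro add_mono mult_left_mono) auto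
  also have "\<dots> = (1 + L) * (2 * (?x * ?y))" by (simp add: algebra_simps)
  also have "\<dots> \<le> (1 + L) * (?x^2 + ?y^2)" using xy L by (intro mult_left_mono) auto
  finally show "\<bar>2 * ((u1 t - u2 t) * (v1 t - v2 t)) + 2 * ((v1 t - v2 t) * (h1 t (u1 t) - h2 t (u2 t)))\<bar>
     \<le> (1 + L) * ((u1 t - u2 t)\<^sup>2 + (v1 t - v2 t)\<^sup>2)" by simp
qed

text \<open>With \<open>w' t = 0\<close>, a positive \<open>k\<close> would make \<open>w'\<close>
  positive just after \<open>t\<close> and push \<open>w\<close> above its maximum.\<close>

lemma second_derivative_at_max:
  fixes w w' :: "real \<Rightarrow> real"
  assumes t: "t \<in> {c<..<d}" and max: "\<And>s. s \<in> {c<..<d} \<Longrightarrow> w s \<le> w t"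
    and der: "\<And>s. s \<in> {c<..<d} \<Longrightarrow> (w has_real_derivative w' s) (at s)"
    and der2: "(w' has_real_derivative k) (at t)"
  shows "w' t = 0" "k \<le> 0"
proof -
  define \<delta> where "\<delta> = min (t - c) (d - t)"
  have \<delta>: "\<delta> > 0" using t by (auto simp: \<delta>_def)
  have in_cd: "\<bar>t - s\<bar> < \<delta> \<Longrightarrow> s \<in> {c<..<d}" for s by (auto simp: \<delta>_def)
  show w't: "w' t = 0"
    by (rule DERIV_local_max[OF der[OF t] \<delta>]) (use in_cd max in auto)
  show "k \<le> 0"
  proof (rule ccontr)
    assume "\<not> k \<le> 0"
    then obtain e where e: "e > 0" "\<And>h. h > 0 \<Longrightarrow> h < e \<Longrightarrow> w' t < w' (t + h)"
      using DERIV_pos_inc_right[OF der2] by auto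
    define s where "s = t + min e \<delta> / 2"
    have "min e \<delta> \<le> e" "min e \<delta> \<le> \<delta>" "min e \<delta> > 0" "\<delta> \<le> d - t" using e \<delta> by (auto simp: \<delta>_def)
    then have s: "t < s" "s < t + e" "s < d" unfolding s_def by auto
    have "\<exists>\<xi>. t < \<xi> \<and> \<xi> < s \<and> w s - w t = (s - t) * w' \<xi>"
      by (rule MVT2[OF s(1)]) (use s t der in auto)
    then obtain \<xi> where \<xi>: "t < \<xi>" "\<xi> < s" "w s - w t = (s - t) * w' \<xi>" by blast
    have "w' \<xi> > 0" using e(2)[of "\<xi> - t"] \<xi> s w't by auto
    then have "w s > w t" using \<xi> s mult_pos_pos[of "s - t" "w' \<xi>"] by linarith
    then show False using max[of s] s t by auto
  qed
qed

section \<open>The singular equation and its truncation\<close>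

definition clamp_to :: "real \<Rightarrow> real \<Rightarrow> real \<Rightarrow> real" where
  "clamp_to m M u = max m (min M u)"

lemma clamp_to:
  assumes "m \<le> M"
  shows "clamp_to m M u \<in> {m..M}" "u \<in> {m..M} \<Longrightarrow> clamp_to m M u = u"
    "u \<le> m \<Longrightarrow> clamp_to m M u = m" "u \<ge> M \<Longrightarrow> clamp_to m M u = M"
    "\<bar>clamp_to m M u - clamp_to m M v\<bar> \<le> \<bar>u - v\<bar>"
  using assms by (auto simp: clamp_to_def)

lemma solves2_cong:
  assumes "solves2 h c d u v" "\<And>t. t \<in> {c<..<d} \<Longrightarrow> h t (u t) = k t (u t)"
  shows "solves2 k c d u v"
  using assms unfolding solves2_def by auto

text \<open>In the application \<open>A\<close> is \<open>(log |F''|)''/4\<close>, while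
  \<open>B\<close> and \<open>C\<close> are \<open>N\<close> and \<open>\<Lambda>/3\<close> times
  \<open>|F''|\<close>; the unknown is the function \<open>p\<close> of the overview.\<close>

locale ode_field =
  fixes I :: "real set" and A B C :: "real \<Rightarrow> real"
  assumes contA: "continuous_on I A" and contB: "continuous_on I B" and contC: "continuous_on I C"
begin

definition f :: "real \<Rightarrow> real \<Rightarrow> real" where "f t u = A t * u + B t / u^3 + C t * u^3"

definition pos_sol where
  "pos_sol c d u v \<longleftrightarrow> solves2 f c d u v \<and> (\<forall>t\<in>{c..d}. u t > 0)"

lemma pos_sol_subset: "pos_sol c d u v \<Longrightarrow> c \<le> c' \<Longrightarrow> d' \<le> d \<Longrightarrow> pos_sol c' d' u v"
  unfolding pos_sol_def using solves2_subset[of f c d u v c' d'] by auto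

lemma coeff_bound:
  assumes "{c..d} \<subseteq> I"
  obtains N where "N > 0" "\<And>t. t \<in> {c..d} \<Longrightarrow> \<bar>A t\<bar> \<le> N" "\<And>t. t \<in> {c..d} \<Longrightarrow> \<bar>B t\<bar> \<le> N"
    "\<And>t. t \<in> {c..d} \<Longrightarrow> \<bar>C t\<bar> \<le> N"
proof -
  have "\<exists>b. \<forall>t\<in>{c..d}. \<bar>g t\<bar> \<le> b" if "continuous_on I g" for g :: "real \<Rightarrow> real"
    using compact_imp_bounded[OF compact_continuous_image[OF continuous_on_subset[OF that assms] compact_Icc]]
    by (auto simp: bounded_iff)
  from this[OF contA] this[OF contB] this[OF contC]
  obtain a b e where abe: "\<forall>t\<in>{c..d}. \<bar>A t\<bar> \<le> a" "\<forall>t\<in>{c..d}. \<bar>B t\<bar> \<le> b" "\<forall>t\<in>{c..d}. \<bar>C t\<bar> \<le> e"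
    by blast
  have "a \<le> max 1 (max a (max b e))" "b \<le> max 1 (max a (max b e))" "e \<le> max 1 (max a (max b e))" "0 < max 1 (max a (max b e))"
    by linarith+
  then show ?thesis using abe by (intro that[of "max 1 (max a (max b e))"]) (blast intro: order_trans)+
qed

lemma f_lipschitz:
  assumes cd: "{c..d} \<subseteq> I" and m: "0 < m"
  obtains L where "L \<ge> 0"
    "\<And>t u v. t \<in> {c..d} \<Longrightarrow> u \<in> {m..M} \<Longrightarrow> v \<in> {m..M} \<Longrightarrow> \<bar>f t u - f t v\<bar> \<le> L * \<bar>u - v\<bar>"
proof -
  obtain N where N: "N > 0" "\<And>t. t \<in> {c..d} \<Longrightarrow> \<bar>A t\<bar> \<le> N" "\<And>t. t \<in> {c..d} \<Longrightarrow> \<bar>B t\<bar> \<le> N"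
    "\<And>t. t \<in> {c..d} \<Longrightarrow> \<bar>C t\<bar> \<le> N" by (rule coeff_bound[OF cd]) (rule that)
  \<comment> \<open>The cubes contribute \<open>3 M^2\<close> on the bounded range; the reciprocal
    cubes need in addition the lower bound \<open>m^6\<close> for the product
    \<open>u^3 v^3\<close>.\<close>
  define L where "L = N + N * (3 * M^2 / m^6) + N * (3 * M^2)"
  show ?thesis
  proof
    show "L \<ge> 0" using N(1) m by (auto simp: L_def)
    fix t u v assume t: "t \<in> {c..d}" and uv: "u \<in> {m..M}" "v \<in> {m..M}"
    have pos: "u > 0" "v > 0" "M > 0" using uv m by auto
    have sq: "\<bar>u^2 + u * v + v^2\<bar> \<le> 3 * M^2"
    proof -
      have "u^2 \<le> M^2" "v^2 \<le> M^2" "u * v \<le> M * M"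
        using uv pos by (auto intro!: power_mono mult_mono)
      then show ?thesis using pos by (simp add: power2_eq_square)
    qed
    have cube: "\<bar>u^3 - v^3\<bar> \<le> 3 * M^2 * \<bar>u - v\<bar>"
    proof -
      have "u^3 - v^3 = (u^2 + u * v + v^2) * (u - v)" by algebra
      then show ?thesis using sq by (simp add: abs_mult mult_right_mono)
    qed
    have m6: "m^6 \<le> u^3 * v^3"
    proof -
      have "m^3 * m^3 \<le> u^3 * v^3" using uv m by (intro mult_mono power_mono) auto
      then show ?thesis by (simp add: power_add[symmetric])
    qed
    have "\<bar>1 / u^3 - 1 / v^3\<bar> = \<bar>u^3 - v^3\<bar> / (u^3 * v^3)"
      using pos by (simp add: divide_simps abs_minus_commute)
    also have "\<dots> \<le> (3 * M^2 * \<bar>u - v\<bar>) / m^6"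
      using cube m6 m pos by (intro frac_le) auto
    finally have inv: "\<bar>1 / u^3 - 1 / v^3\<bar> \<le> 3 * M^2 / m^6 * \<bar>u - v\<bar>" by simp
    have "f t u - f t v = A t * (u - v) + B t * (1 / u^3 - 1 / v^3) + C t * (u^3 - v^3)"
      by (simp add: f_def algebra_simps)
    then have "\<bar>f t u - f t v\<bar> \<le> \<bar>A t\<bar> * \<bar>u - v\<bar> + \<bar>B t\<bar> * \<bar>1 / u^3 - 1 / v^3\<bar> + \<bar>C t\<bar> * \<bar>u^3 - v^3\<bar>"
      by (simp only: abs_mult[symmetric])
    also have "\<dots> \<le> N * \<bar>u - v\<bar> + N * (3 * M^2 / m^6 * \<bar>u - v\<bar>) + N * (3 * M^2 * \<bar>u - v\<bar>)"
      using N t inv cube by (intro add_mono mult_mono) auto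
    also have "\<dots> = L * \<bar>u - v\<bar>" by (simp add: L_def algebra_simps)
    finally show "\<bar>f t u - f t v\<bar> \<le> L * \<bar>u - v\<bar>" .
  qed
qed

lemma cont_f:
  assumes "{c..d} \<subseteq> I" "continuous_on S g" "continuous_on S h" "g ` S \<subseteq> {c..d}" "\<And>x. x \<in> S \<Longrightarrow> h x > 0"
  shows "continuous_on S (\<lambda>x. f (g x) (h x))"
proof -
  have sub: "g ` S \<subseteq> I" using assms by blast
  show ?thesis unfolding f_def
    by (intro continuous_intros continuous_on_compose2[OF contA assms(2) sub]
        continuous_on_compose2[OF contB assms(2) sub] continuous_on_compose2[OF contC assms(2) sub] assms)
       (use assms(5) in force)
qed

text \<open>Clamping \<open>u\<close> to \<open>{m..M}\<close>, away from the singularity at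
  \<open>0\<close>, makes the field globally Lipschitz; each application shows afterwards that the
  clamp is inactive.\<close>

lemma trunc_exists:
  assumes cd: "c \<le> d" "{c..d} \<subseteq> I" and m: "0 < m" "m \<le> M"
  shows "\<exists>u v. solves2 (\<lambda>t u. f t (clamp_to m M u)) c d u v \<and> u t0 = u0 \<and> v t0 = v0"
proof -
  obtain L where L: "L \<ge> 0"
    "\<And>t u v. t \<in> {c..d} \<Longrightarrow> u \<in> {m..M} \<Longrightarrow> v \<in> {m..M} \<Longrightarrow> \<bar>f t u - f t v\<bar> \<le> L * \<bar>u - v\<bar>"
    by (rule f_lipschitz[OF cd(2) m(1), where M = M]) (rule that)
  show ?thesis
  proof (rule solves2_exists[OF cd(1) _ _ L(1)])
    have "continuous_on ({c..d} \<times> UNIV) (\<lambda>p. f (fst p) (clamp_to m M (snd p)))"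
    proof (rule cont_f[OF cd(2)])
      show "continuous_on ({c..d} \<times> UNIV) (\<lambda>p. clamp_to m M (snd p))"
        unfolding clamp_to_def by (intro continuous_intros)
      show "clamp_to m M (snd x) > 0" for x :: "real \<times> real"
        using clamp_to(1)[OF m(2), of "snd x"] m(1) by auto
    qed (auto intro!: continuous_intros)
    then show "continuous_on ({c..d} \<times> UNIV) (\<lambda>(t, u). f t (clamp_to m M u))"
      by (simp add: case_prod_unfold)
    show "\<bar>f t (clamp_to m M u) - f t (clamp_to m M v)\<bar> \<le> L * \<bar>u - v\<bar>" if "t \<in> {c..d}" for t u v
      by (rule order_trans[OF L(2)[OF that clamp_to(1) clamp_to(1)]])
         (use clamp_to(5)[OF m(2), of u v] m L in \<open>auto intro!: mult_left_mono\<close>)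
  qed
qed

lemma pos_sol_range:
  assumes "pos_sol c d u v" "c \<le> d"
  obtains m M where "0 < m" "m \<le> M" "\<And>t. t \<in> {c..d} \<Longrightarrow> u t \<in> {m..M}"
proof -
  have u: "continuous_on {c..d} u" "\<And>t. t \<in> {c..d} \<Longrightarrow> u t > 0"
    using assms by (auto simp: pos_sol_def solves2_def)
  obtain a where a: "a \<in> {c..d}" "\<forall>t\<in>{c..d}. u a \<le> u t"
    using continuous_attains_inf[OF compact_Icc _ u(1)] assms(2) by auto
  obtain b where b: "b \<in> {c..d}" "\<forall>t\<in>{c..d}. u t \<le> u b"
    using continuous_attains_sup[OF compact_Icc _ u(1)] assms(2) by auto
  show ?thesis by (rule that[of "u a" "u b"]) (use a b u in auto)
qed

lemma pos_sol_unique: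
  assumes p: "pos_sol c d u1 v1" "pos_sol c d u2 v2" and cd: "{c..d} \<subseteq> I"
    and t0: "t0 \<in> {c..d}" "u1 t0 = u2 t0" "v1 t0 = v2 t0" and t: "t \<in> {c..d}"
  shows "u1 t = u2 t" "v1 t = v2 t"
proof -
  have "c \<le> d" using t0 by auto
  obtain m1 M1 where 1: "0 < m1" "m1 \<le> M1" "\<And>t. t \<in> {c..d} \<Longrightarrow> u1 t \<in> {m1..M1}" by (rule pos_sol_range[OF p(1) \<open>c \<le> d\<close>]) (rule that)
  obtain m2 M2 where 2: "0 < m2" "m2 \<le> M2" "\<And>t. t \<in> {c..d} \<Longrightarrow> u2 t \<in> {m2..M2}" by (rule pos_sol_range[OF p(2) \<open>c \<le> d\<close>]) (rule that)
  define m M where "m = min m1 m2" and "M = max M1 M2"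
  have "0 < m" using 1 2 by (auto simp: m_def)
  have in_mM: "u1 t \<in> {m..M}" "u2 t \<in> {m..M}" if "t \<in> {c..d}" for t
    using 1(3)[OF that] 2(3)[OF that] by (auto simp: m_def M_def)
  obtain L where L: "L \<ge> 0"
    "\<And>t u v. t \<in> {c..d} \<Longrightarrow> u \<in> {m..M} \<Longrightarrow> v \<in> {m..M} \<Longrightarrow> \<bar>f t u - f t v\<bar> \<le> L * \<bar>u - v\<bar>"
    by (rule f_lipschitz[OF cd \<open>0 < m\<close>, where M = M]) (rule that)
  have "(u1 t - u2 t)^2 + (v1 t - v2 t)^2 \<le> ((u1 t0 - u2 t0)^2 + (v1 t0 - v2 t0)^2) * exp ((1 + L) * \<bar>t - t0\<bar>)"
    by (rule gronwall2[of f c d u1 v1 f u2 v2]) (use p L in_mM t0 t in \<open>auto simp: pos_sol_def\<close>)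
  then have "(u1 t - u2 t)^2 + (v1 t - v2 t)^2 \<le> 0" using t0 by simp
  then show "u1 t = u2 t" "v1 t = v2 t" unfolding sum_power2_le_zero_iff by auto
qed

text \<open>Solutions over compact intervals around \<open>y0\<close> with the same data at
  \<open>y0\<close> agree on overlaps. Each \<open>t\<close> selects an interval around both
  \<open>t\<close> and \<open>y0\<close>; near \<open>t\<close> the glued functions coincide with
  that single solution.\<close>

lemma pos_sol_patch:
  assumes I: "open I" "is_interval I" and y0: "y0 \<in> I"
    and ex: "\<And>c d. c < y0 \<Longrightarrow> y0 < d \<Longrightarrow> {c..d} \<subseteq> I \<Longrightarrow> \<exists>u v. pos_sol c d u v \<and> u y0 = u0 \<and> v y0 = v0"
  shows "\<exists>u v. \<forall>t\<in>I. u t > 0 \<and> (u has_real_derivative v t) (at t) \<and> (v has_real_derivative f t (u t)) (at t)"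
proof -
  define J where "J t p \<longleftrightarrow> fst p < y0 \<and> y0 < snd p \<and> {fst p..snd p} \<subseteq> I \<and> fst p < t \<and> t < snd p" for t p
  have exJ: "\<exists>p. J t p" if t: "t \<in> I" for t
  proof -
    obtain e1 where e1: "e1 > 0" "cball t e1 \<subseteq> I" using I(1) t unfolding open_contains_cball by blast
    obtain e2 where e2: "e2 > 0" "cball y0 e2 \<subseteq> I" using I(1) y0 unfolding open_contains_cball by blast
    define c where "c = min (t - e1) (y0 - e2)"
    define d where "d = max (t + e1) (y0 + e2)"
    have "t - e1 \<in> I" "t + e1 \<in> I" using e1(1) by (intro subsetD[OF e1(2)]; simp add: dist_real_def)+
    moreover have "y0 - e2 \<in> I" "y0 + e2 \<in> I" using e2(1) by (intro subsetD[OF e2(2)]; simp add: dist_real_def)+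
    ultimately have "c \<in> I" "d \<in> I" unfolding c_def d_def min_def max_def by presburger+
    then have "{c..d} \<subseteq> I"
      by (meson atLeastAtMost_iff I(2) mem_is_interval_1_I subsetI)
    moreover have "c < t" "c < y0" "t < d" "y0 < d" using e1 e2 by (auto simp: c_def d_def)
    ultimately show ?thesis by (intro exI[of _ "(c, d)"]) (auto simp: J_def)
  qed
  define p where "p t = (SOME p. J t p)" for t
  have p: "J t (p t)" if "t \<in> I" for t unfolding p_def by (rule someI_ex[OF exJ[OF that]])
  define W where "W q = (SOME w. pos_sol (fst q) (snd q) (fst w) (snd w) \<and> fst w y0 = u0 \<and> snd w y0 = v0)" for q
  have W: "pos_sol (fst q) (snd q) (fst (W q)) (snd (W q)) \<and> fst (W q) y0 = u0 \<and> snd (W q) y0 = v0"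
    if q: "fst q < y0" "y0 < snd q" "{fst q..snd q} \<subseteq> I" for q
  proof -
    obtain u v where "pos_sol (fst q) (snd q) u v \<and> u y0 = u0 \<and> v y0 = v0" using ex[OF q] by blast
    then show ?thesis
      using someI[of "\<lambda>w. pos_sol (fst q) (snd q) (fst w) (snd w) \<and> fst w y0 = u0 \<and> snd w y0 = v0" "(u, v)"]
      by (simp add: W_def)
  qed
  define u where "u t = fst (W (p t)) t" for t
  define v where "v t = snd (W (p t)) t" for t
  have agree: "u s = fst (W (p t)) s" "v s = snd (W (p t)) s" if t: "t \<in> I" and s: "s \<in> {fst (p t)<..<snd (p t)}" for s t
  proof -
    have Jt: "J t (p t)" using p[OF t] .
    then have sI: "s \<in> I" using s by (auto simp: J_def)
    then have Js: "J s (p s)" by (rule p)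
    define c where "c = max (fst (p s)) (fst (p t))"
    define d where "d = min (snd (p s)) (snd (p t))"
    have ps: "pos_sol (fst (p s)) (snd (p s)) (fst (W (p s))) (snd (W (p s)))" "fst (W (p s)) y0 = u0" "snd (W (p s)) y0 = v0"
      using W[of "p s"] Js by (auto simp: J_def)
    have pt: "pos_sol (fst (p t)) (snd (p t)) (fst (W (p t))) (snd (W (p t)))" "fst (W (p t)) y0 = u0" "snd (W (p t)) y0 = v0"
      using W[of "p t"] Jt by (auto simp: J_def)
    have 1: "pos_sol c d (fst (W (p s))) (snd (W (p s)))" by (rule pos_sol_subset[OF ps(1)]) (auto simp: c_def d_def)
    have 2: "pos_sol c d (fst (W (p t))) (snd (W (p t)))" by (rule pos_sol_subset[OF pt(1)]) (auto simp: c_def d_def)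
    have "{c..d} \<subseteq> {fst (p s)..snd (p s)}" by (auto simp: c_def d_def)
    then have cd: "{c..d} \<subseteq> I" using Js by (auto simp: J_def)
    have "y0 \<in> {c..d}" "s \<in> {c..d}" using Js Jt s by (auto simp: J_def c_def d_def)
    then show "u s = fst (W (p t)) s" "v s = snd (W (p t)) s"
      using pos_sol_unique[OF 1 2 cd, of y0 s] ps(2,3) pt(2,3) unfolding u_def v_def by simp_all
  qed
  show ?thesis
  proof (intro exI ballI conjI)
    fix t assume t: "t \<in> I"
    have Jt: "J t (p t)" using p[OF t] .
    have pt: "pos_sol (fst (p t)) (snd (p t)) (fst (W (p t))) (snd (W (p t)))"
      using W[of "p t"] Jt by (auto simp: J_def)
    have tt: "t \<in> {fst (p t)<..<snd (p t)}" using Jt by (auto simp: J_def)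
    show "u t > 0" using pt tt by (auto simp: pos_sol_def u_def)
    have "(fst (W (p t)) has_real_derivative v t) (at t)"
      using pt tt by (auto simp: pos_sol_def solves2_def v_def)
    then show "(u has_real_derivative v t) (at t)"
      by (rule has_field_derivative_transform_within_open[OF _ open_greaterThanLessThan tt]) (simp add: agree[OF t])
    have "(snd (W (p t)) has_real_derivative f t (u t)) (at t)"
      using pt tt by (auto simp: pos_sol_def solves2_def u_def)
    then show "(v has_real_derivative f t (u t)) (at t)"
      by (rule has_field_derivative_transform_within_open[OF _ open_greaterThanLessThan tt]) (simp add: agree[OF t])
  qed
qed

text \<open>The energy is monotone up to terms controlled by itself; the summand \<open>u\<^sup>2/2\<close> is only there to keep
  control of \<open>u\<close> when \<open>b0 = 0\<close>. Clamping \<open>u\<close> makes the equation globally Lipschitz, and a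
  first-exit argument shows that the clamp is never active.\<close>

lemma solution_by_energy:
  assumes c1: "\<And>t. t \<in> I \<Longrightarrow> (g has_real_derivative g' t) (at t)" and g: "\<And>t. t \<in> I \<Longrightarrow> g t > 0"
    and cg': "continuous_on I g'"
    and BC: "\<And>t. t \<in> I \<Longrightarrow> B t = a0 * g t" "\<And>t. t \<in> I \<Longrightarrow> C t = - b0 * g t" and ab: "a0 > 0" "b0 \<ge> 0"
    and cd: "c < y0" "y0 < d" "{c..d} \<subseteq> I"
  shows "\<exists>u v. pos_sol c d u v \<and> u y0 = 1 \<and> v y0 = 0"
proof -
  have cg: "continuous_on {c..d} g"
    using c1 cd(3) by (meson DERIV_isCont continuous_at_imp_continuous_on subset_iff)
  have y0: "y0 \<in> {c..d}" using cd by auto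
  have bdd: "\<exists>b. \<forall>t\<in>{c..d}. \<bar>h t\<bar> \<le> b" if "continuous_on {c..d} h" for h :: "real \<Rightarrow> real"
    using compact_imp_bounded[OF compact_continuous_image[OF that compact_Icc]]
    by (auto simp: bounded_iff)
  have "continuous_on {c..d} (\<lambda>t. g' t / g t)"
    using g cd(3) by (intro continuous_intros cg continuous_on_subset[OF cg' cd(3)]) force
  then obtain k1 where k1: "\<And>t. t \<in> {c..d} \<Longrightarrow> \<bar>g' t / g t\<bar> \<le> k1" using bdd by blast
  have "continuous_on {c..d} (\<lambda>t. A t / g t)"
    using g cd(3) by (intro continuous_intros cg continuous_on_subset[OF contA cd(3)]) force
  then obtain k2 where k2: "\<And>t. t \<in> {c..d} \<Longrightarrow> \<bar>A t / g t\<bar> \<le> k2" using bdd by blast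
  obtain k3 where k3: "\<And>t. t \<in> {c..d} \<Longrightarrow> \<bar>g t\<bar> \<le> k3" using bdd[OF cg] by blast
  have kpos: "k1 \<ge> 0" "k2 \<ge> 0" "k3 > 0"
  proof -
    have "g y0 > 0" using g y0 cd(3) by blast
    then show "k1 \<ge> 0" "k2 \<ge> 0" "k3 > 0" using k1[OF y0] k2[OF y0] k3[OF y0] by linarith+
  qed
  \<comment> \<open>The rate collects \<open>k1\<close> from \<open>g'/g\<close>,
    \<open>k2 (k3 + 1)\<close> from \<open>A/g\<close>, and \<open>k3 + 1\<close> from the summand
    \<open>u^2/2\<close>.\<close>
  define k where "k = k1 + (k2 + 1) * (k3 + 1)"
  \<comment> \<open>Dividing the kinetic energy by \<open>g\<close> turns the two nonlinear forces
    into gradients: the sum of the first three summands changes only through \<open>A\<close> and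
    \<open>g'\<close>.\<close>
  define E where "E u v t = (v t)^2 / (2 * g t) + a0 / (2 * (u t)^2) + b0 * (u t)^4 / 4 + (u t)^2 / 2" for u v :: "real \<Rightarrow> real" and t
  define E0 where "E0 = (a0 / 2 + b0 / 4 + 1 / 2) * exp (k * (d - c))"
  have E0: "E0 > 0" unfolding E0_def using ab by (intro mult_pos_pos) auto
  \<comment> \<open>\<open>E \<le> E0\<close> confines \<open>u\<close> between
    \<open>sqrt (a0/(2 E0))\<close> and \<open>sqrt (2 E0)\<close>. The clamp is set a factor
    \<open>2\<close> beyond these, and beyond the initial value \<open>1\<close>, so that the bounds
    are strict.\<close>
  define m where "m = min (1/2) (sqrt (a0 / (2 * E0)) / 2)"
  define M where "M = max 2 (2 * sqrt (2 * E0))"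
  have m: "0 < m" "m < 1" "1 < M" "m \<le> M" using ab E0 by (auto simp: m_def M_def)
  have "c \<le> d" using cd by simp
  from trunc_exists[OF this cd(3) m(1,4), of y0 1 0]
  obtain u v where uv: "solves2 (\<lambda>t u. f t (clamp_to m M u)) c d u v" and init: "u y0 = 1" "v y0 = 0"
    by blast
  have cu: "continuous_on {c..d} u" "continuous_on {c..d} v" using uv by (auto simp: solves2_def)
  have bound: "E u v t \<le> E0" if seg: "\<And>s. s \<in> {min y0 t..max y0 t} \<Longrightarrow> u s \<in> {m..M}" and t: "t \<in> {c..d}" for t
  proof -
    have mn: "c \<le> min y0 t" "max y0 t \<le> d" using t y0 by auto
    have sub: "{min y0 t..max y0 t} \<subseteq> {c..d}" using t y0 by auto
    have cont: "continuous_on {min y0 t..max y0 t} (E u v)"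
    proof -
      have "g s \<noteq> 0" "u s \<noteq> 0" if "s \<in> {min y0 t..max y0 t}" for s
      proof -
        have "s \<in> I" using that sub cd(3) by blast
        then show "g s \<noteq> 0" using g[of s] by simp
        show "u s \<noteq> 0" using seg[OF that] m(1) by auto
      qed
      then show ?thesis unfolding E_def
        by (intro continuous_intros continuous_on_subset[OF cu(1) sub] continuous_on_subset[OF cu(2) sub] continuous_on_subset[OF cg sub]) auto
    qed
    have "E u v t \<le> E u v y0 * exp (k * \<bar>t - y0\<bar>)"
    proof (rule exp_bound_of_deriv_bound[OF cont, where E' = "\<lambda>s. A s / g s * (u s * v s) - g' s / g s * ((v s)^2 / (2 * g s)) + u s * v s"])
      fix s assume s: "s \<in> {min y0 t<..<max y0 t}"
      then have "s \<in> {c<..<d}" "s \<in> {c..d}" using mn by auto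
      then have s': "s \<in> {c<..<d}" "s \<in> I" "s \<in> {c..d}" using cd(3) by blast+
      have gs: "g s > 0" using g s' by auto
      have us: "u s \<in> {m..M}" using seg s by auto
      then have us0: "u s > 0" using m by auto
      have du: "(u has_real_derivative v s) (at s)" using uv s' by (auto simp: solves2_def)
      have "(v has_real_derivative f s (clamp_to m M (u s))) (at s)"
        using uv s'(1) unfolding solves2_def by blast
      then have dv: "(v has_real_derivative f s (u s)) (at s)" unfolding clamp_to(2)[OF m(4) us] .
      show "(E u v has_real_derivative A s / g s * (u s * v s) - g' s / g s * ((v s)^2 / (2 * g s)) + u s * v s) (at s)"
      proof -
        have 1: "((\<lambda>s. (v s)^2 / (2 * g s)) has_real_derivative v s * f s (u s) / g s - g' s / g s * ((v s)^2 / (2 * g s))) (at s)"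
          by (rule DERIV_cong, rule DERIV_divide[OF DERIV_power[OF dv, of 2] DERIV_cmult[OF c1[OF s'(2)], of 2]])
             (use gs in \<open>simp_all add: field_simps power2_eq_square\<close>)
        have 2: "((\<lambda>s. a0 / (2 * (u s)^2)) has_real_derivative - a0 * v s / (u s)^3) (at s)"
          by (rule DERIV_cong, rule DERIV_divide[OF DERIV_const DERIV_cmult[OF DERIV_power[OF du, of 2], of 2]])
             (use us0 in \<open>simp_all add: field_simps eval_nat_numeral\<close>)
        have 3: "((\<lambda>s. b0 * (u s)^4 / 4) has_real_derivative b0 * (u s)^3 * v s) (at s)"
          by (rule DERIV_cong, rule DERIV_cdivide[OF DERIV_cmult[OF DERIV_power[OF du, of 4], of b0], of 4]) simp
        have 4: "((\<lambda>s. (u s)^2 / 2) has_real_derivative u s * v s) (at s)"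
          by (rule DERIV_cong, rule DERIV_cdivide[OF DERIV_power[OF du, of 2], of 2]) simp
        have "v s * f s (u s) / g s - a0 * v s / (u s)^3 + b0 * (u s)^3 * v s = A s / g s * (u s * v s)"
          using gs us0 unfolding f_def BC(1)[OF s'(2)] BC(2)[OF s'(2)] by (simp add: field_simps)
        then show ?thesis unfolding E_def[abs_def]
          by (intro DERIV_cong[OF DERIV_add[OF DERIV_add[OF DERIV_add[OF 1 2] 3] 4]]) simp
      qed
      have uvs: "\<bar>u s * v s\<bar> \<le> (k3 + 1) * (E u v s)"
      proof -
        have "\<bar>u s * v s\<bar> \<le> (u s)^2 / 2 + (v s)^2 / 2"
          using sum_squares_bound[of "\<bar>u s\<bar>" "\<bar>v s\<bar>"] by (simp add: abs_mult)
        also have "(v s)^2 / 2 \<le> k3 * ((v s)^2 / (2 * g s))"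
        proof -
          have "g s * ((v s)^2 / (2 * g s)) \<le> k3 * ((v s)^2 / (2 * g s))"
            using k3[OF s'(3)] gs by (intro mult_right_mono) auto
          then show ?thesis using gs by simp
        qed
        also have "(u s)^2 / 2 + k3 * ((v s)^2 / (2 * g s)) \<le> (k3 + 1) * ((u s)^2 / 2) + (k3 + 1) * ((v s)^2 / (2 * g s))"
          using kpos gs by (intro add_mono mult_right_mono) (auto simp: mult_le_cancel_right1 algebra_simps)
        also have "\<dots> \<le> (k3 + 1) * E u v s"
          using kpos gs ab us0 unfolding E_def distrib_left[symmetric] by (intro mult_left_mono) auto
        finally show ?thesis by simp
      qed
      have Ege: "(v s)^2 / (2 * g s) \<le> E u v s" "E u v s \<ge> 0" using gs ab us0 by (auto simp: E_def)
      have "\<bar>A s / g s * (u s * v s) - g' s / g s * ((v s)^2 / (2 * g s)) + u s * v s\<bar>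
         \<le> \<bar>A s / g s\<bar> * \<bar>u s * v s\<bar> + \<bar>g' s / g s\<bar> * \<bar>(v s)^2 / (2 * g s)\<bar> + \<bar>u s * v s\<bar>"
        by (simp only: abs_mult[symmetric])
      also have "\<dots> \<le> k2 * ((k3 + 1) * E u v s) + k1 * E u v s + (k3 + 1) * E u v s"
        using k1[OF s'(3)] k2[OF s'(3)] uvs Ege kpos gs by (intro add_mono mult_mono) auto
      also have "\<dots> = k * E u v s" by (simp add: k_def algebra_simps)
      finally show "\<bar>A s / g s * (u s * v s) - g' s / g s * ((v s)^2 / (2 * g s)) + u s * v s\<bar> \<le> k * E u v s" .
    qed auto
    also have "E u v y0 = a0 / 2 + b0 / 4 + 1 / 2" by (simp add: E_def init)
    also have "(a0 / 2 + b0 / 4 + 1 / 2) * exp (k * \<bar>t - y0\<bar>) \<le> E0"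
    proof -
      have "k \<ge> 0" using kpos by (simp add: k_def)
      moreover have "\<bar>t - y0\<bar> \<le> d - c" using t y0 by auto
      ultimately have "k * \<bar>t - y0\<bar> \<le> k * (d - c)" by (rule mult_left_mono[rotated])
      then show ?thesis unfolding E0_def using ab by (intro mult_left_mono) auto
    qed
    finally show ?thesis .
  qed
  have strict: "m < u t \<and> u t < M" if "E u v t \<le> E0" "u t > 0" "t \<in> I" for t
  proof -
    have g': "g t > 0" using g that by auto
    have ge: "(v t)^2 / (2 * g t) \<ge> 0" "b0 * (u t)^4 / 4 \<ge> 0" "a0 / (2 * (u t)^2) \<ge> 0" using g' ab by auto
    have E: "(v t)^2 / (2 * g t) + a0 / (2 * (u t)^2) + b0 * (u t)^4 / 4 + (u t)^2 / 2 \<le> E0"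
      using that(1) unfolding E_def .
    have "(u t)^2 / 2 \<le> E0" using E ge by linarith
    then have "u t \<le> sqrt (2 * E0)" using that by (intro real_le_rsqrt) auto
    moreover have "sqrt (2 * E0) > 0" using E0 by simp
    ultimately have 1: "u t < M" unfolding M_def by linarith
    have "(u t)^2 / 2 \<ge> 0" by simp
    then have "a0 / (2 * (u t)^2) \<le> E0" using E ge by linarith
    then have "a0 / (2 * E0) \<le> (u t)^2" using that E0 by (simp add: field_simps)
    then have "sqrt (a0 / (2 * E0)) \<le> u t" using that by (intro real_le_lsqrt) auto
    moreover have "sqrt (a0 / (2 * E0)) > 0" using E0 ab by simp
    ultimately have 2: "m < u t" unfolding m_def by linarith
    show ?thesis using 1 2 by simp
  qed
  have inside: "m < u t \<and> u t < M" if t: "t \<in> {c..d}" for t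
  proof (rule ccontr)
    assume neg: "\<not> (m < u t \<and> u t < M)"
    \<comment> \<open>\<open>Z\<close> collects the times at which the clamp is reached;
      \<open>t1\<close> below is one nearest to \<open>y0\<close>. Up to \<open>t1\<close> the
      energy bound is valid, and it places \<open>u t1\<close> strictly inside, a
      contradiction.\<close>
    define Z where "Z = {c..d} \<inter> u -` ({..m} \<union> {M..})"
    have "closed Z" unfolding Z_def
      by (intro continuous_closed_preimage[OF cu(1)] closed_Un) auto
    moreover have "bounded Z" unfolding Z_def by (rule bounded_subset[OF bounded_closed_interval[of c d]]) auto
    ultimately have cZ: "compact Z" unfolding compact_eq_bounded_closed by blast
    have Zne: "Z \<noteq> {}" using t neg by (auto simp: Z_def)
    have "continuous_on Z (\<lambda>s. \<bar>s - y0\<bar>)" by (intro continuous_intros)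
    from continuous_attains_inf[OF cZ Zne this]
    obtain t1 where t1: "t1 \<in> Z" "\<And>s. s \<in> Z \<Longrightarrow> \<bar>t1 - y0\<bar> \<le> \<bar>s - y0\<bar>" by blast
    have t1cd: "t1 \<in> {c..d}" using t1 by (auto simp: Z_def)
    have near: "u s \<in> {m<..<M}" if "s \<in> {c..d}" "\<bar>s - y0\<bar> < \<bar>t1 - y0\<bar>" for s
      using t1(2)[of s] that by (force simp: Z_def)
    have ne: "t1 \<noteq> y0" using t1 init m by (auto simp: Z_def)
    \<comment> \<open>At \<open>t1\<close> itself the weak bounds follow by continuity from those at
      nearer times.\<close>
    have t1in: "u t1 \<in> {m..M}"
    proof -
      have "t1 \<in> closure {min y0 t1<..<max y0 t1}" using ne by (auto simp: min_def max_def)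
      moreover have "u ` closure {min y0 t1<..<max y0 t1} \<subseteq> {m..M}"
      proof (rule image_closure_subset)
        show "continuous_on (closure {min y0 t1<..<max y0 t1}) u"
          by (rule continuous_on_subset[OF cu(1)]) (use ne t1cd y0 in auto)
        show "u ` {min y0 t1<..<max y0 t1} \<subseteq> {m..M}"
        proof (rule image_subsetI)
          fix s assume s: "s \<in> {min y0 t1<..<max y0 t1}"
          then have "s \<in> {c..d}" "\<bar>s - y0\<bar> < \<bar>t1 - y0\<bar>"
            using t1cd y0 by (auto simp: min_def max_def split: if_splits)
          from near[OF this] show "u s \<in> {m..M}" by auto
        qed
      qed auto
      ultimately show ?thesis by blast
    qed
    have "E u v t1 \<le> E0"
    proof (rule bound[OF _ t1cd])
      fix s assume s: "s \<in> {min y0 t1..max y0 t1}"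
      show "u s \<in> {m..M}"
      proof (cases "s = t1")
        case False
        then have "s \<in> {c..d}" "\<bar>s - y0\<bar> < \<bar>t1 - y0\<bar>" using s t1cd y0 by (auto simp: min_def max_def split: if_splits)
        then show ?thesis using near[of s] by auto
      qed (use t1in in simp)
    qed
    then have "m < u t1 \<and> u t1 < M" using strict[of t1] t1in m t1cd cd(3) by auto
    then show False using t1 by (auto simp: Z_def)
  qed
  have "pos_sol c d u v" unfolding pos_sol_def
  proof (intro conjI ballI)
    show "solves2 f c d u v"
      by (rule solves2_cong[OF uv]) (use inside in \<open>simp add: clamp_to(2)[OF m(4)] less_imp_le\<close>)
    show "u t > 0" if "t \<in> {c..d}" for t using inside[OF that] m by auto
  qed
  then show ?thesis using init by blast
qed

section \<open>Boundary value problems and interior bounds\<close>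

lemma coeff_lower_bound:
  fixes g :: "real \<Rightarrow> real"
  assumes "continuous_on {c..d} g" "\<And>t. t \<in> {c..d} \<Longrightarrow> g t > 0" "c \<le> d"
  obtains n where "n > 0" "\<And>t. t \<in> {c..d} \<Longrightarrow> n \<le> g t"
proof -
  obtain a where a: "a \<in> {c..d}" "\<forall>t\<in>{c..d}. g a \<le> g t"
    using continuous_attains_inf[OF compact_Icc _ assms(1)] assms(3) by auto
  show ?thesis by (rule that[of "g a"]) (use a assms in auto)
qed

lemma sign_bounds:
  assumes Bneg: "\<And>t. t \<in> I \<Longrightarrow> B t < 0" and Cpos: "\<And>t. t \<in> I \<Longrightarrow> C t > 0"
    and cd: "c < d" "{c..d} \<subseteq> I"
  obtains N nB nC where "N > 0" "\<And>t. t \<in> {c..d} \<Longrightarrow> \<bar>A t\<bar> \<le> N" "\<And>t. t \<in> {c..d} \<Longrightarrow> \<bar>B t\<bar> \<le> N"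
    "\<And>t. t \<in> {c..d} \<Longrightarrow> \<bar>C t\<bar> \<le> N" "nB > 0" "\<And>t. t \<in> {c..d} \<Longrightarrow> nB \<le> - B t"
    "nC > 0" "\<And>t. t \<in> {c..d} \<Longrightarrow> nC \<le> C t"
proof -
  obtain N where N: "N > 0" "\<And>t. t \<in> {c..d} \<Longrightarrow> \<bar>A t\<bar> \<le> N" "\<And>t. t \<in> {c..d} \<Longrightarrow> \<bar>B t\<bar> \<le> N"
    "\<And>t. t \<in> {c..d} \<Longrightarrow> \<bar>C t\<bar> \<le> N" by (rule coeff_bound[OF cd(2)]) (rule that)
  have cc: "continuous_on {c..d} (\<lambda>t. - B t)" "continuous_on {c..d} C"
    by (intro continuous_intros continuous_on_subset[OF contB cd(2)] continuous_on_subset[OF contC cd(2)])+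
  have cd': "c \<le> d" using cd by simp
  have Bneg': "t \<in> {c..d} \<Longrightarrow> - B t > 0" for t using Bneg cd(2) by force
  have Cpos': "t \<in> {c..d} \<Longrightarrow> C t > 0" for t using Cpos cd(2) by force
  obtain nB where nB: "nB > 0" "\<And>t. t \<in> {c..d} \<Longrightarrow> nB \<le> - B t"
    using coeff_lower_bound[OF cc(1) _ cd'] Bneg' by blast
  obtain nC where nC: "nC > 0" "\<And>t. t \<in> {c..d} \<Longrightarrow> nC \<le> C t"
    using coeff_lower_bound[OF cc(2) _ cd'] Cpos' by blast
  show ?thesis by (rule that[OF N nB nC])
qed

lemma f_bounded:
  assumes "{c..d} \<subseteq> I" "0 < m"
  obtains b where "\<And>t x. t \<in> {c..d} \<Longrightarrow> x \<in> {m..M} \<Longrightarrow> \<bar>f t x\<bar> \<le> b"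
proof -
  have "continuous_on ({c..d} \<times> {m..M}) (\<lambda>p. f (fst p) (snd p))"
    by (rule cont_f[OF assms(1)]) (use assms(2) in \<open>auto intro!: continuous_intros\<close>)
  then have "bounded ((\<lambda>p. f (fst p) (snd p)) ` ({c..d} \<times> {m..M}))"
    by (intro compact_imp_bounded compact_continuous_image compact_Times) auto
  then obtain b where "\<forall>y\<in>(\<lambda>p. f (fst p) (snd p)) ` ({c..d} \<times> {m..M}). norm y \<le> b"
    unfolding bounded_iff by blast
  then show ?thesis by (intro that[of b]) force
qed

text \<open>Shooting from the value \<alpha> at \<open>c\<close> for the truncated equation: its
  field is bounded by \<open>Bd\<close>, so initial slopes \<open>Bd (d - c)\<close> and its
  negative lead to end values on opposite sides of \<alpha>, and an intermediate slope returns to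
  \<alpha>. The maximum principle with the constants \<alpha> and \<beta> then keeps the solution
  within the clamp.\<close>

lemma two_point_bvp:
  assumes Bneg: "\<And>t. t \<in> I \<Longrightarrow> B t < 0" and Cpos: "\<And>t. t \<in> I \<Longrightarrow> C t > 0"
    and cd: "c < d" "{c..d} \<subseteq> I"
  shows "\<exists>u v. pos_sol c d u v"
proof -
  obtain N nB nC where N: "N > 0" "\<And>t. t \<in> {c..d} \<Longrightarrow> \<bar>A t\<bar> \<le> N" "\<And>t. t \<in> {c..d} \<Longrightarrow> \<bar>B t\<bar> \<le> N"
    "\<And>t. t \<in> {c..d} \<Longrightarrow> \<bar>C t\<bar> \<le> N" and nB: "nB > 0" "\<And>t. t \<in> {c..d} \<Longrightarrow> nB \<le> - B t"
    and nC: "nC > 0" "\<And>t. t \<in> {c..d} \<Longrightarrow> nC \<le> C t"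
    using sign_bounds[OF Bneg Cpos cd] by blast
  have cd': "c \<le> d" "c \<in> {c..d}" "d \<in> {c..d}" using cd by auto
  \<comment> \<open>\<alpha> is so small that the singular term beats the others,
    \<open>2 N \<alpha>^4 < nB\<close>, and \<beta> so large that the cubic term does,
    \<open>2 N < nC \<beta>^2\<close>.\<close>
  define \<alpha> where "\<alpha> = min (1/2) (nB / (4 * N))"
  define \<beta> where "\<beta> = 1 + (2 * N + 1) / nC"
  have "0 < \<alpha>" "\<alpha> < 1" "1 < \<beta>" using N(1) nB(1) nC(1) by (auto simp: \<alpha>_def \<beta>_def add_pos_pos)
  then have ab: "0 < \<alpha>" "\<alpha> < 1" "1 < \<beta>" "\<alpha> \<le> \<beta>" by linarith+
  have f\<alpha>: "f t \<alpha> < 0" if t: "t \<in> {c..d}" for t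
  proof -
    have "\<alpha>^4 \<le> \<alpha>" using ab power_decreasing[of 1 4 \<alpha>] by simp
    also have "\<dots> \<le> nB / (4 * N)" by (simp add: \<alpha>_def)
    finally have a4: "2 * N * \<alpha>^4 < nB" using N(1) nB by (simp add: field_simps)
    have "\<alpha>^3 \<le> \<alpha>" using ab power_decreasing[of 1 3 \<alpha>] by simp
    then have "f t \<alpha> \<le> N * \<alpha> + (- nB) / \<alpha>^3 + N * \<alpha>"
      unfolding f_def using N(2)[OF t] N(4)[OF t] nB(2)[OF t] ab N(1)
      by (intro add_mono mult_mono divide_right_mono) auto
    also have "\<dots> = (2 * N * \<alpha>^4 - nB) / \<alpha>^3" using ab by (simp add: field_simps eval_nat_numeral)
    also have "\<dots> < 0" using a4 ab by (simp add: divide_neg_pos)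
    finally show ?thesis .
  qed
  have f\<beta>: "f t \<beta> > 0" if t: "t \<in> {c..d}" for t
  proof -
    have b2: "\<beta> \<le> \<beta>^2" using ab by (simp add: power2_eq_square)
    have "2 * N < nC * \<beta>" using nC(1) N(1) by (simp add: \<beta>_def field_simps add_pos_pos)
    also have "\<dots> \<le> nC * \<beta>^2" using b2 nC(1) by simp
    finally have "0 < (nC * \<beta>^2 - 2 * N) * \<beta>" using ab by simp
    also have "\<dots> = - N * \<beta> + (- N) * \<beta> + nC * \<beta>^3" by (simp add: algebra_simps eval_nat_numeral)
    also have "\<dots> \<le> f t \<beta>" unfolding f_def
    proof (intro add_mono)
      have "- N \<le> A t" using N(2)[OF t] by linarith
      then show "- N * \<beta> \<le> A t * \<beta>" using ab(3) by (intro mult_right_mono) auto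
      show "nC * \<beta>^3 \<le> C t * \<beta>^3" using nC(2)[OF t] ab(3) by (intro mult_right_mono) auto
      have "1 / \<beta>^3 \<le> \<beta>"
      proof -
        have "1 / \<beta>^3 \<le> 1" using ab by simp
        then show ?thesis using ab by linarith
      qed
      then have "\<bar>B t\<bar> * (1 / \<beta>^3) \<le> N * \<beta>" using N(3)[OF t] N(1) ab by (intro mult_mono) auto
      then have "\<bar>B t / \<beta>^3\<bar> \<le> N * \<beta>" using ab by (simp add: abs_divide)
      then show "- N * \<beta> \<le> B t / \<beta>^3" by linarith
    qed
    finally show ?thesis .
  qed
  define h where "h t u = f t (clamp_to \<alpha> \<beta> u)" for t u
  obtain L where L: "L \<ge> 0"
    "\<And>t u v. t \<in> {c..d} \<Longrightarrow> u \<in> {\<alpha>..\<beta>} \<Longrightarrow> v \<in> {\<alpha>..\<beta>} \<Longrightarrow> \<bar>f t u - f t v\<bar> \<le> L * \<bar>u - v\<bar>"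
    by (rule f_lipschitz[OF cd(2) ab(1), where M = \<beta>]) (rule that)
  have hlip: "\<bar>h t u - h t v\<bar> \<le> L * \<bar>u - v\<bar>" if "t \<in> {c..d}" for t u v
    unfolding h_def
    by (rule order_trans[OF L(2)[OF that clamp_to(1)[OF ab(4)] clamp_to(1)[OF ab(4)]]])
       (intro mult_left_mono clamp_to(5)[OF ab(4)] L(1))
  obtain Bd where Bd: "\<And>t x. t \<in> {c..d} \<Longrightarrow> x \<in> {\<alpha>..\<beta>} \<Longrightarrow> \<bar>f t x\<bar> \<le> Bd"
    using f_bounded[OF cd(2) ab(1)] by blast
  have hb: "\<bar>h t u\<bar> \<le> Bd" if t: "t \<in> {c..d}" for t u
    unfolding h_def by (rule Bd[OF t clamp_to(1)[OF ab(4)]])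
  have "\<exists>uv. \<forall>s. solves2 h c d (fst (uv s)) (snd (uv s)) \<and> fst (uv s) c = \<alpha> \<and> snd (uv s) c = s"
    using trunc_exists[OF cd'(1) cd(2) ab(1) ab(4), of c \<alpha>] unfolding h_def[symmetric]
    by (intro choice allI) auto
  then obtain uv where uv: "\<And>s. solves2 h c d (fst (uv s)) (snd (uv s))" "\<And>s. fst (uv s) c = \<alpha>" "\<And>s. snd (uv s) c = s"
    by blast
  define e where "e s = fst (uv s) d" for s
  have lips: "\<bar>e s - e s'\<bar> \<le> exp ((1 + L) * \<bar>d - c\<bar>) * \<bar>s - s'\<bar>" for s s'
  proof -
    have "(e s - e s')^2 \<le> (e s - e s')^2 + (snd (uv s) d - snd (uv s') d)^2" by simp
    also have "\<dots> \<le> ((fst (uv s) c - fst (uv s') c)^2 + (snd (uv s) c - snd (uv s') c)^2) * exp ((1 + L) * \<bar>d - c\<bar>)"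
      unfolding e_def by (rule gronwall2[OF uv(1) uv(1) _ cd'(2,3) L(1)]) (rule hlip, simp)
    also have "\<dots> = (s - s')^2 * exp ((1 + L) * \<bar>d - c\<bar>)" by (simp add: uv)
    also have "\<dots> \<le> (s - s')^2 * (exp ((1 + L) * \<bar>d - c\<bar>))^2"
      using L(1) by (intro mult_left_mono self_le_power) auto
    also have "\<dots> = (exp ((1 + L) * \<bar>d - c\<bar>) * \<bar>s - s'\<bar>)^2" by (simp add: power_mult_distrib mult.commute)
    finally have "\<bar>e s - e s'\<bar> \<le> \<bar>exp ((1 + L) * \<bar>d - c\<bar>) * \<bar>s - s'\<bar>\<bar>"
      unfolding abs_le_square_iff .
    then show ?thesis by (simp add: abs_mult)
  qed
  have conte: "continuous_on UNIV e"
    by (rule lipschitz_on_continuous_on[where L = "exp ((1 + L) * \<bar>d - c\<bar>)"])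
       (use lips in \<open>auto simp: lipschitz_on_def dist_real_def\<close>)
  have mvt: "\<exists>z\<in>{c<..<d}. \<bar>snd (uv s) z - s\<bar> \<le> Bd * (d - c) \<and> e s - \<alpha> = (d - c) * snd (uv s) z" for s
  proof -
    define u v where "u = fst (uv s)" and "v = snd (uv s)"
    have sol: "continuous_on {c..d} u" "continuous_on {c..d} v"
      "\<And>t. t \<in> {c<..<d} \<Longrightarrow> (u has_real_derivative v t) (at t)"
      "\<And>t. t \<in> {c<..<d} \<Longrightarrow> (v has_real_derivative h t (u t)) (at t)"
      using uv(1)[of s] unfolding solves2_def u_def v_def by auto
    have "\<exists>l z. c < z \<and> z < d \<and> (u has_real_derivative l) (at z) \<and> u d - u c = (d - c) * l"
      using sol(3) by (intro MVT[OF cd(1) sol(1)]) (meson greaterThanLessThan_iff real_differentiable_def)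
    then obtain l z where z: "c < z" "z < d" "(u has_real_derivative l) (at z)" "u d - u c = (d - c) * l" by blast
    have l: "l = v z" using DERIV_unique[OF z(3) sol(3)] z by auto
    have "\<exists>l' z'. c < z' \<and> z' < z \<and> (v has_real_derivative l') (at z') \<and> v z - v c = (z - c) * l'"
    proof (rule MVT[OF z(1)])
      show "continuous_on {c..z} v" by (rule continuous_on_subset[OF sol(2)]) (use z in auto)
      show "v differentiable (at x)" if "c < x" "x < z" for x
        using sol(4)[of x] that z(2) unfolding real_differentiable_def by auto
    qed
    then obtain l' z' where z': "c < z'" "z' < z" "(v has_real_derivative l') (at z')" "v z - v c = (z - c) * l'" by blast
    have l': "l' = h z' (u z')" using DERIV_unique[OF z'(3) sol(4)] z z' by auto
    have "\<bar>v z - v c\<bar> \<le> Bd * (d - c)"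
    proof -
      have "\<bar>v z - v c\<bar> = \<bar>z - c\<bar> * \<bar>l'\<bar>" by (simp add: z'(4) abs_mult)
      also have "\<dots> \<le> (d - c) * Bd" unfolding l' using hb[of z' "u z'"] z z' by (intro mult_mono) auto
      finally show ?thesis by (simp add: mult.commute)
    qed
    then show ?thesis using z l uv(2,3)[of s] unfolding e_def u_def v_def
      by (intro bexI[of _ z]) auto
  qed
  have s1: "e (Bd * (d - c)) \<ge> \<alpha>" and s2: "e (- (Bd * (d - c))) \<le> \<alpha>"
  proof -
    obtain z where "\<bar>snd (uv (Bd * (d - c))) z - Bd * (d - c)\<bar> \<le> Bd * (d - c)"
      "e (Bd * (d - c)) - \<alpha> = (d - c) * snd (uv (Bd * (d - c))) z" using mvt by blast
    moreover from this(1) have "snd (uv (Bd * (d - c))) z \<ge> 0" by linarith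
    moreover from this have "(d - c) * snd (uv (Bd * (d - c))) z \<ge> 0" using cd(1) by (intro mult_nonneg_nonneg) auto
    ultimately show "e (Bd * (d - c)) \<ge> \<alpha>" by linarith
    obtain z where "\<bar>snd (uv (- (Bd * (d - c)))) z - (- (Bd * (d - c)))\<bar> \<le> Bd * (d - c)"
      "e (- (Bd * (d - c))) - \<alpha> = (d - c) * snd (uv (- (Bd * (d - c)))) z" using mvt by blast
    moreover from this(1) have "snd (uv (- (Bd * (d - c)))) z \<le> 0" by linarith
    moreover from this have "(d - c) * snd (uv (- (Bd * (d - c)))) z \<le> 0" using cd(1) by (intro mult_nonneg_nonpos) auto
    ultimately show "e (- (Bd * (d - c))) \<le> \<alpha>" by linarith
  qed
  have "Bd \<ge> 0" using hb[OF cd'(2), of 0] by linarith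
  then have "- (Bd * (d - c)) \<le> Bd * (d - c)" using cd(1) by simp
  from IVT'[OF s2 s1 this continuous_on_subset[OF conte]] obtain s where s: "e s = \<alpha>" by auto
  define u v where "u = fst (uv s)" and "v = snd (uv s)"
  have sol: "continuous_on {c..d} u" "continuous_on {c..d} v"
    "\<And>t. t \<in> {c<..<d} \<Longrightarrow> (u has_real_derivative v t) (at t)"
    "\<And>t. t \<in> {c<..<d} \<Longrightarrow> (v has_real_derivative h t (u t)) (at t)"
    using uv(1)[of s] unfolding solves2_def u_def v_def by auto
  have bc: "u c = \<alpha>" "u d = \<alpha>" using uv(2)[of s] s by (auto simp: u_def e_def)
  have low: "\<alpha> \<le> u t" if t: "t \<in> {c..d}" for t
  proof (rule ccontr)
    assume neg: "\<not> \<alpha> \<le> u t"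
    obtain t1 where t1: "t1 \<in> {c..d}" "\<forall>s\<in>{c..d}. u t1 \<le> u s"
      using continuous_attains_inf[OF compact_Icc _ sol(1)] t by auto
    have ut1: "u t1 < \<alpha>" using t1(2) t neg by force
    then have "t1 \<noteq> c" "t1 \<noteq> d" using bc by auto
    then have t1in: "t1 \<in> {c<..<d}" using t1 by auto
    \<comment> \<open>At a minimum below \<alpha> the truncated field has the value
      \<open>f t1 \<alpha> < 0\<close>, while a minimum requires a nonnegative second
      derivative.\<close>
    have "- h t1 (u t1) \<le> 0"
    proof (rule second_derivative_at_max(2)[OF t1in, where w = "\<lambda>s. - u s" and w' = "\<lambda>s. - v s"])
      show "- u s \<le> - u t1" if "s \<in> {c<..<d}" for s using t1(2) that by auto
    qed (auto intro!: derivative_intros sol t1in)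
    moreover have "h t1 (u t1) = f t1 \<alpha>" using ut1 clamp_to(3)[OF ab(4)] by (simp add: h_def)
    ultimately show False using f\<alpha>[OF t1(1)] by simp
  qed
  have high: "u t \<le> \<beta>" if t: "t \<in> {c..d}" for t
  proof (rule ccontr)
    assume neg: "\<not> u t \<le> \<beta>"
    obtain t1 where t1: "t1 \<in> {c..d}" "\<forall>s\<in>{c..d}. u s \<le> u t1"
      using continuous_attains_sup[OF compact_Icc _ sol(1)] t by auto
    have ut1: "u t1 > \<beta>" using t1(2) t neg by force
    then have "t1 \<noteq> c" "t1 \<noteq> d" using bc ab by auto
    then have t1in: "t1 \<in> {c<..<d}" using t1 by auto
    have "h t1 (u t1) \<le> 0"
      by (rule second_derivative_at_max(2)[OF t1in _ sol(3) sol(4)[OF t1in]]) (use t1(2) in auto)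
    moreover have "h t1 (u t1) = f t1 \<beta>" using ut1 clamp_to(4)[OF ab(4)] by (simp add: h_def)
    ultimately show False using f\<beta>[OF t1(1)] by simp
  qed
  have "pos_sol c d u v" unfolding pos_sol_def
  proof (intro conjI ballI)
    show "solves2 f c d u v"
    proof (rule solves2_cong)
      show "solves2 h c d u v" using uv(1)[of s] by (simp add: u_def v_def)
      show "h t (u t) = f t (u t)" if "t \<in> {c<..<d}" for t
        using low[of t] high[of t] that clamp_to(2)[OF ab(4), of "u t"] by (simp add: h_def)
    qed
    show "u t > 0" if "t \<in> {c..d}" for t using low[OF that] ab by linarith
  qed
  then show ?thesis by blast
qed

text \<open>At an interior maximum of \<open>u \<phi>\<close>, where \<open>\<phi> t = (t - c) (d - t)\<close>, the cubic term dominates and bounds \<open>u \<phi>\<close>;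
  at an interior maximum of \<open>\<phi> / u\<close> the singular term does the same. As \<open>\<phi>\<close> vanishes at the end points,
  the boundary values do not enter.\<close>

lemma interior_bounds:
  assumes Bneg: "\<And>t. t \<in> I \<Longrightarrow> B t < 0" and Cpos: "\<And>t. t \<in> I \<Longrightarrow> C t > 0"
    and cd: "c < d" "{c..d} \<subseteq> I"
  obtains W where "W > 0"
    "\<And>u v t. pos_sol c d u v \<Longrightarrow> t \<in> {c..d} \<Longrightarrow> u t * ((t - c) * (d - t)) \<le> W"
    "\<And>u v t. pos_sol c d u v \<Longrightarrow> t \<in> {c..d} \<Longrightarrow> (t - c) * (d - t) / u t \<le> W"
proof -
  obtain N nB nC where N: "N > 0" "\<And>t. t \<in> {c..d} \<Longrightarrow> \<bar>A t\<bar> \<le> N" "\<And>t. t \<in> {c..d} \<Longrightarrow> \<bar>B t\<bar> \<le> N"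
    "\<And>t. t \<in> {c..d} \<Longrightarrow> \<bar>C t\<bar> \<le> N" and nB: "nB > 0" "\<And>t. t \<in> {c..d} \<Longrightarrow> nB \<le> - B t"
    and nC: "nC > 0" "\<And>t. t \<in> {c..d} \<Longrightarrow> nC \<le> C t"
    using sign_bounds[OF Bneg Cpos cd] by blast
  have cd': "c \<le> d" using cd by simp
  define l where "l = d - c"
  have l: "l > 0" using cd by (simp add: l_def)
  define \<phi> where "\<phi> t = (t - c) * (d - t)" for t
  have \<phi>: "0 \<le> \<phi> t" "\<phi> t \<le> l^2" "\<bar>c + d - 2 * t\<bar> \<le> l" if "t \<in> {c..d}" for t
    using that by (auto simp: \<phi>_def l_def power2_eq_square intro!: mult_mono)
  have \<phi>pos: "0 < \<phi> t" if "t \<in> {c<..<d}" for t using that by (simp add: \<phi>_def)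
  have d\<phi>: "(\<phi> has_real_derivative c + d - 2 * t) (at t)" for t
    unfolding \<phi>_def by (auto intro!: derivative_eq_intros simp: algebra_simps)
  have c\<phi>: "continuous_on {c..d} \<phi>" unfolding \<phi>_def by (intro continuous_intros)
  \<comment> \<open>\<open>Q1\<close> and \<open>Q2\<close> bound \<open>(u \<phi>)^2\<close> and
    \<open>(\<phi>/u)^4\<close> at the interior maxima treated below; they arise from the estimates
    there by inserting \<open>l^2\<close> for \<phi> and \<open>l\<close> for the size of its
    derivative.\<close>
  define Q1 where "Q1 = (2 * N * l^4 + 4 * l^2) / nC"
  define Q2 where "Q2 = (2 * N * l^8 + 2 * l^6) / nB"
  define W where "W = 1 + Q1 + Q2 + l^2"
  have Q: "Q1 > 0" "Q2 > 0" using N(1) nC(1) nB(1) l by (auto simp: Q1_def Q2_def add_pos_pos)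
  have W: "W > 0" "1 + Q1 \<le> W" "1 + Q2 \<le> W" "l^2 \<le> W" using Q zero_le_power2[of l] unfolding W_def by linarith+
  have up: "u t * \<phi> t \<le> W" if s: "pos_sol c d u v" and t: "t \<in> {c..d}" for u v t
  proof -
    have sol: "continuous_on {c..d} u"
      "\<And>t. t \<in> {c<..<d} \<Longrightarrow> (u has_real_derivative v t) (at t)"
      "\<And>t. t \<in> {c<..<d} \<Longrightarrow> (v has_real_derivative f t (u t)) (at t)"
      "\<And>t. t \<in> {c..d} \<Longrightarrow> u t > 0"
      using s unfolding pos_sol_def solves2_def by auto
    have "continuous_on {c..d} (\<lambda>t. u t * \<phi> t)" by (intro continuous_intros sol c\<phi>)
    then obtain t1 where t1: "t1 \<in> {c..d}" "\<forall>s\<in>{c..d}. u s * \<phi> s \<le> u t1 * \<phi> t1"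
      using continuous_attains_sup[OF compact_Icc, of c d "\<lambda>t. u t * \<phi> t"] cd' by auto
    have "u t1 * \<phi> t1 \<le> W"
    \<comment> \<open>For \<open>u < 1\<close> the product is at most \<open>l^2\<close> anyway. For
      \<open>u \<ge> 1\<close> the linear and singular terms are both at most \<open>N u\<close> in
      size, so that the cubic term prevails.\<close>
    proof (cases "t1 \<in> {c<..<d} \<and> u t1 \<ge> 1")
      case False
      then consider "t1 = c \<or> t1 = d" | "u t1 < 1" using t1(1) by fastforce
      then show ?thesis
      proof cases
        case 1
        then show ?thesis using W by (auto simp: \<phi>_def)
      next
        case 2
        then have "u t1 * \<phi> t1 \<le> 1 * l^2" using \<phi>[OF t1(1)] sol(4)[OF t1(1)] by (intro mult_mono) auto
        then show ?thesis using W by simp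
      qed
    next
      case True
      then have t1in: "t1 \<in> {c<..<d}" and x1: "u t1 \<ge> 1" by auto
      define x p F G where "x = u t1" and "p = v t1" and "F = \<phi> t1" and "G = c + d - 2 * t1"
      have x: "x \<ge> 1" "x > 0" using x1 by (auto simp: x_def)
      have F: "F > 0" "F \<le> l^2" using \<phi>pos[OF t1in] \<phi>(2)[OF t1(1)] by (auto simp: F_def)
      have "\<bar>G\<bar>^2 \<le> l^2" using \<phi>(3)[OF t1(1)] by (intro power_mono) (auto simp: G_def)
      then have G: "G^2 \<le> l^2" by simp
      have c1: "v t1 * \<phi> t1 + u t1 * (c + d - 2 * t1) = 0"
        and c2: "f t1 (u t1) * \<phi> t1 + v t1 * (c + d - 2 * t1) + (v t1 * (c + d - 2 * t1) + u t1 * (- 2)) \<le> 0"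
      proof -
        have d1: "((\<lambda>t. u t * \<phi> t) has_real_derivative v t * \<phi> t + u t * (c + d - 2 * t)) (at t)" if "t \<in> {c<..<d}" for t
          by (rule DERIV_cong[OF DERIV_mult[OF sol(2)[OF that] d\<phi>]]) (simp add: algebra_simps)
        have d2: "((\<lambda>t. v t * \<phi> t + u t * (c + d - 2 * t)) has_real_derivative
            f t1 (u t1) * \<phi> t1 + v t1 * (c + d - 2 * t1) + (v t1 * (c + d - 2 * t1) + u t1 * (- 2))) (at t1)"
          by (auto intro!: derivative_eq_intros sol(2,3)[OF t1in] d\<phi>)
        have mx: "u s * \<phi> s \<le> u t1 * \<phi> t1" if "s \<in> {c<..<d}" for s using t1(2) that by auto
        show "v t1 * \<phi> t1 + u t1 * (c + d - 2 * t1) = 0"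
          using second_derivative_at_max(1)[OF t1in mx d1 d2] .
        show "f t1 (u t1) * \<phi> t1 + v t1 * (c + d - 2 * t1) + (v t1 * (c + d - 2 * t1) + u t1 * (- 2)) \<le> 0"
          using second_derivative_at_max(2)[OF t1in mx d1 d2] .
      qed
      define fx where "fx = f t1 x"
      have e1: "p * F = - (x * G)" using c1 by (simp add: x_def p_def F_def G_def)
      have "fx * F + 2 * (p * G) - 2 * x \<le> 0" using c2 by (simp add: x_def p_def F_def G_def fx_def algebra_simps)
      \<comment> \<open>Multiplication by \<open>F\<close> lets the first-order condition
        \<open>e1\<close> eliminate the velocity \<open>p\<close>.\<close>
      then have "(fx * F + 2 * (p * G) - 2 * x) * F \<le> 0" using F by (simp add: mult_nonpos_nonneg)
      also have "(fx * F + 2 * (p * G) - 2 * x) * F = fx * F^2 + 2 * (p * F) * G - 2 * x * F" by (simp add: algebra_simps power2_eq_square)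
      finally have e2: "fx * F^2 \<le> 2 * x * G^2 + 2 * x * F" unfolding e1 by (simp add: power2_eq_square algebra_simps)
      have "nC * x^3 - 2 * N * x \<le> fx"
      proof -
        have "- N \<le> A t1" using N(2)[OF t1(1)] by linarith
        from mult_right_mono[OF this, of x] have a: "A t1 * x \<ge> - (N * x)" using x by simp
        have "1 / x^3 \<le> 1" using x by simp
        then have "1 / x^3 \<le> x" using x by linarith
        then have "\<bar>B t1\<bar> * (1 / x^3) \<le> N * x" using N(1,3) t1(1) x by (intro mult_mono) auto
        then have "\<bar>B t1 / x^3\<bar> \<le> N * x" using x by (simp add: abs_divide)
        moreover have "nC * x^3 \<le> C t1 * x^3" using nC(2)[OF t1(1)] x by (intro mult_right_mono) auto
        ultimately show ?thesis using a unfolding fx_def f_def by linarith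
      qed
      then have "(nC * x^3 - 2 * N * x) * F^2 \<le> fx * F^2" by (rule mult_right_mono) simp
      then have "(nC * x^3 - 2 * N * x) * F^2 \<le> 2 * x * G^2 + 2 * x * F" using e2 by linarith
      then have "x * (nC * (x * F)^2) \<le> x * (2 * N * F^2 + 2 * G^2 + 2 * F)" by (simp add: algebra_simps power2_eq_square power3_eq_cube)
      then have "nC * (x * F)^2 \<le> 2 * N * F^2 + 2 * G^2 + 2 * F" using x by simp
      also have "\<dots> \<le> 2 * N * (l^2)^2 + 2 * l^2 + 2 * l^2"
        using power_mono[OF F(2), of 2] F G N(1) by (intro add_mono mult_left_mono) auto
      also have "\<dots> = nC * Q1" using nC(1) by (simp add: Q1_def)
      finally have "(x * F)^2 \<le> Q1" using nC(1) by simp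
      moreover have "2 * (x * F) \<le> (x * F)^2 + 1" using zero_le_power2[of "x * F - 1"] by (simp add: power2_diff)
      moreover have "x * F > 0" using x F by simp
      ultimately have "x * F \<le> 1 + Q1" using Q by linarith
      then show ?thesis using W by (simp add: x_def F_def)
    qed
    then show ?thesis using t1(2) t by fastforce
  qed
  have low: "\<phi> t / u t \<le> W" if s: "pos_sol c d u v" and t: "t \<in> {c..d}" for u v t
  proof -
    have sol: "continuous_on {c..d} u"
      "\<And>t. t \<in> {c<..<d} \<Longrightarrow> (u has_real_derivative v t) (at t)"
      "\<And>t. t \<in> {c<..<d} \<Longrightarrow> (v has_real_derivative f t (u t)) (at t)"
      "\<And>t. t \<in> {c..d} \<Longrightarrow> u t > 0"
      using s unfolding pos_sol_def solves2_def by auto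
    have "continuous_on {c..d} (\<lambda>t. \<phi> t / u t)" using sol(4) by (intro continuous_intros sol c\<phi>) force
    then obtain t1 where t1: "t1 \<in> {c..d}" "\<forall>s\<in>{c..d}. \<phi> s / u s \<le> \<phi> t1 / u t1"
      using continuous_attains_sup[OF compact_Icc, of c d "\<lambda>t. \<phi> t / u t"] cd' by auto
    have "\<phi> t1 / u t1 \<le> W"
    proof (cases "t1 \<in> {c<..<d} \<and> u t1 \<le> 1")
      case False
      then consider "t1 = c \<or> t1 = d" | "u t1 > 1" using t1(1) by fastforce
      then show ?thesis
      proof cases
        case 1
        then show ?thesis using W by (auto simp: \<phi>_def)
      next
        case 2
        then have "\<phi> t1 / u t1 \<le> l^2 / 1" using \<phi>[OF t1(1)] by (intro frac_le) auto
        then show ?thesis using W by simp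
      qed
    next
      case True
      then have t1in: "t1 \<in> {c<..<d}" and x1: "u t1 \<le> 1" by auto
      define x F where "x = u t1" and "F = \<phi> t1"
      have x: "x \<le> 1" "x > 0" using x1 sol(4)[OF t1(1)] by (auto simp: x_def)
      have F: "F > 0" "F \<le> l^2" using \<phi>pos[OF t1in] \<phi>(2)[OF t1(1)] by (auto simp: F_def)
      define fx where "fx = f t1 x"
      define w' where "w' t = ((c + d - 2 * t) * u t - \<phi> t * v t) / (u t)^2" for t
      have d1: "((\<lambda>t. \<phi> t / u t) has_real_derivative w' t) (at t)" if "t \<in> {c<..<d}" for t
        using sol(4)[of t] that unfolding w'_def power2_eq_square
        by (intro DERIV_divide[OF d\<phi> sol(2)[OF that]]) auto
      \<comment> \<open>At a critical point of the quotient \<open>num\<close> vanishes, so the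
        second derivative of the quotient has the sign of the derivative of
        \<open>num\<close>.\<close>
      define num where "num t = (c + d - 2 * t) * u t - \<phi> t * v t" for t
      have dn: "(num has_real_derivative - 2 * x - F * fx) (at t1)"
        unfolding num_def x_def F_def fx_def
        by (auto intro!: derivative_eq_intros sol(2,3)[OF t1in] d\<phi> simp: algebra_simps)
      have mx: "\<phi> s / u s \<le> \<phi> t1 / u t1" if "s \<in> {c<..<d}" for s using t1(2) that by auto
      have dp: "((\<lambda>t. (u t)^2) has_real_derivative 2 * u t1 * v t1) (at t1)"
        by (auto intro!: derivative_eq_intros sol(2)[OF t1in])
      have d2: "(w' has_real_derivative ((- 2 * x - F * fx) * (u t1)^2 - num t1 * (2 * u t1 * v t1)) / ((u t1)^2 * (u t1)^2)) (at t1)"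
        unfolding w'_def[abs_def] num_def[symmetric]
        using sol(4)[OF t1(1)] by (intro DERIV_divide[OF dn dp]) auto
      have "num t1 = 0"
        using second_derivative_at_max(1)[OF t1in mx d1 d2] sol(4)[OF t1(1)] by (simp add: w'_def num_def)
      then have "((- 2 * x - F * fx) * x^2) / (x^2 * x^2) \<le> 0"
        using second_derivative_at_max(2)[OF t1in mx d1 d2] by (simp add: x_def)
      then have e1: "- (2 * x) \<le> F * fx" using x by (simp add: divide_le_0_iff mult_le_0_iff)
      have "fx \<le> 2 * N * x - nB / x^3"
      proof -
        have "A t1 * x \<le> N * x" using N(2)[OF t1(1)] x by (intro mult_right_mono) auto
        moreover have "B t1 / x^3 \<le> (- nB) / x^3" using nB(2)[OF t1(1)] x by (intro divide_right_mono) auto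
        moreover have "C t1 * x^3 \<le> N * x"
          using N(1) N(4)[OF t1(1)] x power_decreasing[of 1 3 x] by (intro mult_mono) auto
        ultimately show ?thesis unfolding fx_def f_def by simp
      qed
      then have "F * fx \<le> F * (2 * N * x - nB / x^3)" using F by (intro mult_left_mono) auto
      then have "- (2 * x) \<le> F * (2 * N * x - nB / x^3)" using e1 by linarith
      then have "- (2 * x) * x^3 \<le> F * (2 * N * x - nB / x^3) * x^3" using x by (intro mult_right_mono) auto
      also have "F * (2 * N * x - nB / x^3) * x^3 = F * (2 * N * x^4 - nB)" using x by (simp add: field_simps eval_nat_numeral)
      finally have "nB * F \<le> (2 * N * F + 2) * x^4" by (simp add: algebra_simps eval_nat_numeral)
      \<comment> \<open>The factor \<open>F^3\<close> produces the fourth power of \<open>F\<close>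
        against that of \<open>x\<close>, so that the quotient \<open>F/x\<close> can be
        bounded.\<close>
      then have "nB * F * F^3 \<le> (2 * N * F + 2) * x^4 * F^3" using F by (intro mult_right_mono) auto
      then have "nB * F^4 \<le> (2 * N * F^4 + 2 * F^3) * x^4" by (simp add: algebra_simps eval_nat_numeral)
      also have "\<dots> \<le> (2 * N * (l^2)^4 + 2 * (l^2)^3) * x^4"
        using F N(1) by (intro mult_right_mono add_mono mult_left_mono power_mono) auto
      also have "\<dots> = nB * (Q2 * x^4)" using nB(1) by (simp add: Q2_def power_mult[symmetric])
      finally have "F^4 \<le> Q2 * x^4" using nB(1) by simp
      then have "(F / x)^4 \<le> Q2" using x by (simp add: power_divide field_simps)
      moreover have "F / x \<le> 1 + (F / x)^4"
      proof (cases "F / x \<le> 1")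
        case True
        moreover have "0 \<le> (F / x)^4" using F x by (intro zero_le_power) simp
        ultimately show ?thesis by linarith
      next
        case False
        then show ?thesis using self_le_power[of "F / x" 4] by linarith
      qed
      ultimately show ?thesis using W by (simp add: x_def F_def)
    qed
    then show ?thesis using t1(2) t by fastforce
  qed
  show ?thesis by (rule that[OF W(1)]) (use up low in \<open>auto simp: \<phi>_def\<close>)
qed

section \<open>A global solution by compactness\<close>

definition initial_data :: "real \<Rightarrow> real \<Rightarrow> real \<Rightarrow> (real \<times> real) set" where
  "initial_data y0 c d = {z. \<exists>u v. pos_sol c d u v \<and> u y0 = fst z \<and> v y0 = snd z}"

text \<open>By restriction, enlarging the interval shrinks the set of admissible data; the data of a
  global solution are to be found as a common point of all these sets.\<close>

lemma initial_data_antimono: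
  "c \<le> c' \<Longrightarrow> d' \<le> d \<Longrightarrow> initial_data y0 c d \<subseteq> initial_data y0 c' d'"
  unfolding initial_data_def using pos_sol_subset by blast

text \<open>On \<open>{c..d}\<close> the weight \<open>(t - c2) (d2 - t)\<close> is bounded below by
  \<open>e > 0\<close>, which converts the weighted bounds into bounds common to all positive
  solutions.\<close>

lemma uniform_bounds:
  assumes Bneg: "\<And>t. t \<in> I \<Longrightarrow> B t < 0" and Cpos: "\<And>t. t \<in> I \<Longrightarrow> C t > 0"
    and cd: "c2 < c" "c \<le> d" "d < d2" "{c2..d2} \<subseteq> I"
  obtains m M where "0 < m" "m \<le> M" "\<And>u v t. pos_sol c2 d2 u v \<Longrightarrow> t \<in> {c..d} \<Longrightarrow> u t \<in> {m..M}"
proof -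
  have "c2 < d2" using cd by simp
  obtain W where W: "W > 0"
    "\<And>u v t. pos_sol c2 d2 u v \<Longrightarrow> t \<in> {c2..d2} \<Longrightarrow> u t * ((t - c2) * (d2 - t)) \<le> W"
    "\<And>u v t. pos_sol c2 d2 u v \<Longrightarrow> t \<in> {c2..d2} \<Longrightarrow> (t - c2) * (d2 - t) / u t \<le> W"
    using interior_bounds[OF Bneg Cpos \<open>c2 < d2\<close> cd(4)] by blast
  define e where "e = (c - c2) * (d2 - d)"
  have e: "e > 0" using cd by (simp add: e_def)
  show ?thesis
  proof
    show "0 < e / W" "e / W \<le> max (e / W) (W / e)" using e W by auto
    fix u v t assume s: "pos_sol c2 d2 u v" and t: "t \<in> {c..d}"
    have t2: "t \<in> {c2..d2}" using t cd by auto
    have u: "u t > 0" using s t2 by (simp add: pos_sol_def)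
    have le: "e \<le> (t - c2) * (d2 - t)" unfolding e_def using t cd by (intro mult_mono) auto
    have "u t * e \<le> W" using W(2)[OF s t2] mult_left_mono[OF le, of "u t"] u by linarith
    then have 1: "u t \<le> W / e" using e by (simp add: field_simps)
    have "e / u t \<le> W" using W(3)[OF s t2] divide_right_mono[OF le, of "u t"] u by linarith
    then have 2: "e / W \<le> u t" using u W(1) by (simp add: field_simps)
    show "u t \<in> {e / W..max (e / W) (W / e)}" using 1 2 by auto
  qed
qed

text \<open>A limit of admissible data might lose admissibility near the ends. Over the smaller
  interval, however, all approximating solutions stay in a common range \<open>{m..M}\<close>, and
  continuous dependence for the equation truncated to this range passes it on to the limit.\<close>

lemma closure_initial_data:
  assumes Bneg: "\<And>t. t \<in> I \<Longrightarrow> B t < 0" and Cpos: "\<And>t. t \<in> I \<Longrightarrow> C t > 0"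
    and cd: "c2 < c" "c < y0" "y0 < d" "d < d2" "{c2..d2} \<subseteq> I"
  shows "closure (initial_data y0 c2 d2) \<subseteq> initial_data y0 c d"
proof
  fix z assume z: "z \<in> closure (initial_data y0 c2 d2)"
  have cd': "c \<le> d" "{c..d} \<subseteq> {c2..d2}" "{c..d} \<subseteq> I" "y0 \<in> {c..d}" using cd by auto
  obtain m M where mM: "0 < m" "m \<le> M" "\<And>u v t. pos_sol c2 d2 u v \<Longrightarrow> t \<in> {c..d} \<Longrightarrow> u t \<in> {m..M}"
    using uniform_bounds[OF Bneg Cpos cd(1) cd'(1) cd(4,5)] by blast
  obtain L where L: "L \<ge> 0"
    "\<And>t u v. t \<in> {c..d} \<Longrightarrow> u \<in> {m..M} \<Longrightarrow> v \<in> {m..M} \<Longrightarrow> \<bar>f t u - f t v\<bar> \<le> L * \<bar>u - v\<bar>"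
    by (rule f_lipschitz[OF cd'(3) mM(1), where M = M]) (rule that)
  obtain u v where uv: "solves2 (\<lambda>t u. f t (clamp_to m M u)) c d u v" "u y0 = fst z" "v y0 = snd z"
    using trunc_exists[OF cd'(1,3) mM(1,2), of y0 "fst z" "snd z"] by blast
  have inside: "u t \<in> {m..M}" if t: "t \<in> {c..d}" for t
  proof (rule ccontr)
    assume neg: "u t \<notin> {m..M}"
    \<comment> \<open>If the limit left the range by \<delta>, a solution with data within
      \<open>\<delta>/k\<close> would be closer to it than \<delta> at time \<open>t\<close>, yet
      inside the range.\<close>
    define \<delta> where "\<delta> = \<bar>u t - clamp_to m M (u t)\<bar>"
    have \<delta>: "\<delta> > 0" using neg clamp_to(1)[OF mM(2), of "u t"] by (auto simp: \<delta>_def)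
    define k where "k = exp ((1 + L) * \<bar>t - y0\<bar>)"
    have k: "k \<ge> 1" using L(1) by (simp add: k_def)
    have "\<delta> / k > 0" using \<delta> k by simp
    then obtain z' where z': "z' \<in> initial_data y0 c2 d2" "dist z' z < \<delta> / k"
      using z unfolding closure_approachable by blast
    obtain u' v' where u': "pos_sol c2 d2 u' v'" "u' y0 = fst z'" "v' y0 = snd z'"
      using z'(1) unfolding initial_data_def by blast
    have u'cd: "solves2 f c d u' v'" using u'(1) cd solves2_subset[of f c2 d2 u' v' c d] by (auto simp: pos_sol_def)
    have "(u' t - u t)^2 + (v' t - v t)^2 \<le> ((u' y0 - u y0)^2 + (v' y0 - v y0)^2) * exp ((1 + L) * \<bar>t - y0\<bar>)"
    proof (rule gronwall2[OF u'cd uv(1) _ cd'(4) t L(1)])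
      fix s assume s: "s \<in> {c<..<d}"
      then have us: "u' s \<in> {m..M}" by (intro mM(3)[OF u'(1)]) auto
      have "\<bar>f s (clamp_to m M (u' s)) - f s (clamp_to m M (u s))\<bar> \<le> L * \<bar>clamp_to m M (u' s) - clamp_to m M (u s)\<bar>"
        by (intro L(2) clamp_to(1)[OF mM(2)]) (use s in auto)
      also have "\<dots> \<le> L * \<bar>u' s - u s\<bar>" by (intro mult_left_mono clamp_to(5)[OF mM(2)] L(1))
      finally show "\<bar>f s (u' s) - f s (clamp_to m M (u s))\<bar> \<le> L * \<bar>u' s - u s\<bar>"
        by (simp only: clamp_to(2)[OF mM(2) us])
    qed
    also have "(u' y0 - u y0)^2 + (v' y0 - v y0)^2 = (dist z' z)^2"
      by (simp add: u' uv dist_prod_def dist_real_def)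
    also have "(dist z' z)^2 * exp ((1 + L) * \<bar>t - y0\<bar>) \<le> (dist z' z)^2 * k^2"
      unfolding k_def[symmetric] using k by (intro mult_left_mono self_le_power) auto
    also have "\<dots> = (dist z' z * k)^2" by (simp add: power_mult_distrib)
    also have "\<dots> < \<delta>^2"
      using z'(2) k by (intro power_strict_mono) (auto simp: field_simps)
    finally have "(u' t - u t)^2 < \<delta>^2" using zero_le_power2[of "v' t - v t"] by linarith
    then have "\<bar>u' t - u t\<bar> < \<delta>" using \<delta> power_less_imp_less_base[of "\<bar>u' t - u t\<bar>" 2 \<delta>] by simp
    moreover have "u' t \<in> {m..M}" by (rule mM(3)[OF u'(1) t])
    ultimately show False using neg unfolding \<delta>_def clamp_to_def by (auto simp: max_def min_def split: if_splits)
  qed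
  have "pos_sol c d u v" unfolding pos_sol_def
  proof (intro conjI ballI)
    show "solves2 f c d u v"
      by (rule solves2_cong[OF uv(1)]) (use inside clamp_to(2)[OF mM(2)] in force)
    show "u t > 0" if "t \<in> {c..d}" for t using inside[OF that] mM(1) by auto
  qed
  then show "z \<in> initial_data y0 c d" using uv by (auto simp: initial_data_def)
qed

text \<open>The values are bounded by \<open>uniform_bounds\<close>. For the velocities, the mean
  value theorem finds a time after \<open>y0\<close> where the velocity is a difference quotient of
  bounded values, and the bounded second derivative carries this back to \<open>y0\<close>.\<close>

lemma bounded_initial_data:
  assumes Bneg: "\<And>t. t \<in> I \<Longrightarrow> B t < 0" and Cpos: "\<And>t. t \<in> I \<Longrightarrow> C t > 0"
    and cd: "c2 < y0" "y0 < d2" "{c2..d2} \<subseteq> I"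
  shows "bounded (initial_data y0 c2 d2)"
proof -
  define d where "d = (y0 + d2) / 2"
  have d: "y0 < d" "d < d2" using cd by (auto simp: d_def)
  have sub: "{y0..d} \<subseteq> {c2..d2}" "{y0..d} \<subseteq> I" using d cd by auto
  obtain m M where mM: "0 < m" "m \<le> M" "\<And>u v t. pos_sol c2 d2 u v \<Longrightarrow> t \<in> {y0..d} \<Longrightarrow> u t \<in> {m..M}"
    using uniform_bounds[OF Bneg Cpos cd(1) _ d(2) cd(3)] d by (metis less_imp_le)
  obtain Bd where hb: "\<And>t x. t \<in> {y0..d} \<Longrightarrow> x \<in> {m..M} \<Longrightarrow> \<bar>f t x\<bar> \<le> Bd"
    using f_bounded[OF sub(2) mM(1)] by blast
  have "norm z \<le> M + (M / (d - y0) + (d - y0) * Bd)" if z: "z \<in> initial_data y0 c2 d2" for z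
  proof -
    obtain u v where uv: "pos_sol c2 d2 u v" "u y0 = fst z" "v y0 = snd z"
      using z unfolding initial_data_def by blast
    have sol: "continuous_on {c2..d2} u" "continuous_on {c2..d2} v"
      "\<And>t. t \<in> {c2<..<d2} \<Longrightarrow> (u has_real_derivative v t) (at t)"
      "\<And>t. t \<in> {c2<..<d2} \<Longrightarrow> (v has_real_derivative f t (u t)) (at t)"
      using uv(1) unfolding pos_sol_def solves2_def by auto
    have "\<exists>x. y0 < x \<and> x < d \<and> u d - u y0 = (d - y0) * v x"
      by (rule MVT2[OF d(1) sol(3)]) (use d cd in auto)
    then obtain x where x: "y0 < x" "x < d" "u d - u y0 = (d - y0) * v x" by blast
    have "\<exists>t. y0 < t \<and> t < x \<and> v x - v y0 = (x - y0) * f t (u t)"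
      by (rule MVT2[OF x(1) sol(4)]) (use x d cd in auto)
    then obtain t where t: "y0 < t" "t < x" "v x - v y0 = (x - y0) * f t (u t)" by blast
    have ud: "u d \<in> {m..M}" "u y0 \<in> {m..M}" "u t \<in> {m..M}"
      by (rule mM(3)[OF uv(1)], use d x t in simp)+
    have "\<bar>u d - u y0\<bar> \<le> M" using ud mM(1) by auto
    then have "\<bar>v x\<bar> * (d - y0) \<le> M" unfolding x(3) using d by (simp add: abs_mult mult.commute)
    then have vx: "\<bar>v x\<bar> \<le> M / (d - y0)" using d by (simp add: field_simps)
    have "\<bar>v x - v y0\<bar> = \<bar>x - y0\<bar> * \<bar>f t (u t)\<bar>" by (simp add: t(3) abs_mult)
    also have "\<dots> \<le> (d - y0) * Bd" using hb[of t "u t"] ud x t by (intro mult_mono) auto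
    finally have "\<bar>v y0\<bar> \<le> M / (d - y0) + (d - y0) * Bd" using vx by linarith
    moreover have "\<bar>u y0\<bar> \<le> M" using ud mM(1) by auto
    moreover have "norm z \<le> \<bar>fst z\<bar> + \<bar>snd z\<bar>" unfolding norm_prod_def by (simp add: sqrt_sum_squares_le_sum_abs)
    ultimately show ?thesis using uv by linarith
  qed
  then show ?thesis unfolding bounded_iff by blast
qed

lemma solution_by_compactness:
  assumes Bneg: "\<And>t. t \<in> I \<Longrightarrow> B t < 0" and Cpos: "\<And>t. t \<in> I \<Longrightarrow> C t > 0"
    and I: "open I" "is_interval I" and y0: "y0 \<in> I"
  obtains u0 v0 where "\<And>c d. c < y0 \<Longrightarrow> y0 < d \<Longrightarrow> {c..d} \<subseteq> I \<Longrightarrow> \<exists>u v. pos_sol c d u v \<and> u y0 = u0 \<and> v y0 = v0"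
proof -
  define P where "P = {p. fst p < y0 \<and> y0 < snd p \<and> fst p \<in> I \<and> snd p \<in> I}"
  define T where "T p = closure (initial_data y0 (fst p) (snd p))" for p
  have subI: "{c..d} \<subseteq> I" if "c \<in> I" "d \<in> I" for c d
    using that by (meson atLeastAtMost_iff I(2) mem_is_interval_1_I subsetI)
  \<comment> \<open>Finite intersections are non-empty: a positive solution over the hull of
    finitely many of the intervals restricts to all of them.\<close>
  have "\<Inter> (T ` P) \<noteq> {}"
  proof (rule compact_fip_Heine_Borel)
    fix S assume "S \<in> T ` P"
    then obtain p where "p \<in> P" "S = T p" by blast
    then show "compact S" unfolding T_def P_def
      using bounded_initial_data[OF Bneg Cpos _ _ subI] by (simp add: compact_closure)
  next
    fix \<F> assume F: "finite \<F>" "\<F> \<subseteq> T ` P"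
    then obtain Q where Q: "finite Q" "Q \<subseteq> P" "\<F> = T ` Q" by (meson finite_subset_image)
    show "\<Inter> \<F> \<noteq> {}"
    proof (cases "Q = {}")
      case False
      define c where "c = Min (fst ` Q)"
      define d where "d = Max (snd ` Q)"
      have "c \<in> fst ` Q" "d \<in> snd ` Q" unfolding c_def d_def using Q False by (auto intro!: Min_in Max_in)
      then have cd: "c < y0" "y0 < d" "c \<in> I" "d \<in> I" using Q(2) by (auto simp: P_def)
      have "c < d" using cd by simp
      from two_point_bvp[OF Bneg Cpos this subI[OF cd(3,4)]] obtain u v where uv: "pos_sol c d u v" by blast
      have "(u y0, v y0) \<in> T q" if q: "q \<in> Q" for q
      proof -
        have "c \<le> fst q" "snd q \<le> d" unfolding c_def d_def using Q q by auto
        then have "initial_data y0 c d \<subseteq> initial_data y0 (fst q) (snd q)" by (rule initial_data_antimono)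
        moreover have "(u y0, v y0) \<in> initial_data y0 c d" using uv by (auto simp: initial_data_def)
        ultimately show ?thesis unfolding T_def using closure_subset by blast
      qed
      then show ?thesis using Q(3) by blast
    qed (use Q in simp)
  qed
  then obtain z where z: "\<And>p. p \<in> P \<Longrightarrow> z \<in> T p" by blast
  show ?thesis
  proof
    fix c d assume cd: "c < y0" "y0 < d" "{c..d} \<subseteq> I"
    then have "c \<in> I" "d \<in> I" by auto
    then obtain e1 e2 where e1: "e1 > 0" "cball c e1 \<subseteq> I" and e2: "e2 > 0" "cball d e2 \<subseteq> I"
      using I(1) unfolding open_contains_cball by blast
    \<comment> \<open>An interval slightly larger than \<open>{c..d}\<close> still fits into
      \<open>I\<close>; the common point lies in the closure of its data set and hence is admissible
      over \<open>{c..d}\<close>.\<close>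
    have mem: "c - e1 \<in> I" "d + e2 \<in> I"
      using e1(1) e2(1) by (auto intro: subsetD[OF e1(2)] subsetD[OF e2(2)] simp: dist_real_def)
    then have "(c - e1, d + e2) \<in> P" using cd e1 e2 by (auto simp: P_def)
    then have "z \<in> closure (initial_data y0 (c - e1) (d + e2))" using z[of "(c - e1, d + e2)"] by (simp add: T_def)
    moreover have "closure (initial_data y0 (c - e1) (d + e2)) \<subseteq> initial_data y0 c d"
      by (rule closure_initial_data[OF Bneg Cpos _ cd(1,2) _ subI[OF mem]]) (use e1 e2 in auto)
    ultimately show "\<exists>u v. pos_sol c d u v \<and> u y0 = fst z \<and> v y0 = snd z" by (auto simp: initial_data_def)
  qed
qed

end

section \<open>Global solutions of either sign\<close>

lemma positive_solution_exists:
  fixes A g g' :: "real \<Rightarrow> real" and \<Lambda> :: real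
  assumes I: "open I" "is_interval I" and A: "continuous_on I A"
    and g: "\<And>t. t \<in> I \<Longrightarrow> (g has_real_derivative g' t) (at t)" "\<And>t. t \<in> I \<Longrightarrow> g t > 0" "continuous_on I g'"
  shows "\<exists>N u v. N \<noteq> 0 \<and> (\<forall>t\<in>I. u t > 0 \<and> (u has_real_derivative v t) (at t) \<and>
    (v has_real_derivative A t * u t + g t * (N / u t ^ 3 + \<Lambda> / 3 * u t ^ 3)) (at t))"
proof (cases "I = {}")
  case True
  then show ?thesis by (intro exI[of _ 1]) simp
next
  case False
  then obtain y0 where y0: "y0 \<in> I" by blast
  have cg: "continuous_on I g"
    using g(1) by (meson DERIV_isCont continuous_at_imp_continuous_on)
  define N :: real where "N = (if \<Lambda> > 0 then -1 else 1)"
  interpret ode_field I A "\<lambda>t. N * g t" "\<lambda>t. \<Lambda> / 3 * g t"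
    by unfold_locales (intro A continuous_intros cg)+
  have "\<exists>u0 v0. \<forall>c d. c < y0 \<longrightarrow> y0 < d \<longrightarrow> {c..d} \<subseteq> I \<longrightarrow> (\<exists>u v. pos_sol c d u v \<and> u y0 = u0 \<and> v y0 = v0)"
  proof (cases "\<Lambda> > 0")
    case True
    then have "N * g t < 0" "\<Lambda> / 3 * g t > 0" if "t \<in> I" for t using g(2)[OF that] by (auto simp: N_def)
    then obtain u0 v0 where "\<And>c d. c < y0 \<Longrightarrow> y0 < d \<Longrightarrow> {c..d} \<subseteq> I \<Longrightarrow> \<exists>u v. pos_sol c d u v \<and> u y0 = u0 \<and> v y0 = v0"
      using solution_by_compactness[OF _ _ I y0] by blast
    then show ?thesis by blast
  next
    case False
    then have "N * g t = 1 * g t" "\<Lambda> / 3 * g t = - (- \<Lambda> / 3) * g t" "(0::real) < 1" "0 \<le> - \<Lambda> / 3" for t by (auto simp: N_def)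
    from solution_by_energy[OF g this] show ?thesis by blast
  qed
  then obtain u0 v0 where "\<And>c d. c < y0 \<Longrightarrow> y0 < d \<Longrightarrow> {c..d} \<subseteq> I \<Longrightarrow> \<exists>u v. pos_sol c d u v \<and> u y0 = u0 \<and> v y0 = v0"
    by blast
  from pos_sol_patch[OF I y0 this] obtain u v where
    uv: "\<And>t. t \<in> I \<Longrightarrow> u t > 0 \<and> (u has_real_derivative v t) (at t) \<and> (v has_real_derivative f t (u t)) (at t)" by blast
  have "f = (\<lambda>t x. A t * x + g t * (N / x ^ 3 + \<Lambda> / 3 * x ^ 3))"
    by (intro ext) (simp only: f_def, simp add: algebra_simps)
  note uv[unfolded this]
  moreover have "N \<noteq> 0" by (simp add: N_def)
  ultimately show ?thesis by blast
qed

text \<open>Bootstrap: the right-hand side is as often differentiable as \<open>u\<close>, so the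
  equation raises the order of \<open>v\<close>, while \<open>u' = v\<close> raises that of
  \<open>u\<close>.\<close>

lemma positive_solution_smooth:
  assumes I: "open I" and A: "smooth_on I A" and g: "smooth_on I g"
    and sol: "\<And>t. t \<in> I \<Longrightarrow> u t > 0" "\<And>t. t \<in> I \<Longrightarrow> (u has_real_derivative v t) (at t)"
      "\<And>t. t \<in> I \<Longrightarrow> (v has_real_derivative A t * u t + g t * (N / u t ^ 3 + l * u t ^ 3)) (at t)"
  shows "smooth_on I u" "smooth_on I v"
proof -
  note mult = cdiff_on_bilinear[OF I bounded_bilinear_mult] and add = cdiff_on_add[OF I]
  have "cdiff_on k I u \<and> cdiff_on k I v" for k
  proof (induction k)
    case 0
    show ?case unfolding cdiff_on.simps using sol
      by (meson DERIV_isCont continuous_at_imp_continuous_on)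
  next
    case (Suc k)
    then have u: "cdiff_on k I u" and v: "cdiff_on k I v" by auto
    have o: "open (- {0::real})" by (simp add: open_Compl)
    have "cdiff_on k (- {0::real}) (inverse :: real \<Rightarrow> real)" using smooth_on_inverse_real by (simp add: smooth_on_def)
    moreover have "u ` I \<subseteq> - {0}" using sol(1) by force
    ultimately have iu: "cdiff_on k I (\<lambda>t. inverse (u t))" using cdiff_on_compose_real[OF I o _ u] by blast
    have "cdiff_on k I A" "cdiff_on k I g" using A g by (auto simp: smooth_on_def)
    then have "cdiff_on k I (\<lambda>t. A t * u t + g t * (N * (inverse (u t) * (inverse (u t) * inverse (u t))) + l * (u t * (u t * u t))))"
      by (intro add mult u iu cdiff_on_const)
    also have "(\<lambda>t. A t * u t + g t * (N * (inverse (u t) * (inverse (u t) * inverse (u t))) + l * (u t * (u t * u t))))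
      = (\<lambda>t. A t * u t + g t * (N / u t ^ 3 + l * u t ^ 3))"
      by (simp add: fun_eq_iff power3_eq_cube divide_inverse)
    finally have rhs: "cdiff_on k I (\<lambda>t. A t * u t + g t * (N / u t ^ 3 + l * u t ^ 3))" .
    have "cdiff_on (Suc k) I v" by (rule cdiff_on_of_field_derivative[OF I _ rhs]) (rule sol(3))
    moreover have "cdiff_on (Suc k) I u" by (rule cdiff_on_of_field_derivative[OF I _ v]) (rule sol(2))
    ultimately show ?case by blast
  qed
  then show "smooth_on I u" "smooth_on I v" by (auto simp: smooth_on_def)
qed

lemma nonzero_on_interval_sign:
  fixes h :: "real \<Rightarrow> real"
  assumes "is_interval I" "continuous_on I h" "\<And>t. t \<in> I \<Longrightarrow> h t \<noteq> 0"
  obtains \<epsilon> where "\<epsilon> = 1 \<or> \<epsilon> = -1" "\<And>t. t \<in> I \<Longrightarrow> \<epsilon> * h t > 0"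
proof -
  have int: "is_interval (h ` I)"
    using connected_continuous_image[OF assms(2)] assms(1) is_interval_connected_1 by blast
  have "(\<forall>t\<in>I. h t > 0) \<or> (\<forall>t\<in>I. h t < 0)"
  proof (rule ccontr)
    assume "\<not> ((\<forall>t\<in>I. h t > 0) \<or> (\<forall>t\<in>I. h t < 0))"
    then obtain s t where "s \<in> I" "t \<in> I" "h s \<le> 0" "0 \<le> h t" by force
    with mem_is_interval_1_I[OF int] have "0 \<in> h ` I" by blast
    then show False using assms(3) by auto
  qed
  then show ?thesis using that[of 1] that[of "-1"] by auto
qed

theorem theorem1p2:
  fixes F :: "real \<Rightarrow> real" and I :: "real set" and \<Lambda> :: real
  assumes "open I" and "is_interval I" and "smooth_on I F"
    and "strictly_pseudoconvex (tube_dom I) (tube_D F) (tube_J F)"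
  shows "\<exists>\<mu> lam P r W H g.
    is_lift (tube_dom I) (tube_D F) (tube_J F) \<mu> lam P r W H g \<and>
    petrov_II_or_D (total_space (tube_dom I)) g (lift_coframe \<mu> lam P r W H) \<and>
    (\<exists>\<Phi>. smooth_on (total_space (tube_dom I)) \<Phi> \<and>
      (\<forall>x\<in>total_space (tube_dom I).
        ricci g x = \<Lambda> *\<^sub>R g x + \<Phi> x *\<^sub>R symprod (pullback lam x) (pullback lam x)))"
proof -
  note I = assms(1)
  define D where "D h y = frechet_derivative h (at y) 1" for h :: "real \<Rightarrow> real" and y
  have D: "(h has_real_derivative D h y) (at y)" "smooth_on I (D h)" if "smooth_on I h" "y \<in> I" for h y
    using smooth_on_has_real_derivative[OF that] smooth_on_frechet[OF that(1), of 1] unfolding D_def by auto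
  have Ds: "smooth_on I (D h)" if "smooth_on I h" for h
    using smooth_on_frechet[OF that, of 1] unfolding D_def .
  define f where "f = D F"
  have f: "smooth_on I f" unfolding f_def by (rule Ds[OF assms(3)])
  have dF: "(F has_real_derivative f y) (at y)" if "y \<in> I" for y unfolding f_def by (rule D(1)[OF assms(3) that])
  have "D f y \<noteq> 0" if "y \<in> I" for y
    using strictly_pseudoconvex_tube_imp[OF I f dF assms(4) that D(1)[OF f that]] .
  from nonzero_on_interval_sign[OF assms(2) smooth_on_continuous[OF Ds[OF f]] this]
  obtain \<epsilon> where eps: "\<epsilon> = 1 \<or> \<epsilon> = -1" and gpos: "\<And>t. t \<in> I \<Longrightarrow> \<epsilon> * D f t > 0" by blast
  have eps2: "\<epsilon> * \<epsilon> = 1" using eps by auto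
  define g where "g t = \<epsilon> * D f t" for t
  have gpos: "g t > 0" if "t \<in> I" for t using gpos[OF that] by (simp add: g_def)
  have Df: "D f t = \<epsilon> * g t" for t using eps2 by (simp add: g_def mult.assoc[symmetric])
  have g: "smooth_on I g" unfolding g_def[abs_def] by (intro smooth_on_mult I smooth_on_const Ds f)
  \<comment> \<open>\<open>e\<close> is the logarithmic derivative of \<open>F''\<close>, and
    \<open>A\<close> a quarter of its derivative.\<close>
  define e where "e t = D g t / g t" for t
  have e: "smooth_on I e" unfolding e_def[abs_def] by (intro smooth_on_divide I Ds g) (use gpos in force)
  define A where "A t = D e t / 4" for t
  have A: "smooth_on I A" unfolding A_def[abs_def] by (intro smooth_on_divide I Ds e smooth_on_const) auto
  from positive_solution_exists[OF I assms(2) smooth_on_continuous[OF A] D(1)[OF g] gpos smooth_on_continuous[OF Ds[OF g]], of \<Lambda>]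
  obtain N u v where N: "N \<noteq> 0" and uv: "\<And>t. t \<in> I \<Longrightarrow> u t > 0" "\<And>t. t \<in> I \<Longrightarrow> (u has_real_derivative v t) (at t)"
    "\<And>t. t \<in> I \<Longrightarrow> (v has_real_derivative A t * u t + g t * (N / u t ^ 3 + \<Lambda> / 3 * u t ^ 3)) (at t)" by blast
  have su: "smooth_on I u" and sv: "smooth_on I v" using positive_solution_smooth[OF I A g uv] by auto
  define M where "M = 4 * \<epsilon> * N"
  \<comment> \<open>The substitution is undone with \<open>p = u\<close>: \<open>q\<close> comes
    from \<open>F'' = 2 q S\<close>, \<open>a\<close> is \<open>q'/q\<close>, and \<open>V\<close>
    is \<open>S'/q\<close>. In \<open>K = - a'/(2 q)\<close> the derivative of \<open>v\<close> has
    been replaced by means of the equation.\<close>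
  define q where "q t = g t / (2 * u t ^ 2)" for t
  define a where "a t = e t - 2 * v t / u t" for t
  define S where "S t = \<epsilon> * u t ^ 2" for t
  define V where "V t = 4 * \<epsilon> * u t ^ 3 * v t / g t" for t
  define K where "K t = - (A t - g t * (N / u t ^ 4 + \<Lambda> / 3 * u t ^ 2) + (v t / u t) ^ 2) / q t" for t
  define L where "L t = D K t / q t" for t
  define L1 where "L1 t = D L t / q t" for t
  have nz: "u t \<noteq> 0" "g t \<noteq> 0" "\<epsilon> \<noteq> 0" "q t > 0" if "t \<in> I" for t
    using uv(1)[OF that] gpos[OF that] eps by (auto simp: q_def)
  have sq: "smooth_on I q" unfolding q_def[abs_def]
    by (intro smooth_on_divide I g smooth_on_mult smooth_on_power su smooth_on_const) (use nz in auto)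
  have sa: "smooth_on I a" unfolding a_def[abs_def]
    by (intro smooth_on_diff smooth_on_divide I e smooth_on_mult sv su smooth_on_const) (use nz in auto)
  have sS: "smooth_on I S" unfolding S_def[abs_def]
    by (intro smooth_on_mult smooth_on_power I su smooth_on_const)
  have sV: "smooth_on I V" unfolding V_def[abs_def]
    by (intro smooth_on_divide smooth_on_mult smooth_on_power I su sv g smooth_on_const) (use nz in auto)
  have sK: "smooth_on I K" unfolding K_def[abs_def]
    by (intro smooth_on_divide smooth_on_minus smooth_on_add smooth_on_diff smooth_on_mult smooth_on_power I su sv g A sq smooth_on_const)
       (use nz in \<open>auto simp: less_imp_neq[symmetric]\<close>)
  have sL: "smooth_on I L" unfolding L_def[abs_def]
    by (intro smooth_on_divide I Ds sK sq) (use nz in force)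
  have sL1: "smooth_on I L1" unfolding L1_def[abs_def]
    by (intro smooth_on_divide I Ds sL sq) (use nz in force)
  interpret tube_lift I q a S V K L L1 f M \<Lambda> F
  proof
    fix y assume y: "y \<in> I"
    note nz = nz[OF y]
    have dg: "(g has_real_derivative e y * g y) (at y)" using D(1)[OF g y] nz by (simp add: e_def)
    have de: "(e has_real_derivative 4 * A y) (at y)" using D(1)[OF e y] by (simp add: A_def)
    note du = uv(2)[OF y] and dv = uv(3)[OF y]
    show "q y > 0" "S y \<noteq> 0" using nz by (auto simp: S_def)
    show "(S has_real_derivative q y * V y) (at y)"
      unfolding S_def[abs_def] using nz
      by (auto intro!: derivative_eq_intros du simp: q_def V_def field_simps eval_nat_numeral)
    show "(q has_real_derivative q y * a y) (at y)"
      unfolding q_def[abs_def] using nz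
      by (auto intro!: derivative_eq_intros du dg simp: a_def field_simps eval_nat_numeral)
    show "(a has_real_derivative - (2 * q y * K y)) (at y)"
      unfolding a_def[abs_def] using nz
      by (auto intro!: derivative_eq_intros du dv de simp: K_def field_simps eval_nat_numeral)
    show "(V has_real_derivative 2 * (M - K y * S y + 4 * \<Lambda> * S y ^ 3 / 3) - a y * V y) (at y)"
    proof (rule DERIV_cong)
      show "(V has_real_derivative 12 * \<epsilon> * u y ^ 2 * v y ^ 2 / g y
          + 4 * \<epsilon> * u y ^ 3 * (A y * u y + g y * (N / u y ^ 3 + \<Lambda> / 3 * u y ^ 3)) / g y - V y * e y) (at y)"
        unfolding V_def[abs_def] using nz
        by (auto intro!: derivative_eq_intros du dv dg simp: field_simps eval_nat_numeral)
      have "S y ^ 3 = \<epsilon> * u y ^ 6" using eps by (auto simp: S_def power_mult[symmetric])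
      then show "12 * \<epsilon> * u y ^ 2 * v y ^ 2 / g y
          + 4 * \<epsilon> * u y ^ 3 * (A y * u y + g y * (N / u y ^ 3 + \<Lambda> / 3 * u y ^ 3)) / g y - V y * e y
        = 2 * (M - K y * S y + 4 * \<Lambda> * S y ^ 3 / 3) - a y * V y"
        using nz by (simp add: M_def K_def S_def q_def a_def V_def field_simps eval_nat_numeral)
    qed
    show "(K has_real_derivative q y * L y) (at y)" using D(1)[OF sK y] nz by (simp add: L_def)
    show "(L has_real_derivative q y * L1 y) (at y)" using D(1)[OF sL y] nz by (simp add: L1_def)
    show "(f has_real_derivative 2 * q y * S y) (at y)"
      using D(1)[OF f y] nz by (simp add: Df q_def S_def field_simps)
    show "(F has_real_derivative f y) (at y)" by (rule dF[OF y])
  qed (use I sq sa sS sV sK sL sL1 f N eps in \<open>auto simp: M_def\<close>)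
  show ?thesis using is_lift_g petrov_g smooth_Phi ricci_lift unfolding total_space_tube_dom by blast
qed

end
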